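(* Let $0<\lambda<1$ and $g\in H(\mathbb{D})$. If $I_g$ is a bounded operator on $\mathcal{L}^{2,\lambda}(\mathbb{D})$, then $\|I_g\|_e\approx\|g\|_\infty$, where $\|g\|_\infty=\sup_{z\in\mathbb{D}}|g(z)|$.
   Context: $\mathbb{D}$ is the open unit disc, $H(\mathbb{D})$ the analytic functions on $\mathbb{D}$, $dA=\frac{1}{\pi}dx\,dy$. For $g\in H(\mathbb{D})$, $I_gf(z)=\int_0^z f'(w)g(w)\,dw$. For an arc $I\subset\partial\mathbb{D}$, $|I|=\frac{1}{2\pi}\int_I|d\zeta|$, $f_I=\frac{1}{|I|}\int_I f(\zeta)\frac{|d\zeta|}{2\pi}$, $S(I)=\{z\in\mathbb{D}:1-|I|\le |z|<1,\ z/|z|\in I\}$. For $0<\lambda\le1$, $\mathcal{L}^{2,\lambda}(\mathbb{D})$ is the set of $f$ in the Hardy space $H^2(\mathbb{D})$ with $\sup_{I}\big(|I|^{-\lambda}\int_I|f(\zeta)-f_I|^2\frac{|d\zeta|}{2\pi}\big)^{1/2}<\infty$, normed by $\|f\|_{\mathcal{L}^{2,\lambda}}=|f(0)|+\sup_{I}\big(|I|^{-\lambda}\int_{S(I)}|f'(z)|^2(1-|z|^2)dA(z)\big)^{1/2}$. For a bounded linear operator $T$ on a Banach space $X$, the essential norm is $\|T\|_e=\inf\{\|T-K\|: K \text{ compact operator on } X\}$. $A\approx B$ means $A\lesssim B\lesssim A$ with constants depending only on $\lambda$. *)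

theory Defs
  imports "HOL-Complex_Analysis.Complex_Analysis"
begin

text \<open>The unit disc is ball 0 1. Arcs I of the unit circle are parametrised by
  a starting angle a and an angular length l with 0 < l \<le> 2 pi; then |I| = l/(2 pi).\<close>

definition arc_params :: "(real \<times> real) set" where
  "arc_params = {(a, l). 0 < l \<and> l \<le> 2 * pi}"

definition hardy2 :: "(complex \<Rightarrow> complex) set" where
  "hardy2 = {f. f holomorphic_on ball 0 1 \<and>
     (\<exists>M. \<forall>r\<in>{0..<1}. (LINT t:{0..2*pi}|lborel. (cmod (f (of_real r * cis t)))\<^sup>2) / (2*pi) \<le> M)}"

definition bval :: "(complex \<Rightarrow> complex) \<Rightarrow> real \<Rightarrow> complex" where
  "bval f t = Lim (at_left 1) (\<lambda>r::real. f (of_real r * cis t))"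

definition arc_avg :: "(complex \<Rightarrow> complex) \<Rightarrow> real \<Rightarrow> real \<Rightarrow> complex" where
  "arc_avg f a l = (1 / of_real (l / (2*pi))) * ((LINT t:{a..a+l}|lborel. bval f t) / of_real (2*pi))"

definition morrey :: "real \<Rightarrow> (complex \<Rightarrow> complex) set" where
  "morrey lam = {f. f \<in> hardy2 \<and>
     (\<exists>M. \<forall>(a, l)\<in>arc_params.
        (l / (2*pi)) powr (- lam) *
          ((LINT t:{a..a+l}|lborel. (cmod (bval f t - arc_avg f a l))\<^sup>2) / (2*pi)) \<le> M)}"

definition carleson_box :: "real \<Rightarrow> real \<Rightarrow> complex set" where
  "carleson_box a l = {z. 1 - l / (2*pi) \<le> cmod z \<and> cmod z < 1 \<and>
      (\<exists>t\<in>{a..a+l}. z / of_real (cmod z) = cis t)}"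

text \<open>Integral of |f'|^2 (1-|z|^2) dA over S(I), with dA = dx dy / pi.\<close>
definition box_energy :: "(complex \<Rightarrow> complex) \<Rightarrow> real \<Rightarrow> real \<Rightarrow> ennreal" where
  "box_energy f a l = (\<integral>\<^sup>+ z\<in>carleson_box a l.
      ennreal ((cmod (deriv f z))\<^sup>2 * (1 - (cmod z)\<^sup>2) / pi) \<partial>lborel)"

definition morrey_norm :: "real \<Rightarrow> (complex \<Rightarrow> complex) \<Rightarrow> real" where
  "morrey_norm lam f = cmod (f 0) + sqrt (enn2real
     (SUP (a, l)\<in>arc_params. ennreal ((l / (2*pi)) powr (- lam)) * box_energy f a l))"

definition Ig :: "(complex \<Rightarrow> complex) \<Rightarrow> (complex \<Rightarrow> complex) \<Rightarrow> complex \<Rightarrow> complex" where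
  "Ig g f = (\<lambda>z. contour_integral (linepath 0 z) (\<lambda>w. deriv f w * g w))"

definition bounded_op_on :: "real \<Rightarrow> ((complex \<Rightarrow> complex) \<Rightarrow> (complex \<Rightarrow> complex)) \<Rightarrow> bool" where
  "bounded_op_on lam T \<longleftrightarrow> (\<forall>f\<in>morrey lam. T f \<in> morrey lam) \<and>
     (\<exists>C. \<forall>f\<in>morrey lam. morrey_norm lam (T f) \<le> C * morrey_norm lam f)"

definition op_norm :: "real \<Rightarrow> ((complex \<Rightarrow> complex) \<Rightarrow> (complex \<Rightarrow> complex)) \<Rightarrow> real" where
  "op_norm lam T = Inf {C. 0 \<le> C \<and> (\<forall>f\<in>morrey lam. morrey_norm lam (T f) \<le> C * morrey_norm lam f)}"

definition compact_op_on :: "real \<Rightarrow> ((complex \<Rightarrow> complex) \<Rightarrow> (complex \<Rightarrow> complex)) \<Rightarrow> bool" where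
  "compact_op_on lam K \<longleftrightarrow>
     (\<forall>f\<in>morrey lam. K f \<in> morrey lam) \<and>
     (\<forall>f\<in>morrey lam. \<forall>h\<in>morrey lam. \<forall>c::complex.
        K (\<lambda>z. f z + h z) = (\<lambda>z. K f z + K h z) \<and> K (\<lambda>z. c * f z) = (\<lambda>z. c * K f z)) \<and>
     (\<forall>s::nat \<Rightarrow> complex \<Rightarrow> complex. (\<forall>n. s n \<in> morrey lam) \<and>
        (\<exists>B. \<forall>n. morrey_norm lam (s n) \<le> B) \<longrightarrow>
        (\<exists>r h. strict_mono r \<and> h \<in> morrey lam \<and>
           (\<lambda>k. morrey_norm lam (\<lambda>z. K (s (r k)) z - h z)) \<longlonglongrightarrow> 0))"

definition ess_norm :: "real \<Rightarrow> ((complex \<Rightarrow> complex) \<Rightarrow> (complex \<Rightarrow> complex)) \<Rightarrow> real" where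
  "ess_norm lam T = Inf {op_norm lam (\<lambda>f z. T f z - K f z) | K. compact_op_on lam K}"

end

theory Submission
  imports Defs
begin

text \<open>
The upper bound is immediate, as \<open>(Ig g f)' = f' g\<close>. For the lower bound take
\<open>f_w(z) = (1 - |w|)^((1+lam)/2) (1/(1 - cnj w z) - 1)\<close>: its energy on a box of size \<open>s\<close> is at most
\<open>4 s^lam (min (d/s) (s/d))^lam\<close>, \<open>d = 1 - |w|\<close>, so along a sequence with lacunary \<open>d\<close>
all finite sums are bounded. A compact operator must then send a subsequence to zero in norm: a
nonzero limit \<open>h\<close> of \<open>K f_k\<close> would make \<open>K (f_1 + ... + f_n)\<close>, which is close to \<open>n h\<close>, unbounded. On the other hand the
submean value property at \<open>w\<close> gives \<open>\<parallel>Ig g f_w\<parallel> \<ge> |g w| / 32\<close>.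

The norm of the statement is computed with junk value \<open>0\<close> when the box energies are unbounded, so all of this rests
on their being bounded for every function of the space, whose definition only speaks of radial boundary values.
This uses Fatou's theorem for \<open>H\<^sup>2\<close> (Vitali covering and a weak type inequality), and the
identity \<open>f' = (1 - cnj w z) h' - cnj w h\<close> for \<open>h = (f - c)/(1 - cnj w z)\<close>, which bounds the energy of a box of size \<open>s\<close>
with top centre \<open>w\<close> by \<open>s\<^sup>2 \<parallel>h\<parallel>\<^sup>2\<close> in \<open>H\<^sup>2\<close>.
\<close>

section \<open>Polar coordinates\<close>

text \<open>A single bound for all finite sums of test functions does the work of weak convergence
  to 0. It rests on two energy estimates, with \<open>d = 1 - |w|\<close>: at most
  \<open>d^lam\<close> from the whole disc, used when \<open>s >= d\<close>, and at most
  \<open>4 s^3 d^(lam-3)\<close> from the pointwise size of the derivative, used when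
  \<open>s < d\<close>. Divided by \<open>s^lam\<close>, both decay geometrically away from
  \<open>s = d\<close>, so the sum over lacunary \<open>d\<close> is bounded uniformly in the box.
  The ratio of the \<open>d\<close> depends on \<open>lam\<close>, the constants do not. The points
  \<open>w\<close> have prescribed modulus and must still see the size of \<open>g\<close>: the
  maximum principle on a circle around \<open>z0\<close> gives \<open>|g w| >= |g z0|\<close>. The
  outcome is a pointwise bound for \<open>g\<close>, which for \<open>K = 0\<close> also shows that
  \<open>g\<close> is bounded. For the box energies, the average over one arc has to be compared
  with \<open>f\<close> far away from that arc. Averages over doubled arcs drift by at most a fixed
  amount per step, because \<open>lam < 1\<close>, and the kernel decays faster than this drift
  grows. Operator norms are real infima, so compact operators must first be shown bounded; norm
  estimates pass through the relation \<open>box_bound\<close>, in which a junk value cannot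
  occur.\<close>

lemma Complex_measurable[measurable (raw)]:
  assumes [measurable]: "h \<in> borel_measurable M" "k \<in> borel_measurable M"
  shows "(\<lambda>x. Complex (h x) (k x)) \<in> borel_measurable M"
  unfolding Complex_eq by measurable

text \<open>Lebesgue measure on the plane is determined by its values on open boxes; the image of
  the product measure under \<open>Complex\<close> has the right ones, and Tonelli does the
  rest.\<close>

lemma nn_integral_lborel_complex:
  fixes u :: "complex \<Rightarrow> ennreal"
  assumes [measurable]: "u \<in> borel_measurable borel"
  shows "(\<integral>\<^sup>+z. u z \<partial>lborel) = (\<integral>\<^sup>+x. \<integral>\<^sup>+y. u (Complex x y) \<partial>lborel \<partial>lborel)"
proof -
  have [measurable]: "(\<lambda>p. Complex (fst p) (snd p)) \<in> borel_measurable borel"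
    by (simp flip: borel_prod)
  have eq: "lborel = distr (lborel \<Otimes>\<^sub>M lborel) borel (\<lambda>p. Complex (fst p) (snd p))"
  proof (rule lborel_eqI)
    fix l v :: complex
    assume lv: "\<And>b. b \<in> Basis \<Longrightarrow> l \<bullet> b \<le> v \<bullet> b"
    have B: "(Basis :: complex set) = {1, \<i>}" by (simp add: Basis_complex_def)
    have le: "Re l \<le> Re v" "Im l \<le> Im v" using lv[of 1] lv[of \<i>] by (auto simp: B)
    have pre: "(\<lambda>p. Complex (fst p) (snd p)) -` box l v \<inter> space (lborel \<Otimes>\<^sub>M lborel)
        = {Re l<..<Re v} \<times> {Im l<..<Im v}"
      by (auto simp: box_def B space_pair_measure)
    have "emeasure (distr (lborel \<Otimes>\<^sub>M lborel) borel (\<lambda>p. Complex (fst p) (snd p))) (box l v)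
      = emeasure (lborel \<Otimes>\<^sub>M lborel) ({Re l<..<Re v} \<times> {Im l<..<Im v})"
      by (subst emeasure_distr) (simp_all only: pre, auto simp: lborel_prod)
    also have "\<dots> = ennreal (Re v - Re l) * ennreal (Im v - Im l)"
      by (subst lborel.emeasure_pair_measure_Times) (auto simp: le)
    also have "\<dots> = ennreal (\<Prod>b\<in>Basis. (v - l) \<bullet> b)"
      using le by (simp add: B ennreal_mult)
    finally show "emeasure (distr (lborel \<Otimes>\<^sub>M lborel) borel (\<lambda>p. Complex (fst p) (snd p))) (box l v)
      = ennreal (\<Prod>b\<in>Basis. (v - l) \<bullet> b)" .
  qed auto
  have "(\<integral>\<^sup>+z. u z \<partial>lborel) = (\<integral>\<^sup>+p. u (Complex (fst p) (snd p)) \<partial>(lborel \<Otimes>\<^sub>M lborel))"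
    by (subst eq, subst nn_integral_distr) (auto simp: lborel_prod)
  also have "\<dots> = (\<integral>\<^sup>+x. \<integral>\<^sup>+y. u (Complex x y) \<partial>lborel \<partial>lborel)"
    by (subst lborel.nn_integral_fst[symmetric]) (auto simp: lborel_prod)
  finally show ?thesis .
qed

text \<open>In polar coordinates \<open>v\<close> is the slope of a line through the origin and
  \<open>t\<close> its angle. The substitution is made on compact intervals whose endpoints have
  tangent \<open>n+1\<close> in modulus, away from the poles, and monotone convergence fills up both
  sides.\<close>

lemma nn_integral_tan:
  fixes f :: "real \<Rightarrow> ennreal"
  assumes [measurable]: "f \<in> borel_measurable borel"
  shows "(\<integral>\<^sup>+v. f v \<partial>lborel) = (\<integral>\<^sup>+t\<in>{-pi/2<..<pi/2}. f (tan t) * ennreal (1 / (cos t)\<^sup>2) \<partial>lborel)"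
proof -
  define b where "b n = arctan (real n + 1)" for n
  have b: "0 < b n" "b n < pi/2" for n
    using arctan_ubound[of "real n + 1"] by (auto simp: b_def)
  have tb: "tan (b n) = real n + 1" for n by (simp add: b_def tan_arctan)
  have cp: "cos x > 0" if "x \<in> {- b n..b n}" for x n
    using that b[of n] by (intro cos_gt_zero_pi) auto
  have step: "(\<integral>\<^sup>+v. f v * indicator {-(real n+1)..real n+1} v \<partial>lborel) =
     (\<integral>\<^sup>+t. f (tan t) * ennreal (1 / (cos t)\<^sup>2) * indicator {-b n..b n} t \<partial>lborel)" for n
  proof -
    have "(\<integral>\<^sup>+v. f v * indicator {tan (- b n)..tan (b n)} v \<partial>lborel) =
     (\<integral>\<^sup>+t. f (tan t) * ennreal (1 / (cos t)\<^sup>2) * indicator {-b n..b n} t \<partial>lborel)"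
    proof (rule nn_integral_substitution_aux)
      show "(tan has_real_derivative 1 / (cos x)\<^sup>2) (at x)" if "x \<in> {- b n..b n}" for x
        using DERIV_tan[of x] cp[OF that] by (simp add: divide_inverse power_inverse)
      show "continuous_on {- b n..b n} (\<lambda>x. 1 / (cos x)\<^sup>2)"
        by (intro continuous_intros) (use cp in force)
    qed (use b[of n] in auto)
    then show ?thesis by (simp add: tb)
  qed
  have i1: "(SUP n. f v * indicator {-(real n+1)..real n+1} v) = f v" for v
  proof -
    have "(SUP n. f v * indicator {-(real n+1)..real n+1} v) = f v * (SUP n. indicator {-(real n+1)..real n+1} v)"
      by (simp add: SUP_mult_left_ennreal)
    also have "(SUP n. indicator {-(real n+1)..real n+1} v) = (1::ennreal)"
    proof (rule antisym)
      obtain n where "real n \<ge> \<bar>v\<bar>" using real_arch_simple by blast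
      then have "indicator {-(real n+1)..real n+1} v = (1::ennreal)" by (auto simp: indicator_def)
      then show "1 \<le> (SUP n. indicator {-(real n+1)..real n+1} v :: ennreal)"
        by (intro SUP_upper2[of n]) auto
    qed (auto intro!: SUP_least simp: indicator_def)
    finally show ?thesis by simp
  qed
  have bmono: "mono b" unfolding b_def by (intro monoI) (simp add: arctan_le_iff)
  have i2: "(SUP n. g t * indicator {-b n..b n} t) = g t * indicator {-pi/2<..<pi/2} t"
    for g :: "real \<Rightarrow> ennreal" and t
  proof -
    have "(SUP n. g t * indicator {-b n..b n} t) = g t * (SUP n. indicator {-b n..b n} t)"
      by (simp add: SUP_mult_left_ennreal)
    also have "(SUP n. indicator {-b n..b n} t) = (indicator {-pi/2<..<pi/2} t::ennreal)"
    proof (rule antisym)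
      show "(SUP n. indicator {-b n..b n} t) \<le> (indicator {-pi/2<..<pi/2} t::ennreal)"
      proof (rule SUP_least)
        fix n
        show "indicator {-b n..b n} t \<le> (indicator {-pi/2<..<pi/2} t::ennreal)"
          using b[of n] by (auto simp: indicator_def)
      qed
      show "(indicator {-pi/2<..<pi/2} t::ennreal) \<le> (SUP n. indicator {-b n..b n} t)"
      proof (cases "t \<in> {-pi/2<..<pi/2}")
        case True
        obtain n where n: "real n \<ge> \<bar>tan t\<bar>" using real_arch_simple by blast
        have "arctan (tan t) = t" using True by (intro arctan_tan) auto
        moreover have "arctan (tan t) \<le> b n" "arctan (- (real n + 1)) \<le> arctan (tan t)"
          unfolding b_def using n by (auto simp: arctan_le_iff)
        moreover have "arctan (- (real n + 1)) = - b n" unfolding b_def by (rule arctan_minus)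
        ultimately have "t \<in> {-b n..b n}" by auto
        then show ?thesis by (intro SUP_upper2[of n]) (auto simp: indicator_def)
      qed simp
    qed
    finally show ?thesis .
  qed
  have "(\<integral>\<^sup>+v. f v \<partial>lborel) = (SUP n. \<integral>\<^sup>+v. f v * indicator {-(real n+1)..real n+1} v \<partial>lborel)"
  proof (subst nn_integral_monotone_convergence_SUP[symmetric])
    show "incseq (\<lambda>n v. f v * indicator {-(real n+1)..real n+1} v)"
      by (auto simp: incseq_def le_fun_def indicator_def)
  qed (simp_all only: i1, measurable)
  also have "\<dots> = (SUP n. \<integral>\<^sup>+t. f (tan t) * ennreal (1 / (cos t)\<^sup>2) * indicator {-b n..b n} t \<partial>lborel)"
    by (simp only: step)
  also have "\<dots> = (\<integral>\<^sup>+t\<in>{-pi/2<..<pi/2}. f (tan t) * ennreal (1 / (cos t)\<^sup>2) \<partial>lborel)"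
  proof (subst nn_integral_monotone_convergence_SUP[symmetric])
    show "incseq (\<lambda>n t. f (tan t) * ennreal (1 / (cos t)\<^sup>2) * indicator {-b n..b n} t)"
      using bmono by (auto simp: incseq_def le_fun_def indicator_def mono_def)
         (meson minus_le_iff neg_le_iff_le order_trans)+
    show "(\<lambda>t. f (tan t) * ennreal (1 / (cos t)\<^sup>2) * indicator {-b n..b n} t) \<in> borel_measurable lborel" for n
      unfolding tan_def by measurable
  qed (simp only: i2[of "\<lambda>t. f (tan t) * ennreal (1 / (cos t)\<^sup>2)"])
  finally show ?thesis .
qed

lemma AE_lborel_neq: "AE x in lborel. x \<noteq> (c::real)"
  by (rule AE_I[of _ _ "{c}"]) auto

text \<open>Translation by a multiple of \<open>2*pi\<close> brings the window to one that starts at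
  some \<open>b\<close> in \<open>[0, 2*pi)\<close>; the part beyond \<open>2*pi\<close> is then
  moved back to fill \<open>[0, b)\<close>.\<close>

lemma nn_integral_periodic_window:
  fixes p :: "real \<Rightarrow> ennreal"
  assumes [measurable]: "p \<in> borel_measurable borel" and per: "\<And>t. p (t + 2*pi) = p t"
  shows "(\<integral>\<^sup>+t\<in>{a..a+2*pi}. p t \<partial>lborel) = (\<integral>\<^sup>+t\<in>{0..2*pi}. p t \<partial>lborel)"
proof -
  have pern: "p (t + 2*pi*real n) = p t" for t n
    by (induction n) (use per[of "t + 2*pi*real _"] in \<open>auto simp: algebra_simps\<close>)
  have peri: "p (2*pi * real_of_int k + t) = p t" for t k
  proof (cases "k \<ge> 0")
    case True
    then show ?thesis using pern[of t "nat k"] by (simp add: algebra_simps)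
  next
    case False
    then show ?thesis using pern[of "2*pi * real_of_int k + t" "nat (-k)"] by (simp add: algebra_simps)
  qed
  \<comment> \<open>Half-open windows tile the line without overlap, so pieces can be cut and
    translated; the lost endpoint has measure zero.\<close>
  have co: "(\<integral>\<^sup>+t\<in>{c..d}. p t \<partial>lborel) = (\<integral>\<^sup>+t\<in>{c..<d}. p t \<partial>lborel)" for c d
    by (rule nn_integral_cong_AE) (use AE_lborel_neq[of d] in \<open>auto elim!: eventually_mono simp: indicator_def\<close>)
  have shift: "(\<integral>\<^sup>+t\<in>{c..<d}. p t \<partial>lborel) = (\<integral>\<^sup>+t\<in>{c - 2*pi * real_of_int k..<d - 2*pi * real_of_int k}. p t \<partial>lborel)" for c d k
    by (subst nn_integral_real_affine[of _ 1 "2*pi * real_of_int k"])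
       (use peri[of k] in \<open>auto simp: indicator_def add.commute less_diff_eq le_diff_eq diff_less_eq diff_le_eq intro!: nn_integral_cong\<close>)
  define k where "k = \<lfloor>a / (2*pi)\<rfloor>"
  define b where "b = a - 2*pi * real_of_int k"
  have "0 \<le> b" "b < 2*pi"
  proof -
    have "real_of_int k \<le> a / (2*pi)" "a / (2*pi) < real_of_int k + 1" unfolding k_def by linarith+
    then show "0 \<le> b" "b < 2*pi" unfolding b_def by (auto simp: field_simps)
  qed
  have "(\<integral>\<^sup>+t\<in>{a..a+2*pi}. p t \<partial>lborel) = (\<integral>\<^sup>+t\<in>{b..<b+2*pi}. p t \<partial>lborel)"
    unfolding co by (subst shift[of _ _ k]) (simp add: b_def algebra_simps)
  also have "\<dots> = (\<integral>\<^sup>+t. p t * indicator {b..<2*pi} t + p t * indicator {2*pi..<b+2*pi} t \<partial>lborel)"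
    using \<open>0 \<le> b\<close> \<open>b < 2*pi\<close> by (intro nn_integral_cong) (auto simp: indicator_def)
  also have "\<dots> = (\<integral>\<^sup>+t\<in>{b..<2*pi}. p t \<partial>lborel) + (\<integral>\<^sup>+t\<in>{2*pi..<b+2*pi}. p t \<partial>lborel)"
    by (rule nn_integral_add) auto
  also have "(\<integral>\<^sup>+t\<in>{2*pi..<b+2*pi}. p t \<partial>lborel) = (\<integral>\<^sup>+t\<in>{0..<b}. p t \<partial>lborel)"
    by (subst shift[of _ _ 1]) simp
  also have "(\<integral>\<^sup>+t\<in>{b..<2*pi}. p t \<partial>lborel) + \<dots> =
     (\<integral>\<^sup>+t. p t * indicator {b..<2*pi} t + p t * indicator {0..<b} t \<partial>lborel)"
    by (rule nn_integral_add[symmetric]) auto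
  also have "\<dots> = (\<integral>\<^sup>+t\<in>{0..<2*pi}. p t \<partial>lborel)"
    using \<open>0 \<le> b\<close> \<open>b < 2*pi\<close> by (intro nn_integral_cong) (auto simp: indicator_def)
  finally show ?thesis by (simp add: co)
qed

lemma cis_measurable[measurable]: "cis \<in> borel_measurable borel"
  by (intro borel_measurable_continuous_onI continuous_intros)

text \<open>Only one-dimensional substitutions occur: \<open>y = x v\<close> contributes
  \<open>x\<close>, \<open>v = tan t\<close> contributes \<open>1 / cos^2 t\<close>, and
  \<open>x = r cos t\<close> contributes \<open>cos t\<close>. With \<open>x = r cos t\<close>
  inserted, the product of the three factors is \<open>r\<close>.\<close>

lemma polar_half_plane:
  fixes u :: "complex \<Rightarrow> ennreal"
  assumes [measurable]: "u \<in> borel_measurable borel"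
  shows "(\<integral>\<^sup>+x\<in>{0<..}. (\<integral>\<^sup>+y. u (Complex x y) \<partial>lborel) \<partial>lborel) =
    (\<integral>\<^sup>+t\<in>{-pi/2<..<pi/2}. (\<integral>\<^sup>+r\<in>{0<..}. ennreal r * u (of_real r * cis t) \<partial>lborel) \<partial>lborel)"
proof -
  have "(\<integral>\<^sup>+x\<in>{0<..}. (\<integral>\<^sup>+y. u (Complex x y) \<partial>lborel) \<partial>lborel) =
     (\<integral>\<^sup>+x. (\<integral>\<^sup>+v. ennreal x * u (Complex x (x * v)) * indicator {0<..} x \<partial>lborel) \<partial>lborel)"
  proof (intro nn_integral_cong)
    fix x :: real
    show "(\<integral>\<^sup>+y. u (Complex x y) \<partial>lborel) * indicator {0<..} x =
      (\<integral>\<^sup>+v. ennreal x * u (Complex x (x * v)) * indicator {0<..} x \<partial>lborel)"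
    proof (cases "x > 0")
      case True
      then show ?thesis
        by (subst nn_integral_real_affine[of _ x 0]) (auto simp: nn_integral_cmult)
    qed simp
  qed
  also have "\<dots> = (\<integral>\<^sup>+v. (\<integral>\<^sup>+x. ennreal x * u (Complex x (x * v)) * indicator {0<..} x \<partial>lborel) \<partial>lborel)"
    by (rule lborel_pair.Fubini') measurable
  also have "\<dots> = (\<integral>\<^sup>+t\<in>{-pi/2<..<pi/2}. (\<integral>\<^sup>+x. ennreal x * u (Complex x (x * tan t)) * indicator {0<..} x \<partial>lborel)
       * ennreal (1 / (cos t)\<^sup>2) \<partial>lborel)"
    by (rule nn_integral_tan) measurable
  also have "\<dots> = (\<integral>\<^sup>+t\<in>{-pi/2<..<pi/2}. (\<integral>\<^sup>+r\<in>{0<..}. ennreal r * u (of_real r * cis t) \<partial>lborel) \<partial>lborel)"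
  proof (intro nn_integral_cong)
    fix t :: real
    show "(\<integral>\<^sup>+x. ennreal x * u (Complex x (x * tan t)) * indicator {0<..} x \<partial>lborel)
       * ennreal (1 / (cos t)\<^sup>2) * indicator {-pi/2<..<pi/2} t =
       (\<integral>\<^sup>+r\<in>{0<..}. ennreal r * u (of_real r * cis t) \<partial>lborel) * indicator {-pi/2<..<pi/2} t"
    proof (cases "t \<in> {-pi/2<..<pi/2}")
      case True
      then have cp: "cos t > 0" by (intro cos_gt_zero_pi) auto
      have "(\<integral>\<^sup>+x. ennreal x * u (Complex x (x * tan t)) * indicator {0<..} x \<partial>lborel) =
         ennreal (cos t) * (\<integral>\<^sup>+r. ennreal (cos t * r) * u (Complex (cos t * r) (cos t * r * tan t)) * indicator {0<..} (cos t * r) \<partial>lborel)"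
        using cp by (subst nn_integral_real_affine[of _ "cos t" 0]) auto
      also have "(\<integral>\<^sup>+r. ennreal (cos t * r) * u (Complex (cos t * r) (cos t * r * tan t)) * indicator {0<..} (cos t * r) \<partial>lborel)
        = (\<integral>\<^sup>+r. ennreal (cos t) * (ennreal r * u (of_real r * cis t) * indicator {0<..} r) \<partial>lborel)"
      proof (intro nn_integral_cong)
        fix r :: real
        have "Complex (cos t * r) (cos t * r * tan t) = of_real r * cis t"
          using cp by (simp add: complex_eq_iff tan_def)
        then show "ennreal (cos t * r) * u (Complex (cos t * r) (cos t * r * tan t)) * indicator {0<..} (cos t * r)
          = ennreal (cos t) * (ennreal r * u (of_real r * cis t) * indicator {0<..} r)"
          using cp by (auto simp: indicator_def ennreal_mult zero_less_mult_iff mult.assoc)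
      qed
      also have "\<dots> = ennreal (cos t) * (\<integral>\<^sup>+r\<in>{0<..}. ennreal r * u (of_real r * cis t) \<partial>lborel)"
        by (rule nn_integral_cmult) measurable
      finally have e: "(\<integral>\<^sup>+x. ennreal x * u (Complex x (x * tan t)) * indicator {0<..} x \<partial>lborel) * ennreal (1 / (cos t)\<^sup>2)
        = (ennreal (cos t) * ennreal (cos t) * ennreal (1 / (cos t)\<^sup>2)) * (\<integral>\<^sup>+r\<in>{0<..}. ennreal r * u (of_real r * cis t) \<partial>lborel)"
        by (simp add: mult_ac)
      have "ennreal (cos t) * ennreal (cos t) * ennreal (1 / (cos t)\<^sup>2) = 1"
        using cp by (simp add: ennreal_mult[symmetric] power2_eq_square)
      then show ?thesis using e by simp
    qed simp
  qed
  finally show ?thesis .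
qed

text \<open>The left half-plane is the image of the right one under \<open>z -> -z\<close>, which
  adds \<open>pi\<close> to the angle; the imaginary axis is a null set. The free starting angle
  \<open>a\<close> allows a window centred at a given arc.\<close>

lemma nn_integral_polar:
  fixes u :: "complex \<Rightarrow> ennreal"
  assumes [measurable]: "u \<in> borel_measurable borel"
  shows "(\<integral>\<^sup>+z. u z \<partial>lborel) =
    (\<integral>\<^sup>+t\<in>{a..a+2*pi}. (\<integral>\<^sup>+r\<in>{0<..}. ennreal r * u (of_real r * cis t) \<partial>lborel) \<partial>lborel)"
proof -
  define P where "P t = (\<integral>\<^sup>+r\<in>{0<..}. ennreal r * u (of_real r * cis t) \<partial>lborel)" for t
  have [measurable]: "P \<in> borel_measurable borel" unfolding P_def by measurable
  have "(\<integral>\<^sup>+z. u z \<partial>lborel) = (\<integral>\<^sup>+x. (\<integral>\<^sup>+y. u (Complex x y) \<partial>lborel) \<partial>lborel)"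
    by (rule nn_integral_lborel_complex) measurable
  also have "\<dots> = (\<integral>\<^sup>+x. (\<integral>\<^sup>+y. u (Complex x y) \<partial>lborel) * indicator {0<..} x +
     (\<integral>\<^sup>+y. u (Complex x y) \<partial>lborel) * indicator {..<0} x \<partial>lborel)"
    by (rule nn_integral_cong_AE) (use AE_lborel_neq[of 0] in \<open>auto elim!: eventually_mono simp: indicator_def\<close>)
  also have "\<dots> = (\<integral>\<^sup>+x\<in>{0<..}. (\<integral>\<^sup>+y. u (Complex x y) \<partial>lborel) \<partial>lborel) +
      (\<integral>\<^sup>+x\<in>{..<0}. (\<integral>\<^sup>+y. u (Complex x y) \<partial>lborel) \<partial>lborel)"
    by (rule nn_integral_add) measurable
  also have "(\<integral>\<^sup>+x\<in>{..<0}. (\<integral>\<^sup>+y. u (Complex x y) \<partial>lborel) \<partial>lborel) =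
     (\<integral>\<^sup>+x. (\<integral>\<^sup>+y. u (Complex (-x) y) \<partial>lborel) * indicator {..<0} (-x) \<partial>lborel)"
    by (subst nn_integral_real_affine[of _ "-1" 0]) auto
  also have "\<dots> = (\<integral>\<^sup>+x\<in>{0<..}. (\<integral>\<^sup>+y. u (- Complex x y) \<partial>lborel) \<partial>lborel)"
  proof (intro nn_integral_cong)
    fix x :: real
    have "(\<integral>\<^sup>+y. u (Complex (-x) y) \<partial>lborel) = (\<integral>\<^sup>+y. u (Complex (-x) (-y)) \<partial>lborel)"
      by (subst nn_integral_real_affine[of _ "-1" 0]) auto
    moreover have "Complex (-x) (-y) = - Complex x y" for y by (simp add: complex_eq_iff)
    ultimately show "(\<integral>\<^sup>+y. u (Complex (-x) y) \<partial>lborel) * indicator {..<0} (-x) =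
      (\<integral>\<^sup>+y. u (- Complex x y) \<partial>lborel) * indicator {0<..} x"
      by (auto simp: indicator_def)
  qed
  also have "\<dots> = (\<integral>\<^sup>+t\<in>{-pi/2<..<pi/2}. (\<integral>\<^sup>+r\<in>{0<..}. ennreal r * u (- (of_real r * cis t)) \<partial>lborel) \<partial>lborel)"
    by (rule polar_half_plane) measurable
  also have "\<dots> = (\<integral>\<^sup>+t\<in>{-pi/2<..<pi/2}. P (pi + t) \<partial>lborel)"
    unfolding P_def by (simp add: cis_mult[symmetric])
  also have "\<dots> = (\<integral>\<^sup>+t\<in>{pi/2<..<3*pi/2}. P t \<partial>lborel)"
    by (subst (2) nn_integral_real_affine[of _ 1 pi]) (auto simp: indicator_def intro!: nn_integral_cong)
  also have "(\<integral>\<^sup>+x\<in>{0<..}. (\<integral>\<^sup>+y. u (Complex x y) \<partial>lborel) \<partial>lborel) = (\<integral>\<^sup>+t\<in>{-pi/2<..<pi/2}. P t \<partial>lborel)"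
    unfolding P_def by (rule polar_half_plane) measurable
  also have "(\<integral>\<^sup>+t\<in>{-pi/2<..<pi/2}. P t \<partial>lborel) + (\<integral>\<^sup>+t\<in>{pi/2<..<3*pi/2}. P t \<partial>lborel) =
    (\<integral>\<^sup>+t. P t * indicator {-pi/2<..<pi/2} t + P t * indicator {pi/2<..<3*pi/2} t \<partial>lborel)"
    by (rule nn_integral_add[symmetric]) measurable
  also have "\<dots> = (\<integral>\<^sup>+t\<in>{-pi/2..-pi/2+2*pi}. P t \<partial>lborel)"
    by (rule nn_integral_cong_AE)
      (use AE_lborel_neq[of "-pi/2"] AE_lborel_neq[of "pi/2"] AE_lborel_neq[of "3*pi/2"]
        in \<open>eventually_elim, auto simp: indicator_def\<close>)
  also have "\<dots> = (\<integral>\<^sup>+t\<in>{0..2*pi}. P t \<partial>lborel)"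
    by (rule nn_integral_periodic_window) (auto simp: P_def cis_mult[symmetric])
  also have "\<dots> = (\<integral>\<^sup>+t\<in>{a..a+2*pi}. P t \<partial>lborel)"
    by (rule nn_integral_periodic_window[symmetric]) (auto simp: P_def cis_mult[symmetric])
  finally show ?thesis unfolding P_def .
qed

section \<open>Power series on circles\<close>

lemma cnj_measurable[measurable]: "cnj \<in> borel_measurable borel"
  by (intro borel_measurable_continuous_onI continuous_intros)

text \<open>Dominated interchange with majorant \<open>K * cmod (b n)\<close>. The bounded factor
  \<open>G\<close> stays general because Parseval's identity takes it once to be a character and
  once the sum of the series itself.\<close>

lemma set_lint_suminf:
  fixes G :: "real \<Rightarrow> complex" and e :: "nat \<Rightarrow> real \<Rightarrow> complex" and b :: "nat \<Rightarrow> complex"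
  assumes [measurable]: "G \<in> borel_measurable borel" "\<And>n. e n \<in> borel_measurable borel"
    and G: "\<And>t. cmod (G t) \<le> K" and e: "\<And>n t. cmod (e n t) \<le> 1"
    and b: "summable (\<lambda>n. cmod (b n))" and c: "0 \<le> c"
  shows "(LINT t:{0..c}|lborel. G t * (\<Sum>n. b n * e n t)) = (\<Sum>n. b n * (LINT t:{0..c}|lborel. G t * e n t))"
proof -
  let ?A = "{0..c}"
  define f where "f n t = indicator ?A t *\<^sub>R (G t * (b n * e n t))" for n t
  have K: "0 \<le> K" using G[of 0] norm_ge_zero order_trans by blast
  have nb: "cmod (G t * (b n * e n t)) \<le> K * cmod (b n)" for n t
  proof -
    have "cmod (G t * (b n * e n t)) = cmod (G t) * (cmod (b n) * cmod (e n t))"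
      by (simp add: norm_mult)
    also have "\<dots> \<le> K * (cmod (b n) * 1)"
      by (intro mult_mono G e K mult_left_mono) auto
    finally show ?thesis by simp
  qed
  have int: "integrable lborel (f n)" for n
    unfolding f_def by (rule integrableI_bounded_set_indicator[where B = "K * cmod (b n)"]) (use nb in \<open>auto simp: emeasure_lborel_Icc_eq\<close>)
  have sm: "summable (\<lambda>n. b n * e n t)" for t
    by (rule summable_norm_cancel, rule summable_comparison_test'[OF b, of 0])
       (use e in \<open>auto simp: norm_mult intro: mult_left_le\<close>)
  have smn: "summable (\<lambda>n. norm (f n t))" for t
    by (rule summable_comparison_test'[OF summable_mult[OF b, of K], of 0])
       (use nb K in \<open>auto simp: f_def indicator_def\<close>)
  have ib: "(\<integral>t. norm (f n t) \<partial>lborel) \<le> c * K * cmod (b n)" for n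
  proof -
    have "(\<integral>t. norm (f n t) \<partial>lborel) \<le> (\<integral>t. indicator ?A t *\<^sub>R (K * cmod (b n)) \<partial>lborel)"
    proof (rule integral_mono)
      show "integrable lborel (\<lambda>t. indicat_real ?A t *\<^sub>R (K * cmod (b n)))"
        by (rule integrableI_bounded_set_indicator[where B = "K * cmod (b n)"]) (use K in \<open>auto simp: emeasure_lborel_Icc_eq\<close>)
      show "integrable lborel (\<lambda>t. norm (f n t))" using int by (rule integrable_norm)
    qed (use nb in \<open>auto simp: f_def indicator_def\<close>)
    also have "\<dots> = c * K * cmod (b n)" using c by simp
    finally show ?thesis .
  qed
  have "(LINT t:?A|lborel. G t * (\<Sum>n. b n * e n t)) = (\<integral>t. (\<Sum>n. f n t) \<partial>lborel)"
    unfolding set_lebesgue_integral_def f_def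
    by (intro Bochner_Integration.integral_cong refl)
       (simp add: sm suminf_mult[symmetric] suminf_scaleR_right[symmetric] summable_mult)
  also have "\<dots> = (\<Sum>n. \<integral>t. f n t \<partial>lborel)"
  proof (rule integral_suminf)
    show "summable (\<lambda>i. LINT x|lborel. norm (f i x))"
      by (rule summable_comparison_test'[OF summable_mult[OF b, of "c*K"], of 0])
         (use ib in \<open>auto simp: Bochner_Integration.integral_nonneg\<close>)
  qed (use int smn in auto)
  also have "(\<lambda>n. \<integral>t. f n t \<partial>lborel) = (\<lambda>n. b n * (LINT t:?A|lborel. G t * e n t))"
  proof
    fix n
    have "(\<integral>t. f n t \<partial>lborel) = (\<integral>t. b n * (indicator ?A t *\<^sub>R (G t * e n t)) \<partial>lborel)"
      unfolding f_def by (intro Bochner_Integration.integral_cong refl) (simp add: mult_ac)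
    also have "\<dots> = b n * (LINT t:?A|lborel. G t * e n t)"
      unfolding set_lebesgue_integral_def by (rule integral_mult_right_zero)
    finally show "(\<integral>t. f n t \<partial>lborel) = b n * (LINT t:?A|lborel. G t * e n t)" .
  qed
  finally show ?thesis .
qed

lemma lint_cis_orthogonal:
  "(LINT t:{0..2*pi}|lborel. cis (real m * t) * cnj (cis (real n * t))) = (if m = n then 2*pi else 0)"
proof -
  let ?k = "real m - real n"
  have eq: "cis (real m * t) * cnj (cis (real n * t)) = cis (?k * t)" for t
    by (simp add: cis_cnj cis_mult left_diff_distrib)
  have "(LINT t:{0..2*pi}|lborel. cis (?k * t)) = integral {0..2*pi} (\<lambda>t. cis (?k * t))"
    by (rule set_borel_integral_eq_integral)
       (auto simp: set_integrable_def intro!: borel_integrable_compact continuous_intros)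
  also have "\<dots> = (if m = n then 2*pi else 0)"
  proof (cases "m = n")
    case False
    have "((\<lambda>t. cis (?k * t)) has_integral (cis (?k * (2*pi)) / (\<i> * ?k) - cis (?k * 0) / (\<i> * ?k))) {0..2*pi}"
    proof (rule fundamental_theorem_of_calculus)
      fix x
      show "((\<lambda>t. cis (?k * t) / (\<i> * ?k)) has_vector_derivative cis (?k * x)) (at x within {0..2*pi})"
      proof -
        have k: "\<i> * complex_of_real ?k \<noteq> 0" using False by (simp del: of_real_diff)
        have "((\<lambda>z. exp (\<i> * complex_of_real ?k * z) / (\<i> * ?k)) has_field_derivative
            exp (\<i> * complex_of_real ?k * of_real x)) (at (of_real x))"
          using k by (auto intro!: derivative_eq_intros simp del: of_real_diff)
        from has_vector_derivative_real_field[OF this]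
        show ?thesis by (simp add: cis_conv_exp mult.assoc del: of_real_diff)
      qed
    qed auto
    moreover have "cis (?k * (2*pi)) = 1"
      using cis_multiple_2pi[of "of_int (int m - int n)"] by (simp add: mult_ac)
    ultimately show ?thesis using False by (simp add: integral_unique)
  qed (simp add: scaleR_conv_of_real)
  finally show ?thesis by (simp add: eq)
qed

lemma summable_square:
  fixes x :: "nat \<Rightarrow> real"
  assumes "summable x" "\<And>n. 0 \<le> x n"
  shows "summable (\<lambda>n. (x n)\<^sup>2)"
proof (rule summable_comparison_test'[OF summable_mult[OF assms(1), of "suminf x"], of 0])
  fix n :: nat
  have "x n \<le> suminf x" using sum_le_suminf[OF assms(1), of "{n}"] assms(2) by auto
  then show "norm ((x n)\<^sup>2) \<le> suminf x * x n"
    using assms(2)[of n] by (simp add: power2_eq_square mult_right_mono)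
qed

text \<open>Absolute summability is what \<open>a n * r ^ n\<close> offers for \<open>r < 1\<close>,
  and it permits two interchanges of sum and integral: orthogonality gives the coefficients of
  \<open>F\<close>, and expanding only the factor \<open>cnj F\<close> in \<open>F * cnj F\<close>
  then gives the sum of squares.\<close>

lemma parseval_cis:
  fixes b :: "nat \<Rightarrow> complex"
  assumes b: "summable (\<lambda>n. cmod (b n))"
  shows "(\<integral>\<^sup>+t\<in>{0..2*pi}. ennreal ((cmod (\<Sum>n. b n * cis (real n * t)))\<^sup>2) \<partial>lborel)
    = ennreal (2 * pi * (\<Sum>n. (cmod (b n))\<^sup>2))"
proof -
  define F where "F t = (\<Sum>n. b n * cis (real n * t))" for t
  have [measurable]: "(\<lambda>t. cis (real n * t)) \<in> borel_measurable borel" for n by measurable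
  have sm: "summable (\<lambda>n. cmod (b n * cis (real n * t)))" for t
    using b by (simp add: norm_mult)
  have [measurable]: "F \<in> borel_measurable borel" unfolding F_def by measurable
  have Fb: "cmod (F t) \<le> (\<Sum>n. cmod (b n))" for t
    unfolding F_def using summable_norm[OF sm[of t]] by (simp add: norm_mult)
  have cF: "cnj (F t) = (\<Sum>n. cnj (b n) * cnj (cis (real n * t)))" for t
    unfolding F_def using sums_cnj[THEN iffD2, OF summable_sums[OF summable_norm_cancel[OF sm[of t]]]]
    by (simp add: sums_unique)
  have A: "(LINT t:{0..2*pi}|lborel. F t * cnj (cis (real m * t))) = 2 * pi * b m" for m
  proof -
    have "(LINT t:{0..2*pi}|lborel. cnj (cis (real m * t)) * (\<Sum>n. b n * cis (real n * t)))
      = (\<Sum>n. b n * (LINT t:{0..2*pi}|lborel. cnj (cis (real m * t)) * cis (real n * t)))"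
      by (rule set_lint_suminf[where K = 1]) (auto simp: b)
    also have "\<dots> = (\<Sum>n. if n = m then 2 * pi * b m else 0)"
      using lint_cis_orthogonal[of _ m] by (intro suminf_cong) (auto simp: mult.commute)
    also have "\<dots> = 2 * pi * b m"
      by (subst suminf_finite[of "{m}"]) auto
    finally show ?thesis by (simp add: F_def mult.commute)
  qed
  have "(LINT t:{0..2*pi}|lborel. F t * cnj (F t)) =
     (\<Sum>n. cnj (b n) * (LINT t:{0..2*pi}|lborel. F t * cnj (cis (real n * t))))"
    unfolding cF by (rule set_lint_suminf[OF _ _ Fb]) (auto simp: b)
  also have "\<dots> = (\<Sum>n. complex_of_real (2 * pi * (cmod (b n))\<^sup>2))"
  proof (intro suminf_cong)
    fix n
    have "complex_of_real (2 * pi * (cmod (b n))\<^sup>2) = 2 * pi * (b n * cnj (b n))"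
      by (simp only: of_real_mult complex_norm_square)
    then show "cnj (b n) * (LINT t:{0..2*pi}|lborel. F t * cnj (cis (real n * t))) = complex_of_real (2 * pi * (cmod (b n))\<^sup>2)"
      unfolding A by (simp only: mult_ac)
  qed
  also have "\<dots> = complex_of_real (2 * pi * (\<Sum>n. (cmod (b n))\<^sup>2))"
    using suminf_of_real[OF summable_mult[OF summable_square[OF b], of "2*pi"], where 'a = complex]
      suminf_mult[OF summable_square[OF b], of "2*pi"] by simp
  finally have C: "(LINT t:{0..2*pi}|lborel. F t * cnj (F t)) = complex_of_real (2 * pi * (\<Sum>n. (cmod (b n))\<^sup>2))" .
  have R: "(LINT t:{0..2*pi}|lborel. F t * cnj (F t)) = complex_of_real (LINT t:{0..2*pi}|lborel. (cmod (F t))\<^sup>2)"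
    by (subst set_integral_complex_of_real[symmetric]) (simp only: complex_norm_square)
  have int: "integrable lborel (\<lambda>t. indicator {0..2*pi} t *\<^sub>R (cmod (F t))\<^sup>2)"
    by (rule integrableI_bounded_set_indicator[where B = "(\<Sum>n. cmod (b n))\<^sup>2"])
       (use Fb in \<open>auto simp: emeasure_lborel_Icc power_mono\<close>)
  have "(\<integral>\<^sup>+t\<in>{0..2*pi}. ennreal ((cmod (F t))\<^sup>2) \<partial>lborel) =
      (\<integral>\<^sup>+t. ennreal (indicator {0..2*pi} t *\<^sub>R (cmod (F t))\<^sup>2) \<partial>lborel)"
    by (intro nn_integral_cong) (auto simp: indicator_def)
  also have "\<dots> = ennreal (LINT t:{0..2*pi}|lborel. (cmod (F t))\<^sup>2)"
    unfolding set_lebesgue_integral_def by (rule nn_integral_eq_integral[OF int]) auto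
  also have "\<dots> = ennreal (2 * pi * (\<Sum>n. (cmod (b n))\<^sup>2))"
    using C unfolding R of_real_eq_iff by simp
  finally show ?thesis unfolding F_def .
qed

text \<open>The factor \<open>1/(2*pi)\<close> of the Hardy mean is left out, hence the
  \<open>2*pi\<close> in later bounds. Values in \<open>ennreal\<close> allow estimates before any
  integrability is known, and \<open>r = 1\<close> makes sense for functions continuous on the
  closed disc.\<close>

definition circle_sq :: "(complex \<Rightarrow> complex) \<Rightarrow> real \<Rightarrow> ennreal" where
  "circle_sq f r = (\<integral>\<^sup>+t\<in>{0..2*pi}. ennreal ((cmod (f (of_real r * cis t)))\<^sup>2) \<partial>lborel)"

definition is_powser :: "(nat \<Rightarrow> complex) \<Rightarrow> (complex \<Rightarrow> complex) \<Rightarrow> bool" where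
  "is_powser a f \<longleftrightarrow> (\<forall>z\<in>ball 0 1. (\<lambda>n. a n * z ^ n) sums f z)"

lemma holomorphic_is_powser:
  assumes "f holomorphic_on ball 0 1"
  obtains a where "is_powser a f"
proof
  show "is_powser (\<lambda>n. (deriv ^^ n) f 0 / fact n) f"
    unfolding is_powser_def using holomorphic_power_series[OF assms] by simp
qed

lemma is_powser_summable_norm:
  assumes "is_powser a f" "0 \<le> r" "r < 1"
  shows "summable (\<lambda>n. cmod (a n) * r ^ n)"
proof -
  have "complex_of_real ((r+1)/2) \<in> ball 0 1" using assms by simp
  then have "summable (\<lambda>n. a n * complex_of_real ((r+1)/2) ^ n)"
    using assms(1) unfolding is_powser_def by (blast intro: sums_summable)
  then have "summable (\<lambda>n. norm (a n * complex_of_real r ^ n))"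
    by (rule powser_insidea) (use assms in auto)
  then show ?thesis using assms by (simp add: norm_mult norm_power)
qed

lemma is_powser_deriv:
  assumes "is_powser a f"
  shows "is_powser (diffs a) (deriv f)"
  unfolding is_powser_def
proof
  fix z :: complex assume z: "z \<in> ball 0 1"
  have sm: "summable (\<lambda>n. a n * z ^ n)" if "norm z < 1" for z
    using assms that unfolding is_powser_def by (auto intro: sums_summable)
  have fz: "f w = (\<Sum>n. a n * w ^ n)" if "w \<in> ball 0 1" for w
    using assms that unfolding is_powser_def by (auto intro: sums_unique)
  have "DERIV (\<lambda>w. \<Sum>n. a n * w ^ n) z :> (\<Sum>n. diffs a n * z ^ n)"
    by (rule termdiffs_strong'[of 1]) (use sm z in auto)
  then have "DERIV f z :> (\<Sum>n. diffs a n * z ^ n)"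
    by (rule has_field_derivative_transform_within_open[OF _ open_ball z]) (simp add: fz)
  then have "deriv f z = (\<Sum>n. diffs a n * z ^ n)" by (rule DERIV_imp_deriv)
  moreover have "summable (\<lambda>n. diffs a n * z ^ n)"
    by (rule termdiff_converges[of _ 1]) (use sm z in auto)
  ultimately show "(\<lambda>n. diffs a n * z ^ n) sums deriv f z" by (simp add: summable_sums)
qed

lemma circle_sq_powser:
  assumes a: "is_powser a f" and r: "0 \<le> r" "r < 1"
  shows "circle_sq f r = (\<Sum>n. ennreal (2 * pi * (cmod (a n))\<^sup>2 * r ^ (2*n)))"
proof -
  have sm: "summable (\<lambda>n. cmod (a n * of_real r ^ n))"
    using is_powser_summable_norm[OF a r] r by (simp add: norm_mult norm_power)
  have "f (of_real r * cis t) = (\<Sum>n. a n * of_real r ^ n * cis (real n * t))" for t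
  proof -
    have "of_real r * cis t \<in> ball 0 1" using r by (simp add: norm_mult)
    then have "(\<lambda>n. a n * (of_real r * cis t) ^ n) sums f (of_real r * cis t)"
      using a unfolding is_powser_def by blast
    then show ?thesis by (simp add: power_mult_distrib Complex.DeMoivre sums_unique mult.assoc)
  qed
  then have "circle_sq f r = ennreal (2 * pi * (\<Sum>n. (cmod (a n * of_real r ^ n))\<^sup>2))"
    unfolding circle_sq_def using parseval_cis[OF sm] by simp
  also have "\<dots> = ennreal (\<Sum>n. 2 * pi * (cmod (a n * of_real r ^ n))\<^sup>2)"
    by (subst suminf_mult) (use summable_square[OF sm] in auto)
  also have "\<dots> = (\<Sum>n. ennreal (2 * pi * (cmod (a n * of_real r ^ n))\<^sup>2))"
    by (rule suminf_ennreal2[symmetric]) (use summable_square[OF sm] in \<open>auto intro: summable_mult\<close>)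
  finally show ?thesis
    using r by (simp add: norm_mult norm_power power_mult_distrib power_mult[symmetric] mult.commute mult.left_commute)
qed

lemma circle_sq_mono:
  assumes "f holomorphic_on ball 0 1" "0 \<le> r" "r \<le> r'" "r' < 1"
  shows "circle_sq f r \<le> circle_sq f r'"
proof -
  obtain a where a: "is_powser a f" using holomorphic_is_powser[OF assms(1)] .
  show ?thesis using assms
    by (auto simp: circle_sq_powser[OF a] intro!: suminf_le ennreal_leI mult_left_mono power_mono)
qed

text \<open>For fixed \<open>N\<close> the partial sum weighted by \<open>r ^ (2*n)\<close> is at
  most \<open>M\<close> for every \<open>r < 1\<close> and is a polynomial in \<open>r\<close>;
  letting \<open>r\<close> tend to 1 removes the weight.\<close>

lemma powser_square_summable:
  assumes a: "is_powser a f" and M: "\<And>r. 0 \<le> r \<Longrightarrow> r < 1 \<Longrightarrow> circle_sq f r \<le> ennreal M" and "0 \<le> M"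
  shows "summable (\<lambda>n. (cmod (a n))\<^sup>2)" "2 * pi * (\<Sum>n. (cmod (a n))\<^sup>2) \<le> M"
proof -
  have fin: "(\<Sum>n<N. 2 * pi * (cmod (a n))\<^sup>2) \<le> M" for N
  proof -
    have le: "(\<Sum>n<N. 2 * pi * (cmod (a n))\<^sup>2 * r ^ (2*n)) \<le> M" if "0 \<le> r" "r < 1" for r
    proof -
      have "ennreal (\<Sum>n<N. 2 * pi * (cmod (a n))\<^sup>2 * r ^ (2*n)) = (\<Sum>n<N. ennreal (2 * pi * (cmod (a n))\<^sup>2 * r ^ (2*n)))"
        using that by (intro sum_ennreal[symmetric]) auto
      also have "\<dots> \<le> circle_sq f r"
        unfolding circle_sq_powser[OF a that] by (rule sum_le_suminf) auto
      also have "\<dots> \<le> ennreal M" using M[OF that] .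
      finally show ?thesis using \<open>0 \<le> M\<close> by (simp add: ennreal_le_iff)
    qed
    have "((\<lambda>r. \<Sum>n<N. 2 * pi * (cmod (a n))\<^sup>2 * r ^ (2*n)) \<longlongrightarrow> (\<Sum>n<N. 2 * pi * (cmod (a n))\<^sup>2 * 1 ^ (2*n))) (at_left (1::real))"
      by (intro tendsto_intros)
    then show ?thesis
      by (intro tendsto_upperbound[where F = "at_left (1::real)"])
         (auto intro!: le eventually_at_leftI[of 0])
  qed
  have s: "summable (\<lambda>n. 2 * pi * (cmod (a n))\<^sup>2)"
    by (rule summableI_nonneg_bounded[of _ M]) (use fin in auto)
  then show s': "summable (\<lambda>n. (cmod (a n))\<^sup>2)" by (simp add: summable_cmult_iff)
  have "(\<Sum>n. 2 * pi * (cmod (a n))\<^sup>2) \<le> M"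
    by (rule suminf_le_const[OF s fin])
  then show "2 * pi * (\<Sum>n. (cmod (a n))\<^sup>2) \<le> M" by (simp add: suminf_mult s')
qed

section \<open>Area integrals over the disc and the Littlewood-Paley inequality\<close>

lemma cmod_sq_indicator_measurable:
  fixes u :: "complex \<Rightarrow> complex" and v :: "complex \<Rightarrow> real"
  assumes [measurable]: "A \<in> sets borel" and u: "continuous_on A u" and [measurable]: "v \<in> borel_measurable borel"
  shows "(\<lambda>z. ennreal ((cmod (u z))\<^sup>2 * v z) * indicator A z) \<in> borel_measurable borel"
proof -
  \<comment> \<open>Nothing is known about \<open>u\<close> outside \<open>A\<close>, as for the
    derivative of a function holomorphic only on the disc; the extension by zero is
    measurable.\<close>
  have [measurable]: "(\<lambda>z. indicator A z *\<^sub>R u z) \<in> borel_measurable borel"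
    by (rule borel_measurable_continuous_on_indicator[OF _ u]) simp
  have "(\<lambda>z. ennreal ((cmod (indicator A z *\<^sub>R u z))\<^sup>2 * v z)) \<in> borel_measurable borel" by measurable
  also have "(\<lambda>z. ennreal ((cmod (indicator A z *\<^sub>R u z))\<^sup>2 * v z)) = (\<lambda>z. ennreal ((cmod (u z))\<^sup>2 * v z) * indicator A z)"
    by (auto simp: indicator_def)
  finally show ?thesis .
qed

lemma nn_integral_disc_circles:
  fixes u :: "complex \<Rightarrow> complex" and w :: "real \<Rightarrow> real"
  assumes u: "continuous_on (ball 0 1) u" and [measurable]: "w \<in> borel_measurable borel" and w: "\<And>r. 0 \<le> w r"
  shows "(\<integral>\<^sup>+z\<in>ball 0 1. ennreal ((cmod (u z))\<^sup>2 * w (cmod z)) \<partial>lborel) =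
    (\<integral>\<^sup>+r\<in>{0<..<1}. ennreal (r * w r) * circle_sq u r \<partial>lborel)"
proof -
  define v where "v z = indicator (ball 0 1) z *\<^sub>R u z" for z
  have [measurable]: "v \<in> borel_measurable borel"
    unfolding v_def by (rule borel_measurable_continuous_on_indicator[OF _ u]) auto
  have "(\<integral>\<^sup>+z\<in>ball 0 1. ennreal ((cmod (u z))\<^sup>2 * w (cmod z)) \<partial>lborel) =
     (\<integral>\<^sup>+z. ennreal ((cmod (v z))\<^sup>2 * w (cmod z)) \<partial>lborel)"
    by (intro nn_integral_cong) (auto simp: v_def indicator_def)
  also have "\<dots> = (\<integral>\<^sup>+t\<in>{0..0+2*pi}. (\<integral>\<^sup>+r\<in>{0<..}. ennreal r *
     (ennreal ((cmod (v (of_real r * cis t)))\<^sup>2 * w (cmod (of_real r * cis t)))) \<partial>lborel) \<partial>lborel)"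
    by (rule nn_integral_polar) measurable
  also have "\<dots> = (\<integral>\<^sup>+t. (\<integral>\<^sup>+r. ennreal (r * w r) * indicator {0<..<1} r *
     (ennreal ((cmod (v (of_real r * cis t)))\<^sup>2) * indicator {0..2*pi} t) \<partial>lborel) \<partial>lborel)"
  proof (subst nn_integral_multc[symmetric])
    show "(\<integral>\<^sup>+t. (\<integral>\<^sup>+r. ennreal r *
     (ennreal ((cmod (v (of_real r * cis t)))\<^sup>2 * w (cmod (of_real r * cis t)))) * indicator {0<..} r *
      indicator {0..0+2*pi} t \<partial>lborel) \<partial>lborel) = (\<integral>\<^sup>+t. (\<integral>\<^sup>+r. ennreal (r * w r) * indicator {0<..<1} r *
     (ennreal ((cmod (v (of_real r * cis t)))\<^sup>2) * indicator {0..2*pi} t) \<partial>lborel) \<partial>lborel)"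
      using w by (intro nn_integral_cong) (auto simp: v_def indicator_def norm_mult ennreal_mult mult_ac)
  qed measurable
  also have "\<dots> = (\<integral>\<^sup>+r. (\<integral>\<^sup>+t. ennreal (r * w r) * indicator {0<..<1} r *
     (ennreal ((cmod (v (of_real r * cis t)))\<^sup>2) * indicator {0..2*pi} t) \<partial>lborel) \<partial>lborel)"
    by (rule lborel_pair.Fubini') measurable
  also have "\<dots> = (\<integral>\<^sup>+r\<in>{0<..<1}. ennreal (r * w r) * circle_sq u r \<partial>lborel)"
  proof (intro nn_integral_cong)
    fix r :: real
    have "(\<integral>\<^sup>+t. ennreal (r * w r) * indicator {0<..<1} r *
     (ennreal ((cmod (v (of_real r * cis t)))\<^sup>2) * indicator {0..2*pi} t) \<partial>lborel) =
      ennreal (r * w r) * indicator {0<..<1} r * circle_sq v r"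
      unfolding circle_sq_def by (rule nn_integral_cmult) measurable
    also have "\<dots> = ennreal (r * w r) * circle_sq u r * indicator {0<..<1} r"
    proof (cases "r \<in> {0<..<1}")
      case True
      then have "v (of_real r * cis t) = u (of_real r * cis t)" for t
        by (simp add: v_def norm_mult)
      then show ?thesis by (simp add: circle_sq_def mult_ac)
    qed auto
    finally show "(\<integral>\<^sup>+t. ennreal (r * w r) * indicator {0<..<1} r *
     (ennreal ((cmod (v (of_real r * cis t)))\<^sup>2) * indicator {0..2*pi} t) \<partial>lborel) =
      ennreal (r * w r) * circle_sq u r * indicator {0<..<1} r" .
  qed
  finally show ?thesis .
qed

text \<open>Parseval on circles splits the integral into one radial integral per coefficient. With
  \<open>a\<close> the coefficient of index \<open>n+1\<close> it is \<open>2*pi (n+1)^2 |a|^2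
  (1/(2n+2) - 1/(2n+4)) = pi |a|^2 (n+1)/(n+2)\<close>, at most \<open>pi |a|^2\<close>. The total
  is at most half of \<open>M\<close>, since \<open>M\<close> bounds \<open>2*pi\<close> times the
  sum of squares.\<close>

lemma littlewood_paley:
  assumes f: "f holomorphic_on ball 0 1"
    and M: "\<And>r. 0 \<le> r \<Longrightarrow> r < 1 \<Longrightarrow> circle_sq f r \<le> ennreal M" and "0 \<le> M"
  shows "(\<integral>\<^sup>+z\<in>ball 0 1. ennreal ((cmod (deriv f z))\<^sup>2 * (1 - (cmod z)\<^sup>2)) \<partial>lborel) \<le> ennreal (M / 2)"
proof -
  obtain a where a: "is_powser a f" using holomorphic_is_powser[OF f] .
  have cd: "continuous_on (ball 0 1) (deriv f)"
    by (intro holomorphic_on_imp_continuous_on holomorphic_deriv f) auto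
  note sq = powser_square_summable[OF a M \<open>0 \<le> M\<close>]
  have "(\<integral>\<^sup>+z\<in>ball 0 1. ennreal ((cmod (deriv f z))\<^sup>2 * (1 - (cmod z)\<^sup>2)) \<partial>lborel)
     = (\<integral>\<^sup>+z\<in>ball 0 1. ennreal ((cmod (deriv f z))\<^sup>2 * max 0 (1 - (cmod z)\<^sup>2)) \<partial>lborel)"
    by (intro nn_integral_cong) (auto simp: indicator_def max_def power_le_one)
  also have "\<dots> = (\<integral>\<^sup>+r\<in>{0<..<1}. ennreal (r * max 0 (1 - r\<^sup>2)) * circle_sq (deriv f) r \<partial>lborel)"
    by (rule nn_integral_disc_circles[OF cd, where w = "\<lambda>r. max 0 (1 - r\<^sup>2)"]) auto
  also have "\<dots> = (\<integral>\<^sup>+r. (\<Sum>n. ennreal (2 * pi * (real (Suc n) * cmod (a (Suc n)))\<^sup>2 * (r ^ (2*n+1) - r ^ (2*n+3))) * indicator {0<..<1} r) \<partial>lborel)"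
  proof (intro nn_integral_cong)
    fix r :: real
    show "ennreal (r * max 0 (1 - r\<^sup>2)) * circle_sq (deriv f) r * indicator {0<..<1} r =
      (\<Sum>n. ennreal (2 * pi * (real (Suc n) * cmod (a (Suc n)))\<^sup>2 * (r ^ (2*n+1) - r ^ (2*n+3))) * indicator {0<..<1} r)"
    proof (cases "r \<in> {0<..<1}")
      case True
      then have r: "0 \<le> r" "r < 1" "r\<^sup>2 \<le> 1" by (auto simp: power_le_one)
      have cd: "cmod (diffs a n) = real (Suc n) * cmod (a (Suc n))" for n
        unfolding diffs_def by (simp only: norm_mult norm_of_nat)
      have "ennreal (r * max 0 (1 - r\<^sup>2)) * circle_sq (deriv f) r =
         (\<Sum>n. ennreal (r * max 0 (1 - r\<^sup>2)) * ennreal (2 * pi * (real (Suc n) * cmod (a (Suc n)))\<^sup>2 * r ^ (2*n)))"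
        unfolding circle_sq_powser[OF is_powser_deriv[OF a] r(1,2)] cd
        by (rule ennreal_suminf_cmult[symmetric])
      also have "\<dots> = (\<Sum>n. ennreal (2 * pi * (real (Suc n) * cmod (a (Suc n)))\<^sup>2 * (r ^ (2*n+1) - r ^ (2*n+3))))"
      proof (intro suminf_cong)
        fix n
        have "r * (1 - r\<^sup>2) * (2 * pi * (real (Suc n) * cmod (a (Suc n)))\<^sup>2 * r ^ (2*n)) =
          2 * pi * (real (Suc n) * cmod (a (Suc n)))\<^sup>2 * (r ^ (2*n+1) - r ^ (2*n+3))"
          by (simp add: algebra_simps power_add power2_eq_square power3_eq_cube)
        then show "ennreal (r * max 0 (1 - r\<^sup>2)) * ennreal (2 * pi * (real (Suc n) * cmod (a (Suc n)))\<^sup>2 * r ^ (2*n)) =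
          ennreal (2 * pi * (real (Suc n) * cmod (a (Suc n)))\<^sup>2 * (r ^ (2*n+1) - r ^ (2*n+3)))"
          using r by (simp only: ennreal_mult[symmetric] max_absorb2 diff_ge_0_iff_ge mult_nonneg_nonneg pi_ge_zero
             zero_le_power zero_le_numeral zero_le_power2)
      qed
      finally show ?thesis using True by simp
    qed simp
  qed
  also have "\<dots> = (\<Sum>n. (\<integral>\<^sup>+r\<in>{0<..<1}. ennreal (2 * pi * (real (Suc n) * cmod (a (Suc n)))\<^sup>2 * (r ^ (2*n+1) - r ^ (2*n+3))) \<partial>lborel))"
    by (rule nn_integral_suminf) measurable
  also have "\<dots> \<le> (\<Sum>n. ennreal (pi * (cmod (a (Suc n)))\<^sup>2))"
  proof (intro suminf_le)
    fix n
    let ?c = "2 * pi * (real (Suc n) * cmod (a (Suc n)))\<^sup>2"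
    have "(\<integral>\<^sup>+r\<in>{0<..<1}. ennreal (?c * (r ^ (2*n+1) - r ^ (2*n+3))) \<partial>lborel)
      \<le> (\<integral>\<^sup>+r. ennreal (?c * (r ^ (2*n+1) - r ^ (2*n+3))) * indicator {0..1} r \<partial>lborel)"
      by (intro nn_integral_mono) (auto simp: indicator_def)
    also have "\<dots> = ennreal (?c * (1 ^ (2*n+2) / (2*n+2) - 1 ^ (2*n+4) / (2*n+4)) - ?c * (0 ^ (2*n+2) / (2*n+2) - 0 ^ (2*n+4) / (2*n+4)))"
    proof (rule nn_integral_FTC_Icc[where F = "\<lambda>r. ?c * (r ^ (2*n+2) / (2*n+2) - r ^ (2*n+4) / (2*n+4))"])
      fix x :: real assume "x \<in> {0..1}"
      then have "0 \<le> x" "x \<le> 1" by auto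
      have P: "((\<lambda>r. r ^ Suc k / real (Suc k)) has_real_derivative x ^ k) (at x)" for k
        using DERIV_cdivide[OF DERIV_pow[of "Suc k" x], of "real (Suc k)"] by (simp del: of_nat_Suc)
      have e: "2 * real n + 2 \<noteq> 0" "2 * real n + 4 \<noteq> 0" by linarith+
      have d: "((\<lambda>r. r ^ (2*n+2) / (2*n+2)) has_real_derivative x ^ (2*n+1)) (at x)"
           "((\<lambda>r. r ^ (2*n+4) / (2*n+4)) has_real_derivative x ^ (2*n+3)) (at x)"
        using e P[of "2*n+1"] P[of "2*n+3"] by (simp_all add: add_ac)
      show "((\<lambda>r. ?c * (r ^ (2*n+2) / (2*n+2) - r ^ (2*n+4) / (2*n+4))) has_real_derivative
          ?c * (x ^ (2*n+1) - x ^ (2*n+3))) (at x)"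
        by (rule DERIV_cmult[OF DERIV_diff[OF d]])
      show "0 \<le> ?c * (x ^ (2*n+1) - x ^ (2*n+3))"
        using \<open>0 \<le> x\<close> \<open>x \<le> 1\<close> power_decreasing[of "2*n+1" "2*n+3" x]
        by (intro mult_nonneg_nonneg) (auto simp del: power_Suc)
    qed auto
    also have "\<dots> \<le> ennreal (pi * (cmod (a (Suc n)))\<^sup>2)"
    proof (intro ennreal_leI)
      have "(real (Suc n))\<^sup>2 * (1 / (2*n+2) - 1 / (2*n+4)) \<le> 1/2"
        by (simp add: divide_simps) (simp add: algebra_simps power2_eq_square)
      then have "2 * pi * (cmod (a (Suc n)))\<^sup>2 * ((real (Suc n))\<^sup>2 * (1 / (2*n+2) - 1 / (2*n+4))) \<le> 2 * pi * (cmod (a (Suc n)))\<^sup>2 * (1/2)"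
        by (intro mult_left_mono) auto
      then show "?c * (1 ^ (2*n+2) / (2*n+2) - 1 ^ (2*n+4) / (2*n+4)) - ?c * (0 ^ (2*n+2) / (2*n+2) - 0 ^ (2*n+4) / (2*n+4)) \<le> pi * (cmod (a (Suc n)))\<^sup>2"
        by (simp add: power_mult_distrib mult_ac power_0_left)
    qed
    finally show "(\<integral>\<^sup>+r\<in>{0<..<1}. ennreal (?c * (r ^ (2*n+1) - r ^ (2*n+3))) \<partial>lborel) \<le> ennreal (pi * (cmod (a (Suc n)))\<^sup>2)" .
  qed auto
  also have "\<dots> = ennreal (pi * (\<Sum>n. (cmod (a (Suc n)))\<^sup>2))"
  proof -
    have s1: "summable (\<lambda>n. (cmod (a (Suc n)))\<^sup>2)"
      using sq(1) summable_Suc_iff[of "\<lambda>n. (cmod (a n))\<^sup>2"] by simp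
    then show ?thesis
      by (subst suminf_ennreal2) (auto simp: suminf_mult[OF s1] intro!: summable_mult)
  qed
  also have "\<dots> \<le> ennreal (M / 2)"
  proof (intro ennreal_leI)
    have "(\<Sum>n. (cmod (a (Suc n)))\<^sup>2) \<le> (\<Sum>n. (cmod (a n))\<^sup>2)"
      using suminf_split_head[OF sq(1)] by simp
    then have "pi * (\<Sum>n. (cmod (a (Suc n)))\<^sup>2) \<le> pi * (\<Sum>n. (cmod (a n))\<^sup>2)"
      by (intro mult_left_mono) auto
    then show "pi * (\<Sum>n. (cmod (a (Suc n)))\<^sup>2) \<le> M / 2" using sq(2) by linarith
  qed
  finally show ?thesis .
qed

section \<open>The Poisson integral and the maximal inequality\<close>

lemma nn_integral_eq_set_integral:
  fixes h :: "'a \<Rightarrow> real"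
  assumes "set_integrable M A h" "\<And>t. 0 \<le> h t"
  shows "(\<integral>\<^sup>+t\<in>A. ennreal (h t) \<partial>M) = ennreal (LINT t:A|M. h t)"
proof -
  have "(\<integral>\<^sup>+t\<in>A. ennreal (h t) \<partial>M) = (\<integral>\<^sup>+t. ennreal (indicator A t *\<^sub>R h t) \<partial>M)"
    by (intro nn_integral_cong) (auto simp: indicator_def)
  also have "\<dots> = ennreal (LINT t:A|M. h t)"
    unfolding set_lebesgue_integral_def
    by (rule nn_integral_eq_integral) (use assms in \<open>auto simp: set_integrable_def indicator_def\<close>)
  finally show ?thesis .
qed

text \<open>Cauchy's formula is applied to \<open>f^2 / (1 - cnj w z)\<close>. At \<open>w\<close>
  the denominator equals \<open>1 - r^2\<close>; on the circle it combines with the Cauchy kernel to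
  \<open>1 / |1 - cnj w z|^2\<close>. The Poisson inequality for \<open>|f|^2\<close> is then the
  triangle inequality for integrals. The window is centred at the angle of \<open>w\<close> to suit
  the dyadic decomposition.\<close>

lemma poisson_bound:
  assumes f: "f holomorphic_on ball 0 1" "continuous_on (cball 0 1) f" and r: "0 \<le> r" "r < 1"
  shows "ennreal ((cmod (f (of_real r * cis \<theta>)))\<^sup>2) \<le> ennreal ((1 - r\<^sup>2) / (2*pi)) *
     (\<integral>\<^sup>+t\<in>{\<theta>-pi..\<theta>+pi}. ennreal ((cmod (f (cis t)))\<^sup>2 / (cmod (1 - of_real r * cis (t-\<theta>)))\<^sup>2) \<partial>lborel)"
proof -
  define w where "w = of_real r * cis \<theta>"
  have w: "cmod w = r" using r by (simp add: w_def norm_mult)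
  have nz: "1 - cnj w * z \<noteq> 0" if "cmod z \<le> 1" for z
  proof
    assume "1 - cnj w * z = 0"
    then have "cmod (cnj w * z) = 1" by simp
    moreover have "cmod (cnj w * z) \<le> r * 1" unfolding norm_mult using w that r by (intro mult_mono) auto
    ultimately show False using r by simp
  qed
  define G where "G z = (f z)\<^sup>2 / (1 - cnj w * z)" for z
  have "continuous_on (cball 0 1) G" unfolding G_def
    by (intro continuous_intros f) (use nz in auto)
  moreover have "G holomorphic_on ball 0 1" unfolding G_def
    by (intro holomorphic_intros f) (use nz in auto)
  ultimately have "((\<lambda>u. G u / (u - w)) has_contour_integral 2 * of_real pi * \<i> * G w) (circlepath 0 1)"
    by (rule Cauchy_integral_circlepath) (use w r in auto)
  then have "((\<lambda>t. G (cis t) / (cis t - w) * \<i> * cis t) has_integral 2 * of_real pi * \<i> * G w) {0..2*pi}"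
    unfolding circlepath_def by (subst (asm) has_contour_integral_part_circlepath_iff) auto
  moreover have eq: "G (cis t) / (cis t - w) * \<i> * cis t = \<i> * ((f (cis t))\<^sup>2 / of_real ((cmod (1 - of_real r * cis (t-\<theta>)))\<^sup>2))" for t
  proof -
    have wt: "w = of_real r * cis \<theta>" "cnj w = of_real r * cis (-\<theta>)" by (simp_all add: w_def cis_cnj)
    have "cnj w * cis t = of_real r * cis (t-\<theta>)" by (simp add: wt(2) cis_mult algebra_simps)
    then have a: "1 - cnj w * cis t = 1 - of_real r * cis (t-\<theta>)" by simp
    have "w = cis t * (of_real r * cis (\<theta> - t))" by (simp add: wt(1) cis_mult algebra_simps)
    then have b: "cis t - w = cis t * (1 - of_real r * cis (\<theta> - t))" by (simp add: algebra_simps)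
    have gen: "A / P / (c * Q) * \<i> * c = \<i> * (A / (P * Q))" if "c \<noteq> 0" for A P Q c :: complex
      using that by (simp add: divide_simps)
    have c: "cnj (1 - of_real r * cis (t-\<theta>)) = 1 - of_real r * cis (\<theta> - t)" by (simp add: cis_cnj)
    have "G (cis t) / (cis t - w) * \<i> * cis t = \<i> * ((f (cis t))\<^sup>2 / ((1 - of_real r * cis (t-\<theta>)) * (1 - of_real r * cis (\<theta> - t))))"
      unfolding G_def a b by (rule gen) simp
    then show ?thesis unfolding complex_norm_square c .
  qed
  ultimately have I: "((\<lambda>t. \<i> * ((f (cis t))\<^sup>2 / of_real ((cmod (1 - of_real r * cis (t-\<theta>)))\<^sup>2))) has_integral 2 * of_real pi * \<i> * G w) {0..2*pi}"
    by simp
  let ?h = "\<lambda>t. (cmod (f (cis t)))\<^sup>2 / (cmod (1 - of_real r * cis (t-\<theta>)))\<^sup>2"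
  have nz': "1 - of_real r * cis (t-\<theta>) \<noteq> 0" for t
  proof
    assume "1 - of_real r * cis (t-\<theta>) = 0"
    then have "cmod (of_real r * cis (t-\<theta>)) = 1" by simp
    then show False using r by (simp add: norm_mult)
  qed
  have cf: "continuous_on UNIV (\<lambda>t. f (cis t))"
    by (rule continuous_on_compose2[OF f(2)]) (auto intro!: continuous_intros)
  have ch: "continuous_on S ?h" for S
    by (intro continuous_intros continuous_on_subset[OF cf]) (use nz' in auto)
  have hi: "(?h has_integral integral {0..2*pi} ?h) {0..2*pi}"
    by (intro integrable_integral integrable_continuous_interval ch)
  have le1: "cmod (2 * of_real pi * \<i> * G w) \<le> integral {0..2*pi} ?h"
    using I by (rule has_integral_norm_bound_integral_component[OF _ hi, where k = 1, simplified])
       (auto simp: norm_divide norm_power norm_mult)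
  have le2: "cmod (2 * of_real pi * \<i> * G w) = 2 * pi * ((cmod (f w))\<^sup>2 / (1 - r\<^sup>2))"
  proof -
    have "cnj w * w = of_real (r\<^sup>2)" using complex_norm_square[of w] w by (simp add: mult.commute)
    then have "1 - cnj w * w = of_real (1 - r\<^sup>2)" by simp
    then have "cmod (1 - cnj w * w) = 1 - r\<^sup>2" using r by (simp add: power_le_one del: of_real_diff)
    then show ?thesis by (simp add: G_def norm_mult norm_divide norm_power)
  qed
  have pos: "1 - r\<^sup>2 > 0" using r by (simp add: power_less_one_iff abs_square_less_1)
  have gen: "a \<le> d / (2*pi) * I" if "2 * pi * (a / d) \<le> I" "0 < d" for a d I :: real
    using that by (simp add: field_simps)
  have le: "(cmod (f w))\<^sup>2 \<le> (1 - r\<^sup>2) / (2*pi) * integral {0..2*pi} ?h"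
    by (rule gen[OF le1[unfolded le2] pos])
  have si: "set_integrable lborel {0..2*pi} ?h"
    unfolding set_integrable_def by (intro borel_integrable_compact ch) auto
  have "ennreal (integral {0..2*pi} ?h) = (\<integral>\<^sup>+t\<in>{0..2*pi}. ennreal (?h t) \<partial>lborel)"
    using nn_integral_eq_set_integral[OF si] set_borel_integral_eq_integral(2)[OF si] by simp
  also have "\<dots> = (\<integral>\<^sup>+t\<in>{\<theta>-pi..\<theta>-pi+2*pi}. ennreal (?h t) \<partial>lborel)"
  proof (rule nn_integral_periodic_window[symmetric])
    show "(\<lambda>t. ennreal (?h t)) \<in> borel_measurable borel"
      using borel_measurable_continuous_onI[OF ch] by measurable
    show "ennreal (?h (t + 2*pi)) = ennreal (?h t)" for t
    proof -
      have "cis (x + 2*pi) = cis x" for x by (simp add: cis_mult[symmetric])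
      moreover have "t + 2*pi - \<theta> = (t - \<theta>) + 2*pi" by simp
      ultimately show ?thesis by (simp only:)
    qed
  qed
  finally have e: "ennreal (integral {0..2*pi} ?h) = (\<integral>\<^sup>+t\<in>{\<theta>-pi..\<theta>+pi}. ennreal (?h t) \<partial>lborel)"
    by (simp add: algebra_simps)
  have "ennreal ((cmod (f w))\<^sup>2) \<le> ennreal ((1 - r\<^sup>2) / (2*pi) * integral {0..2*pi} ?h)"
    using le by (rule ennreal_leI)
  also have "\<dots> = ennreal ((1 - r\<^sup>2) / (2*pi)) * ennreal (integral {0..2*pi} ?h)"
    using \<open>1 - r\<^sup>2 > 0\<close> by (intro ennreal_mult) (auto intro!: integral_nonneg integrable_continuous_interval ch)
  finally show ?thesis unfolding e w_def .
qed

text \<open>Moving from \<open>r * cis p\<close> to \<open>cis p\<close> costs \<open>1 - r\<close>,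
  which is itself at most \<open>|1 - r cis p|\<close>. Hence \<open>|1 - cis p|\<close> is at most
  twice \<open>|1 - r cis p|\<close>, and it equals \<open>2 sin(|p|/2)\<close>.\<close>

lemma norm_one_minus_cis_ge:
  assumes "0 \<le> r" "r \<le> 1" "\<bar>p\<bar> \<le> pi"
  shows "\<bar>p\<bar> / pi \<le> cmod (1 - of_real r * cis p)" "1 - r \<le> cmod (1 - of_real r * cis p)"
proof -
  show b: "1 - r \<le> cmod (1 - of_real r * cis p)"
    using norm_triangle_ineq2[of 1 "of_real r * cis p"] assms by (simp add: norm_mult)
  have "cmod (1 - cis p) \<le> cmod (1 - of_real r * cis p) + cmod (of_real (1 - r) * cis p)"
    using norm_triangle_ineq4[of "1 - of_real r * cis p" "of_real (1 - r) * cis p"]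
    by (simp add: algebra_simps)
  also have "\<dots> \<le> 2 * cmod (1 - of_real r * cis p)"
    using b assms by (simp add: norm_mult del: of_real_diff)
  finally have *: "cmod (1 - cis p) \<le> 2 * cmod (1 - of_real r * cis p)" .
  \<comment> \<open>Jordan's inequality: the concave sine lies above its chord from 0 to
    \<open>pi/2\<close>.\<close>
  have sin_ge: "2 / pi * x \<le> sin x" if "0 \<le> x" "x \<le> pi/2" for x
  proof -
    have "concave_on {0..pi} sin"
      by (rule f''_le0_imp_concave[where f' = cos and f'' = "\<lambda>x. - sin x"])
         (auto intro!: derivative_eq_intros sin_ge_zero)
    from concave_onD[OF this, of "2/pi*x" 0 "pi/2"] that
    show ?thesis by (simp add: field_simps)
  qed
  have e: "(cmod (1 - cis p))\<^sup>2 = (2 * sin (\<bar>p\<bar>/2))\<^sup>2"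
  proof -
    have "(cmod (1 - cis p))\<^sup>2 = 2 - 2 * cos p"
      using sin_cos_squared_add[of p] unfolding cmod_power2 by (simp add: power2_eq_square algebra_simps)
    also have "cos p = cos (2 * (\<bar>p\<bar>/2))" by simp
    also have "2 - 2 * \<dots> = (2 * sin (\<bar>p\<bar>/2))\<^sup>2"
      by (simp only: cos_double_sin) (simp add: power_mult_distrib)
    finally show ?thesis .
  qed
  have s: "2 / pi * (\<bar>p\<bar>/2) \<le> sin (\<bar>p\<bar>/2)" using assms by (intro sin_ge) auto
  have "0 \<le> 2 / pi * (\<bar>p\<bar>/2)" by simp
  then have "0 \<le> 2 * sin (\<bar>p\<bar>/2)" using s by linarith
  with e have "cmod (1 - cis p) = 2 * sin (\<bar>p\<bar>/2)"
    by (rule power2_eq_imp_eq[OF _ norm_ge_zero])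
  moreover have "2 / pi * (\<bar>p\<bar>/2) = \<bar>p\<bar> / pi" by simp
  ultimately show "\<bar>p\<bar> / pi \<le> cmod (1 - of_real r * cis p)" using * s by linarith
qed

text \<open>Half the angular length of an arc of normalised length \<open>s\<close>, doubled
  \<open>k\<close> times; the cap \<open>pi\<close> stops the growth when the arc is the whole
  circle. The normalised length is \<open>arc_radius s k / pi\<close>.\<close>

definition arc_radius :: "real \<Rightarrow> nat \<Rightarrow> real" where
  "arc_radius s k = min pi (pi * s * 2 ^ k)"

text \<open>At angular distance more than \<open>pi * s * 2^(k-1)\<close> from the centre the kernel
  is at most \<open>1 / (s * 2^(k-1))^2\<close>. At each point one term of the series dominates the
  integrand, so full nested arcs may be used in place of annuli.\<close>

lemma dyadic_kernel_bound:
  fixes u :: "real \<Rightarrow> ennreal"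
  assumes [measurable]: "u \<in> borel_measurable borel" and s: "0 < s" "s \<le> 1"
  shows "(\<integral>\<^sup>+t\<in>{\<theta>-pi..\<theta>+pi}. u t * ennreal (1 / (cmod (1 - of_real (1-s) * cis (t-\<theta>)))\<^sup>2) \<partial>lborel)
    \<le> (\<Sum>k. ennreal (4 / (s\<^sup>2 * 4 ^ k)) * (\<integral>\<^sup>+t\<in>{\<theta> - arc_radius s k..\<theta> + arc_radius s k}. u t \<partial>lborel))"
proof -
  let ?I = "\<lambda>k. {\<theta> - arc_radius s k..\<theta> + arc_radius s k}"
  have "(\<integral>\<^sup>+t\<in>{\<theta>-pi..\<theta>+pi}. u t * ennreal (1 / (cmod (1 - of_real (1-s) * cis (t-\<theta>)))\<^sup>2) \<partial>lborel)
    \<le> (\<integral>\<^sup>+t. (\<Sum>k. ennreal (4 / (s\<^sup>2 * 4 ^ k)) * (u t * indicator (?I k) t)) \<partial>lborel)"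
  proof (intro nn_integral_mono)
    fix t :: real
    show "u t * ennreal (1 / (cmod (1 - of_real (1-s) * cis (t-\<theta>)))\<^sup>2) * indicator {\<theta>-pi..\<theta>+pi} t
       \<le> (\<Sum>k. ennreal (4 / (s\<^sup>2 * 4 ^ k)) * (u t * indicator (?I k) t))"
    proof (cases "t \<in> {\<theta>-pi..\<theta>+pi}")
      case True
      define p where "p = t - \<theta>"
      have p: "\<bar>p\<bar> \<le> pi" using True by (auto simp: p_def)
      define d where "d = cmod (1 - of_real (1-s) * cis p)"
      have d: "\<bar>p\<bar> / pi \<le> d" "s \<le> d"
        using norm_one_minus_cis_ge[of "1-s" p] s p by (auto simp: d_def)
      have d0: "0 < d" using d s by linarith
      have "\<exists>k. \<bar>p\<bar> \<le> pi * s * 2 ^ k \<and> 1 / d\<^sup>2 \<le> 4 / (s\<^sup>2 * 4 ^ k)"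
      proof (cases "\<bar>p\<bar> \<le> pi * s")
        case True
        have "1 / d\<^sup>2 \<le> 1 / s\<^sup>2" using d s by (intro divide_left_mono power_mono) auto
        also have "\<dots> \<le> 4 / s\<^sup>2" by (intro divide_right_mono) auto
        finally show ?thesis using True by (intro exI[of _ 0]) auto
      next
        case False
        obtain n where n: "\<bar>p\<bar> / (pi * s) < 2 ^ n" using real_arch_pow[of 2] by auto
        \<comment> \<open>Minimality matters: the next smaller arc misses \<open>t\<close>, and this
          is what bounds the kernel from above.\<close>
        define k where "k = (LEAST k. \<bar>p\<bar> \<le> pi * s * 2 ^ k)"
        have ex: "\<bar>p\<bar> \<le> pi * s * 2 ^ n" using n s by (simp add: field_simps)
        have k: "\<bar>p\<bar> \<le> pi * s * 2 ^ k" unfolding k_def by (rule LeastI[of _ n]) (rule ex)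
        with False have "k \<noteq> 0" by (metis mult.right_neutral power_0)
        then obtain j where j: "k = Suc j" by (cases k) auto
        have "\<not> \<bar>p\<bar> \<le> pi * s * 2 ^ j" using not_less_Least[of j "\<lambda>k. \<bar>p\<bar> \<le> pi * s * 2 ^ k"] j k_def by simp
        then have "s * 2 ^ j \<le> \<bar>p\<bar> / pi" by (simp add: field_simps)
        then have "s * 2 ^ j \<le> d" using d by linarith
        then have "1 / d\<^sup>2 \<le> 1 / (s * 2 ^ j)\<^sup>2" using s d0 by (intro divide_left_mono power_mono) auto
        also have "(s * 2 ^ j)\<^sup>2 = s\<^sup>2 * 4 ^ j"
        proof -
          have "(4::real) ^ j = 2 ^ j * 2 ^ j" by (simp add: power_mult_distrib[symmetric])
          then show ?thesis by (simp add: power2_eq_square)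
        qed
        also have "1 / (s\<^sup>2 * 4 ^ j) = 4 / (s\<^sup>2 * 4 ^ k)" using s by (simp add: j)
        finally show ?thesis using k by blast
      qed
      then obtain k where k: "\<bar>p\<bar> \<le> pi * s * 2 ^ k" "1 / d\<^sup>2 \<le> 4 / (s\<^sup>2 * 4 ^ k)" by blast
      have tk: "t \<in> ?I k" using k(1) p by (auto simp: arc_radius_def p_def)
      have "u t * ennreal (1 / d\<^sup>2) \<le> ennreal (4 / (s\<^sup>2 * 4 ^ k)) * (u t * indicator (?I k) t)"
        using tk ennreal_leI[OF k(2)] by (simp add: mult.commute mult_left_mono)
      also have "\<dots> \<le> (\<Sum>k. ennreal (4 / (s\<^sup>2 * 4 ^ k)) * (u t * indicator (?I k) t))"
        using sum_le_suminf[of "\<lambda>k. ennreal (4 / (s\<^sup>2 * 4 ^ k)) * (u t * indicator (?I k) t)" "{k}"] by simp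
      finally show ?thesis using True by (simp add: d_def p_def)
    qed simp
  qed
  also have "\<dots> = (\<Sum>k. \<integral>\<^sup>+t. ennreal (4 / (s\<^sup>2 * 4 ^ k)) * (u t * indicator (?I k) t) \<partial>lborel)"
    by (rule nn_integral_suminf) measurable
  also have "\<dots> = (\<Sum>k. ennreal (4 / (s\<^sup>2 * 4 ^ k)) * (\<integral>\<^sup>+t\<in>?I k. u t \<partial>lborel))"
    by (intro suminf_cong nn_integral_cmult) measurable
  finally show ?thesis .
qed

lemma suminf_geometric_ennreal:
  "0 \<le> c \<Longrightarrow> (\<Sum>k. ennreal (c / 2 ^ k)) = ennreal (2 * c)"
proof -
  assume c: "0 \<le> c"
  have "(\<lambda>k. c * (1/2) ^ k) sums (c * (1 / (1 - 1/2)))"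
    by (intro sums_mult geometric_sums) auto
  then have "(\<lambda>k. c / 2 ^ k) sums (2 * c)" by (simp add: power_divide mult.commute)
  then show ?thesis using c by (intro suminf_ennreal_eq) auto
qed

text \<open>The radial maximal function is controlled by averages over centred arcs. If all of them
  were small, the dyadic bound would sum to \<open>8 * \<alpha> * pi / s\<close>, and the Poisson
  factor \<open>s * (2 - s) / (2*pi)\<close> turns this into \<open>4 * \<alpha> * (2 - s)\<close>,
  at most the \<open>8 * \<alpha>\<close> of the hypothesis.\<close>

lemma maximal_point:
  assumes f: "f holomorphic_on ball 0 1" "continuous_on (cball 0 1) f" and r: "0 \<le> r" "r < 1"
    and "0 < \<alpha>" and big: "8 * \<alpha> < (cmod (f (of_real r * cis \<theta>)))\<^sup>2"
  shows "\<exists>\<rho>>0. \<rho> \<le> pi \<and> ennreal (\<alpha> * \<rho>) < (\<integral>\<^sup>+t\<in>{\<theta>-\<rho>..\<theta>+\<rho>}. ennreal ((cmod (f (cis t)))\<^sup>2) \<partial>lborel)"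
proof (rule ccontr)
  assume "\<not> ?thesis"
  then have small: "(\<integral>\<^sup>+t\<in>{\<theta>-\<rho>..\<theta>+\<rho>}. ennreal ((cmod (f (cis t)))\<^sup>2) \<partial>lborel) \<le> ennreal (\<alpha> * \<rho>)"
    if "0 < \<rho>" "\<rho> \<le> pi" for \<rho> using that by force
  define s where "s = 1 - r"
  have s: "0 < s" "s \<le> 1" "r = 1 - s" using r by (auto simp: s_def)
  have cf: "continuous_on UNIV (\<lambda>t. f (cis t))"
    by (rule continuous_on_compose2[OF f(2)]) (auto intro!: continuous_intros)
  have [measurable]: "(\<lambda>t. f (cis t)) \<in> borel_measurable borel" by (rule borel_measurable_continuous_onI[OF cf])
  have "(\<integral>\<^sup>+t\<in>{\<theta>-pi..\<theta>+pi}. ennreal ((cmod (f (cis t)))\<^sup>2 / (cmod (1 - of_real r * cis (t-\<theta>)))\<^sup>2) \<partial>lborel)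
    = (\<integral>\<^sup>+t\<in>{\<theta>-pi..\<theta>+pi}. ennreal ((cmod (f (cis t)))\<^sup>2) * ennreal (1 / (cmod (1 - of_real (1-s) * cis (t-\<theta>)))\<^sup>2) \<partial>lborel)"
    by (intro nn_integral_cong) (simp add: s(3) ennreal_mult[symmetric])
  also have "\<dots> \<le> (\<Sum>k. ennreal (4 / (s\<^sup>2 * 4 ^ k)) *
      (\<integral>\<^sup>+t\<in>{\<theta> - arc_radius s k..\<theta> + arc_radius s k}. ennreal ((cmod (f (cis t)))\<^sup>2) \<partial>lborel))"
    by (rule dyadic_kernel_bound) (use s in auto)
  also have "\<dots> \<le> (\<Sum>k. ennreal ((4 * \<alpha> * pi / s) / 2 ^ k))"
  proof (intro suminf_le)
    fix k
    have "ennreal (4 / (s\<^sup>2 * 4 ^ k)) *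
      (\<integral>\<^sup>+t\<in>{\<theta> - arc_radius s k..\<theta> + arc_radius s k}. ennreal ((cmod (f (cis t)))\<^sup>2) \<partial>lborel)
      \<le> ennreal (4 / (s\<^sup>2 * 4 ^ k)) * ennreal (\<alpha> * arc_radius s k)"
      using s by (intro mult_left_mono small) (auto simp: arc_radius_def)
    also have "\<dots> = ennreal (4 / (s\<^sup>2 * 4 ^ k) * (\<alpha> * arc_radius s k))"
      using s \<open>0 < \<alpha>\<close> by (intro ennreal_mult[symmetric]) (auto simp: arc_radius_def)
    also have "\<dots> \<le> ennreal (4 / (s\<^sup>2 * 4 ^ k) * (\<alpha> * (pi * s * 2 ^ k)))"
      using s \<open>0 < \<alpha>\<close> by (intro ennreal_leI mult_left_mono) (auto simp: arc_radius_def)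
    also have "4 / (s\<^sup>2 * 4 ^ k) * (\<alpha> * (pi * s * 2 ^ k)) = (4 * \<alpha> * pi / s) / 2 ^ k"
    proof -
      have "(4::real) ^ k = 2 ^ k * 2 ^ k" by (simp add: power_mult_distrib[symmetric])
      then show ?thesis using s by (simp add: field_simps power2_eq_square)
    qed
    finally show "ennreal (4 / (s\<^sup>2 * 4 ^ k)) *
      (\<integral>\<^sup>+t\<in>{\<theta> - arc_radius s k..\<theta> + arc_radius s k}. ennreal ((cmod (f (cis t)))\<^sup>2) \<partial>lborel)
      \<le> ennreal ((4 * \<alpha> * pi / s) / 2 ^ k)" .
  qed auto
  also have "\<dots> = ennreal (2 * (4 * \<alpha> * pi / s))"
    using s \<open>0 < \<alpha>\<close> by (intro suminf_geometric_ennreal) auto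
  finally have I: "(\<integral>\<^sup>+t\<in>{\<theta>-pi..\<theta>+pi}. ennreal ((cmod (f (cis t)))\<^sup>2 / (cmod (1 - of_real r * cis (t-\<theta>)))\<^sup>2) \<partial>lborel)
    \<le> ennreal (2 * (4 * \<alpha> * pi / s))" .
  have r2: "0 \<le> 1 - r\<^sup>2" using r by (simp add: power_le_one)
  have "ennreal ((cmod (f (of_real r * cis \<theta>)))\<^sup>2) \<le> ennreal ((1 - r\<^sup>2) / (2*pi)) * ennreal (2 * (4 * \<alpha> * pi / s))"
    using poisson_bound[OF f r, of \<theta>] I by (meson mult_left_mono order_trans zero_le)
  also have "\<dots> = ennreal ((1 - r\<^sup>2) / (2*pi) * (2 * (4 * \<alpha> * pi / s)))"
    using s \<open>0 < \<alpha>\<close> r2 by (intro ennreal_mult[symmetric]) auto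
  also have "(1 - r\<^sup>2) / (2*pi) * (2 * (4 * \<alpha> * pi / s)) = 4 * \<alpha> * (2 - s)"
  proof -
    have "1 - r\<^sup>2 = s * (2 - s)" by (simp add: s_def power2_eq_square algebra_simps)
    then show ?thesis using s(1) by simp
  qed
  finally have "(cmod (f (of_real r * cis \<theta>)))\<^sup>2 \<le> 4 * \<alpha> * (2 - s)"
    using s \<open>0 < \<alpha>\<close> by (subst (asm) ennreal_le_iff) auto
  also have "\<dots> \<le> 8 * \<alpha>" using s \<open>0 < \<alpha>\<close> by (simp add: algebra_simps)
  finally show False using big by simp
qed

text \<open>Each point of \<open>E\<close> carries an interval of radius \<open>\<rho>\<close> and
  mass above \<open>\<alpha> * \<rho>\<close>. Vitali's lemma selects disjoint ones whose fivefold
  enlargements, of length \<open>10 * \<rho>\<close>, cover \<open>E\<close>. The selected intervals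
  lie in two periods, which doubles \<open>10 / \<alpha>\<close> to
  \<open>20 / \<alpha>\<close>.\<close>

lemma weak_type_closed_disc:
  assumes f: "f holomorphic_on ball 0 1" "continuous_on (cball 0 1) f" and "0 < \<alpha>"
    and E: "E \<in> sets borel" "\<And>t. t \<in> E \<Longrightarrow> 0 \<le> t \<and> t \<le> 2*pi \<and> (\<exists>r. 0 \<le> r \<and> r < 1 \<and> 8 * \<alpha> < (cmod (f (of_real r * cis t)))\<^sup>2)"
  shows "emeasure lborel E \<le> ennreal (20 / \<alpha>) * circle_sq f 1"
proof -
  have cf: "continuous_on UNIV (\<lambda>t. f (cis t))"
    by (rule continuous_on_compose2[OF f(2)]) (auto intro!: continuous_intros)
  have [measurable]: "(\<lambda>t. f (cis t)) \<in> borel_measurable borel" by (rule borel_measurable_continuous_onI[OF cf])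
  define u where "u t = ennreal ((cmod (f (cis t)))\<^sup>2)" for t
  have [measurable]: "u \<in> borel_measurable borel" unfolding u_def by measurable
  have "\<exists>\<rho>. 0 < \<rho> \<and> \<rho> \<le> pi \<and> ennreal (\<alpha> * \<rho>) < (\<integral>\<^sup>+x\<in>cball t \<rho>. u x \<partial>lborel)" if "t \<in> E" for t
  proof -
    note tE = that
    obtain r where "0 \<le> r" "r < 1" "8 * \<alpha> < (cmod (f (of_real r * cis t)))\<^sup>2" using E(2)[OF tE] by blast
    from maximal_point[OF f this(1,2) \<open>0 < \<alpha>\<close> this(3)] show ?thesis by (auto simp: u_def cball_eq_atLeastAtMost)
  qed
  then have "\<forall>t\<in>E. \<exists>\<rho>. 0 < \<rho> \<and> \<rho> \<le> pi \<and> ennreal (\<alpha> * \<rho>) < (\<integral>\<^sup>+x\<in>cball t \<rho>. u x \<partial>lborel)"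
    by (rule ballI)
  from bchoice[OF this] obtain \<rho> where \<rho>': "\<forall>t\<in>E. 0 < \<rho> t \<and> \<rho> t \<le> pi \<and>
     ennreal (\<alpha> * \<rho> t) < (\<integral>\<^sup>+x\<in>cball t (\<rho> t). u x \<partial>lborel)" by (elim exE)
  then have \<rho>: "\<And>t. t \<in> E \<Longrightarrow> 0 < \<rho> t \<and> \<rho> t \<le> pi"
     "\<And>t. t \<in> E \<Longrightarrow> ennreal (\<alpha> * \<rho> t) < (\<integral>\<^sup>+x\<in>cball t (\<rho> t). u x \<partial>lborel)" by simp_all
  have cov: "E \<subseteq> (\<Union>i\<in>E. cball i (\<rho> i))" using \<rho>(1) by (fastforce simp: less_imp_le)
  obtain C where C: "countable C" "C \<subseteq> E"
     "pairwise (\<lambda>i j. disjnt (cball i (\<rho> i)) (cball j (\<rho> j))) C" "E \<subseteq> (\<Union>i\<in>C. cball i (5 * \<rho> i))"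
    using Vitali_covering_lemma_cballs[OF cov \<rho>(1)] .
  have "emeasure lborel E = (\<integral>\<^sup>+x. indicator E x \<partial>lborel)"
    using E(1) by simp
  \<comment> \<open>The integral over \<open>count_space C\<close> is a sum over the countable set
    \<open>C\<close>; the term of one ball containing \<open>x\<close> already dominates the
    indicator.\<close>
  also have "\<dots> \<le> (\<integral>\<^sup>+x. (\<integral>\<^sup>+i. indicator (cball i (5 * \<rho> i)) x \<partial>count_space C) \<partial>lborel)"
  proof (intro nn_integral_mono)
    fix x
    show "indicator E x \<le> (\<integral>\<^sup>+i. indicator (cball i (5 * \<rho> i)) x \<partial>count_space C)"
    proof (cases "x \<in> E")
      case True
      then obtain i where i: "i \<in> C" "x \<in> cball i (5 * \<rho> i)" using C(4) by blast
      show ?thesis using nn_integral_ge_point[OF i(1), of "\<lambda>i. indicator (cball i (5 * \<rho> i)) x"] i True by simp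
    qed simp
  qed
  also have "\<dots> = (\<integral>\<^sup>+i. emeasure lborel (cball i (5 * \<rho> i)) \<partial>count_space C)"
    by (subst nn_integral_count_space_nn_integral[OF C(1)]) (auto intro!: borel_measurable_indicator borel_closed)
  also have "\<dots> \<le> (\<integral>\<^sup>+i. ennreal (10 / \<alpha>) * (\<integral>\<^sup>+x\<in>cball i (\<rho> i). u x \<partial>lborel) \<partial>count_space C)"
  proof (intro nn_integral_mono)
    fix i assume "i \<in> space (count_space C)"
    then have i: "i \<in> E" using C by auto
    have "emeasure lborel (cball i (5 * \<rho> i)) = ennreal (10 / \<alpha> * (\<alpha> * \<rho> i))"
      using \<rho>(1)[OF i] \<open>0 < \<alpha>\<close> by (simp add: cball_eq_atLeastAtMost)
    also have "\<dots> = ennreal (10 / \<alpha>) * ennreal (\<alpha> * \<rho> i)"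
      using \<rho>(1)[OF i] \<open>0 < \<alpha>\<close> by (intro ennreal_mult) auto
    also have "\<dots> \<le> ennreal (10 / \<alpha>) * (\<integral>\<^sup>+x\<in>cball i (\<rho> i). u x \<partial>lborel)"
      using \<rho>(2)[OF i] by (intro mult_left_mono) auto
    finally show "emeasure lborel (cball i (5 * \<rho> i)) \<le> ennreal (10 / \<alpha>) * (\<integral>\<^sup>+x\<in>cball i (\<rho> i). u x \<partial>lborel)" .
  qed
  also have "\<dots> = ennreal (10 / \<alpha>) * (\<integral>\<^sup>+i. emeasure (density lborel u) (cball i (\<rho> i)) \<partial>count_space C)"
    by (subst nn_integral_cmult) (auto simp: emeasure_density)
  also have "(\<integral>\<^sup>+i. emeasure (density lborel u) (cball i (\<rho> i)) \<partial>count_space C) =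
      emeasure (density lborel u) (\<Union>i\<in>C. cball i (\<rho> i))"
    by (rule emeasure_UN_countable[symmetric])
       (use C in \<open>auto simp: disjoint_family_on_def pairwise_def disjnt_def\<close>)
  also have "\<dots> \<le> emeasure (density lborel u) ({-pi..-pi+2*pi} \<union> {pi..pi+2*pi})"
  proof (rule emeasure_mono)
    show "(\<Union>i\<in>C. cball i (\<rho> i)) \<subseteq> {-pi..-pi+2*pi} \<union> {pi..pi+2*pi}"
    proof
      fix x assume "x \<in> (\<Union>i\<in>C. cball i (\<rho> i))"
      then obtain i where i: "i \<in> E" "\<bar>i - x\<bar> \<le> \<rho> i" using C by (auto simp: dist_real_def)
      with \<rho>(1)[OF i(1)] E(2)[OF i(1)] show "x \<in> {-pi..-pi+2*pi} \<union> {pi..pi+2*pi}" by auto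
    qed
  qed auto
  also have "\<dots> \<le> emeasure (density lborel u) {-pi..-pi+2*pi} + emeasure (density lborel u) {pi..pi+2*pi}"
    by (rule emeasure_subadditive) auto
  also have "\<dots> = circle_sq f 1 + circle_sq f 1"
  proof -
    have "emeasure (density lborel u) {a..a+2*pi} = circle_sq f 1" for a
    proof -
      have "emeasure (density lborel u) {a..a+2*pi} = (\<integral>\<^sup>+x\<in>{a..a+2*pi}. u x \<partial>lborel)"
        by (simp add: emeasure_density)
      also have "\<dots> = (\<integral>\<^sup>+x\<in>{0..2*pi}. u x \<partial>lborel)"
        by (rule nn_integral_periodic_window) (auto simp: u_def cis_mult[symmetric])
      finally show ?thesis by (simp add: u_def circle_sq_def)
    qed
    then show ?thesis by (simp only:)
  qed
  finally have "emeasure lborel E \<le> ennreal (10 / \<alpha>) * (circle_sq f 1 + circle_sq f 1)"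
    by (simp add: mult_left_mono)
  also have "\<dots> = ennreal (10 / \<alpha>) * ennreal 2 * circle_sq f 1"
    by (simp add: mult_2[symmetric] mult.assoc)
  also have "\<dots> = ennreal (20 / \<alpha>) * circle_sq f 1"
    using \<open>0 < \<alpha>\<close> by (subst ennreal_mult[symmetric]) auto
  finally show ?thesis .
qed

text \<open>The dilations \<open>f (q n * z)\<close> are continuous up to the circle, and their
  exceptional sets increase to that of \<open>f\<close>. Measurability comes from openness: for each
  \<open>r\<close> the condition is open in \<open>t\<close>, hence so is the uncountable union over
  \<open>r\<close>.\<close>

lemma weak_type_open_disc:
  assumes f: "f holomorphic_on ball 0 1"
    and M: "\<And>r. 0 \<le> r \<Longrightarrow> r < 1 \<Longrightarrow> circle_sq f r \<le> M" and "0 < \<alpha>"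
  shows "{t\<in>{0..2*pi}. \<exists>r\<in>{0..<1}. 8 * \<alpha> < (cmod (f (of_real r * cis t)))\<^sup>2} \<in> sets borel" (is "?E \<in> _")
    and "emeasure lborel {t\<in>{0..2*pi}. \<exists>r\<in>{0..<1}. 8 * \<alpha> < (cmod (f (of_real r * cis t)))\<^sup>2} \<le> ennreal (20 / \<alpha>) * M"
proof -
  have cr: "continuous_on UNIV (\<lambda>t. f (of_real r * cis t))" if "r \<in> {0..<1}" for r
    by (rule continuous_on_compose2[OF holomorphic_on_imp_continuous_on[OF f]])
       (use that in \<open>auto intro!: continuous_intros simp: norm_mult\<close>)
  have sets: "{t\<in>{0..2*pi}. \<exists>r\<in>{0..<q}. 8 * \<alpha> < (cmod (f (of_real r * cis t)))\<^sup>2} \<in> sets borel" if "q \<le> 1" for q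
  proof -
    have "open {t. 8 * \<alpha> < (cmod (f (of_real r * cis t)))\<^sup>2}" if "r \<in> {0..<q}" for r
      by (intro open_Collect_less continuous_intros cr) (use that \<open>q \<le> 1\<close> in auto)
    then have "open (\<Union>r\<in>{0..<q}. {t. 8 * \<alpha> < (cmod (f (of_real r * cis t)))\<^sup>2})" by blast
    moreover have "{t\<in>{0..2*pi}. \<exists>r\<in>{0..<q}. 8 * \<alpha> < (cmod (f (of_real r * cis t)))\<^sup>2} =
       {0..2*pi} \<inter> (\<Union>r\<in>{0..<q}. {t. 8 * \<alpha> < (cmod (f (of_real r * cis t)))\<^sup>2})" by auto
    ultimately show ?thesis by auto
  qed
  show "?E \<in> sets borel" by (rule sets) simp
  define q where "q n = 1 - 1 / (real n + 2)" for n
  have q: "0 < q n" "q n < 1" for n by (auto simp: q_def field_simps)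
  define E where "E n = {t\<in>{0..2*pi}. \<exists>r\<in>{0..<q n}. 8 * \<alpha> < (cmod (f (of_real r * cis t)))\<^sup>2}" for n
  have Es: "E n \<in> sets borel" for n unfolding E_def by (rule sets) (use q[of n] in auto)
  have qmono: "q m \<le> q n" if "m \<le> n" for m n using that by (auto simp: q_def frac_le)
  have "incseq E" unfolding E_def incseq_def using qmono by fastforce
  have "?E = (\<Union>n. E n)"
  proof (intro equalityI subsetI)
    fix t assume "t \<in> ?E"
    then obtain r where r: "t \<in> {0..2*pi}" "0 \<le> r" "r < 1" "8 * \<alpha> < (cmod (f (of_real r * cis t)))\<^sup>2" by auto
    obtain n where "real n > 1 / (1 - r)" using reals_Archimedean2 by blast
    then have "r < q n" using r by (simp add: q_def field_simps)
    then have "t \<in> E n" using r by (auto simp: E_def)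
    then show "t \<in> (\<Union>n. E n)" by blast
  next
    fix t assume "t \<in> (\<Union>n. E n)"
    then obtain n r where "t \<in> {0..2*pi}" "0 \<le> r" "r < q n" "8 * \<alpha> < (cmod (f (of_real r * cis t)))\<^sup>2"
      by (auto simp: E_def)
    then show "t \<in> ?E" using q[of n] by auto
  qed
  then have "emeasure lborel ?E = (SUP n. emeasure lborel (E n))"
    using SUP_emeasure_incseq[of E lborel] Es \<open>incseq E\<close> by (simp add: image_subset_iff)
  also have "\<dots> \<le> ennreal (20 / \<alpha>) * M"
  proof (rule SUP_least)
    fix n
    define g where "g z = f (of_real (q n) * z)" for z
    have m: "of_real (q n) * z \<in> ball 0 1" if "cmod z \<le> 1" for z
    proof -
      have "q n * cmod z \<le> q n * 1" using that q[of n] by (intro mult_left_mono) auto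
      then have "q n * cmod z < 1" using q[of n] by linarith
      then show ?thesis using q[of n] by (simp add: norm_mult)
    qed
    have "continuous_on (cball 0 1) g" unfolding g_def
      by (rule continuous_on_compose2[OF holomorphic_on_imp_continuous_on[OF f]])
         (use m in \<open>auto intro!: continuous_intros\<close>)
    moreover have "(f \<circ> (\<lambda>z. of_real (q n) * z)) holomorphic_on ball 0 1"
      by (rule holomorphic_on_compose_gen[OF _ f]) (use m in \<open>auto intro!: holomorphic_intros\<close>)
    then have "g holomorphic_on ball 0 1" by (simp add: g_def[abs_def] o_def)
    ultimately have "emeasure lborel (E n) \<le> ennreal (20 / \<alpha>) * circle_sq g 1"
    proof (intro weak_type_closed_disc[OF _ _ \<open>0 < \<alpha>\<close> Es])
      fix t assume "t \<in> E n"
      then obtain r where r: "t \<in> {0..2*pi}" "0 \<le> r" "r < q n" "8 * \<alpha> < (cmod (f (of_real r * cis t)))\<^sup>2"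
        by (auto simp: E_def)
      have "g (of_real (r / q n) * cis t) = f (of_real r * cis t)"
        using q[of n] by (simp add: g_def)
      then have "\<exists>r. 0 \<le> r \<and> r < 1 \<and> 8 * \<alpha> < (cmod (g (of_real r * cis t)))\<^sup>2"
        using r q[of n] by (intro exI[of _ "r / q n"]) auto
      then show "0 \<le> t \<and> t \<le> 2*pi \<and> (\<exists>r. 0 \<le> r \<and> r < 1 \<and> 8 * \<alpha> < (cmod (g (of_real r * cis t)))\<^sup>2)" using r by auto
    qed
    also have "circle_sq g 1 = circle_sq f (q n)" by (simp add: circle_sq_def g_def)
    also have "\<dots> \<le> M" using M q[of n] by auto
    finally show "emeasure lborel (E n) \<le> ennreal (20 / \<alpha>) * M" by (simp add: mult_left_mono)
  qed
  finally show "emeasure lborel ?E \<le> ennreal (20 / \<alpha>) * M" .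
qed

section \<open>Radial limits of Hardy functions\<close>

lemma holomorphic_circle_continuous:
  assumes "f holomorphic_on ball 0 1" "0 \<le> r" "r < 1"
  shows "continuous_on S (\<lambda>t. f (of_real r * cis t))"
  by (rule continuous_on_compose2[OF holomorphic_on_imp_continuous_on[OF assms(1)]])
     (use assms in \<open>auto intro!: continuous_intros simp: norm_mult\<close>)

lemma holomorphic_circle_measurable:
  assumes "f holomorphic_on ball 0 1" "0 \<le> r" "r < 1"
  shows "(\<lambda>t. f (of_real r * cis t)) \<in> borel_measurable borel"
  by (rule borel_measurable_continuous_onI[OF holomorphic_circle_continuous[OF assms]])

lemma hardy2_circle_sq:
  assumes "f \<in> hardy2"
  shows "\<exists>M\<ge>0. \<forall>r. 0 \<le> r \<and> r < 1 \<longrightarrow> circle_sq f r \<le> ennreal M"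
proof -
  from assms obtain M where f: "f holomorphic_on ball 0 1" and
    M: "\<And>r. r \<in> {0..<1} \<Longrightarrow> (LINT t:{0..2*pi}|lborel. (cmod (f (of_real r * cis t)))\<^sup>2) / (2*pi) \<le> M"
    unfolding hardy2_def by blast
  show ?thesis
  proof (intro exI[of _ "2 * pi * max M 0"] conjI allI impI)
    fix r :: real assume "0 \<le> r \<and> r < 1"
    then have r: "0 \<le> r" "r < 1" by auto
    have "set_integrable lborel {0..2*pi} (\<lambda>t. (cmod (f (of_real r * cis t)))\<^sup>2)"
      unfolding set_integrable_def
      by (intro borel_integrable_compact continuous_intros holomorphic_circle_continuous[OF f r]) auto
    from nn_integral_eq_set_integral[OF this]
    have "circle_sq f r = ennreal (LINT t:{0..2*pi}|lborel. (cmod (f (of_real r * cis t)))\<^sup>2)"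
      by (simp add: circle_sq_def)
    also have "\<dots> \<le> ennreal (2 * pi * max M 0)"
    proof (intro ennreal_leI)
      have "(LINT t:{0..2*pi}|lborel. (cmod (f (of_real r * cis t)))\<^sup>2) \<le> 2 * pi * M"
        using M[of r] r by (simp add: field_simps)
      also have "\<dots> \<le> 2 * pi * max M 0" by (intro mult_left_mono) auto
      finally show "(LINT t:{0..2*pi}|lborel. (cmod (f (of_real r * cis t)))\<^sup>2) \<le> 2 * pi * max M 0" .
    qed
    finally show "circle_sq f r \<le> ennreal (2 * pi * max M 0)" .
  qed simp
qed

lemma circle_sq_powser_le:
  assumes a: "is_powser a f" and r: "0 \<le> r" "r < 1" and s: "summable (\<lambda>n. (cmod (a n))\<^sup>2)"
  shows "circle_sq f r \<le> ennreal (2 * pi * (\<Sum>n. (cmod (a n))\<^sup>2))"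
proof -
  have "circle_sq f r \<le> (\<Sum>n. ennreal (2 * pi * (cmod (a n))\<^sup>2))"
    unfolding circle_sq_powser[OF a r]
    by (intro suminf_le ennreal_leI mult_left_le) (use r in \<open>auto intro: power_le_one\<close>)
  also have "\<dots> = ennreal (2 * pi * (\<Sum>n. (cmod (a n))\<^sup>2))"
    using s by (subst suminf_ennreal2) (auto intro!: summable_mult simp: suminf_mult)
  finally show ?thesis .
qed

lemma tendsto_at_left_if_cauchy:
  fixes h :: "real \<Rightarrow> complex"
  assumes "\<And>e. e > 0 \<Longrightarrow> \<exists>P. eventually P (at_left 1) \<and> (\<forall>x y. P x \<and> P y \<longrightarrow> dist (h x) (h y) < e)"
  shows "\<exists>L. (h \<longlongrightarrow> L) (at_left 1)"
proof -
  have "cauchy_filter (filtermap h (at_left 1))"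
    unfolding cauchy_filter_metric_filtermap using assms by blast
  moreover have "filtermap h (at_left 1) \<noteq> bot"
    by (simp add: filtermap_bot_iff trivial_limit_at_left_real)
  ultimately show ?thesis
    using complete_UNIV[where 'a = complex, unfolded complete_uniform] by (auto simp: filterlim_def)
qed

text \<open>The tail \<open>g N\<close> of the power series has small mean squares, so by the weak
  type inequality its radial supremum is small off a set of small measure, while the polynomial
  \<open>P N\<close> is continuous up to the circle. Off a null set the radial oscillation of
  \<open>f\<close> is therefore arbitrarily small, and completeness gives the limit.\<close>

lemma fatou_interval:
  assumes f: "f holomorphic_on ball 0 1"
    and M: "\<And>r. 0 \<le> r \<Longrightarrow> r < 1 \<Longrightarrow> circle_sq f r \<le> ennreal M" and "0 \<le> M"
  obtains Z where "Z \<in> null_sets lborel"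
    "\<And>t. t \<in> {0..2*pi} - Z \<Longrightarrow> \<exists>L. ((\<lambda>r. f (of_real r * cis t)) \<longlongrightarrow> L) (at_left 1)"
proof -
  obtain a where a: "is_powser a f" using holomorphic_is_powser[OF f] .
  note sq = powser_square_summable[OF a M \<open>0 \<le> M\<close>]
  define P where "P N z = (\<Sum>n<N. a n * z ^ n)" for N z
  define g where "g N z = f z - P N z" for N z
  define b where "b N n = (if n < N then 0 else a n)" for N n
  define \<tau> where "\<tau> N = (\<Sum>n. (cmod (b N n))\<^sup>2)" for N
  have bs: "summable (\<lambda>n. (cmod (b N n))\<^sup>2)" for N
    by (rule summable_comparison_test'[OF sq(1), of 0]) (auto simp: b_def)
  have gp: "is_powser (b N) (g N)" for N
    unfolding is_powser_def
  proof
    fix z :: complex assume "z \<in> ball 0 1"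
    then have "(\<lambda>n. a n * z ^ n) sums f z" using a by (simp add: is_powser_def)
    moreover have "(\<lambda>n. if n < N then a n * z ^ n else 0) sums P N z"
      using sums_If_finite_set[of "{..<N}" "\<lambda>n. a n * z ^ n"] by (simp add: P_def)
    ultimately have "(\<lambda>n. a n * z ^ n - (if n < N then a n * z ^ n else 0)) sums g N z"
      unfolding g_def by (rule sums_diff)
    moreover have "a n * z ^ n - (if n < N then a n * z ^ n else 0) = b N n * z ^ n" for n by (simp add: b_def)
    ultimately show "(\<lambda>n. b N n * z ^ n) sums g N z" by simp
  qed
  have gh: "g N holomorphic_on ball 0 1" for N
    unfolding g_def P_def by (intro holomorphic_intros f)
  have \<tau>: "\<tau> \<longlonglongrightarrow> 0"
  proof -
    have "\<tau> = (\<lambda>N. (\<Sum>n. (cmod (a n))\<^sup>2) - (\<Sum>n<N. (cmod (a n))\<^sup>2))"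
    proof
      fix N
      have "\<tau> N = (\<Sum>n. (cmod (b N (n + N)))\<^sup>2) + (\<Sum>n<N. (cmod (b N n))\<^sup>2)"
        unfolding \<tau>_def by (rule suminf_split_initial_segment[OF bs])
      also have "(\<Sum>n<N. (cmod (b N n))\<^sup>2) = 0" by (simp add: b_def)
      also have "(\<lambda>n. (cmod (b N (n + N)))\<^sup>2) = (\<lambda>n. (cmod (a (n + N)))\<^sup>2)" by (simp add: b_def)
      finally show "\<tau> N = (\<Sum>n. (cmod (a n))\<^sup>2) - (\<Sum>n<N. (cmod (a n))\<^sup>2)"
        using suminf_split_initial_segment[OF sq(1), of N] by simp
    qed
    moreover have "(\<lambda>N. (\<Sum>n. (cmod (a n))\<^sup>2) - (\<Sum>n<N. (cmod (a n))\<^sup>2)) \<longlonglongrightarrow> (\<Sum>n. (cmod (a n))\<^sup>2) - (\<Sum>n. (cmod (a n))\<^sup>2)"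
      by (intro tendsto_intros summable_LIMSEQ sq)
    ultimately show ?thesis by simp
  qed
  have \<tau>0: "0 \<le> \<tau> N" for N unfolding \<tau>_def by (intro suminf_nonneg bs) auto
  \<comment> \<open>Chosen so that the threshold \<open>8 * \<alpha> m\<close> of the weak type
    inequality is the square of \<open>1/(m+1)\<close>.\<close>
  define \<alpha> where "\<alpha> m = 1 / (8 * (real m + 1)\<^sup>2)" for m :: nat
  have \<alpha>: "0 < \<alpha> m" "8 * \<alpha> m = (1 / (real m + 1))\<^sup>2" for m
    by (auto simp: \<alpha>_def power_divide)
  define B where "B N m = {t\<in>{0..2*pi}. \<exists>r\<in>{0..<1}. 8 * \<alpha> m < (cmod (g N (of_real r * cis t)))\<^sup>2}" for N m
  have Bs: "B N m \<in> sets borel" and Be: "emeasure lborel (B N m) \<le> ennreal (20 / \<alpha> m * (2 * pi * \<tau> N))" for N m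
  proof -
    have gM: "circle_sq (g N) r \<le> ennreal (2 * pi * \<tau> N)" if "0 \<le> r" "r < 1" for r
      using circle_sq_powser_le[OF gp that bs] by (simp add: \<tau>_def)
    show "B N m \<in> sets borel"
      unfolding B_def by (rule weak_type_open_disc(1)[OF gh gM \<alpha>(1)])
    have "emeasure lborel (B N m) \<le> ennreal (20 / \<alpha> m) * ennreal (2 * pi * \<tau> N)"
      unfolding B_def by (rule weak_type_open_disc(2)[OF gh gM \<alpha>(1)])
    also have "\<dots> = ennreal (20 / \<alpha> m * (2 * pi * \<tau> N))"
      using \<alpha>(1)[of m] \<tau>0[of N] by (intro ennreal_mult[symmetric]) auto
    finally show "emeasure lborel (B N m) \<le> ennreal (20 / \<alpha> m * (2 * pi * \<tau> N))" .
  qed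
  have null: "(\<Inter>N. B N m) \<in> null_sets lborel" for m
  proof -
    have s: "(\<Inter>N. B N m) \<in> sets borel" using Bs by (intro sets.countable_INT) auto
    have "emeasure lborel (\<Inter>N. B N m) \<le> ennreal 0"
    proof (rule tendsto_lowerbound)
      have "(\<lambda>N. 20 / \<alpha> m * (2 * pi * \<tau> N)) \<longlonglongrightarrow> 20 / \<alpha> m * (2 * pi * 0)"
        by (intro tendsto_intros \<tau>)
      then show "(\<lambda>N. ennreal (20 / \<alpha> m * (2 * pi * \<tau> N))) \<longlonglongrightarrow> ennreal 0"
        by (intro tendsto_ennrealI) simp
      show "\<forall>\<^sub>F N in sequentially. emeasure lborel (\<Inter>N. B N m) \<le> ennreal (20 / \<alpha> m * (2 * pi * \<tau> N))"
        by (intro always_eventually allI order_trans[OF emeasure_mono Be]) (use Bs in auto)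
    qed auto
    then show ?thesis using s by (simp add: null_sets_def)
  qed
  show thesis
  proof (rule that[of "\<Union>m. \<Inter>N. B N m"])
    show "(\<Union>m. \<Inter>N. B N m) \<in> null_sets lborel" using null by (intro null_sets_UN) auto
    fix t assume t: "t \<in> {0..2*pi} - (\<Union>m. \<Inter>N. B N m)"
    show "\<exists>L. ((\<lambda>r. f (of_real r * cis t)) \<longlongrightarrow> L) (at_left 1)"
    proof (rule tendsto_at_left_if_cauchy)
      fix e :: real assume e: "e > 0"
      obtain m where m: "1 / (real m + 1) < e / 4"
        using reals_Archimedean[of "e/4"] e by (auto simp: inverse_eq_divide add.commute)
      from t obtain N where "t \<notin> B N m" "t \<in> {0..2*pi}" by blast
      then have gs: "cmod (g N (of_real r * cis t)) < e / 4" if "0 \<le> r" "r < 1" for r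
      proof -
        have "\<not> 8 * \<alpha> m < (cmod (g N (of_real r * cis t)))\<^sup>2"
          using \<open>t \<notin> B N m\<close> \<open>t \<in> {0..2*pi}\<close> that by (auto simp: B_def)
        then have "(cmod (g N (of_real r * cis t)))\<^sup>2 \<le> (1 / (real m + 1))\<^sup>2" unfolding \<alpha>(2) by (simp only: not_less)
        then have "cmod (g N (of_real r * cis t)) \<le> 1 / (real m + 1)" by (rule power2_le_imp_le) simp
        then show ?thesis using m by simp
      qed
      have "((\<lambda>r. P N (of_real r * cis t)) \<longlongrightarrow> P N (of_real 1 * cis t)) (at_left 1)"
        unfolding P_def by (intro tendsto_intros)
      then have ev: "eventually (\<lambda>r. dist (P N (of_real r * cis t)) (P N (of_real 1 * cis t)) < e / 4) (at_left 1)"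
        using e by (intro tendstoD) auto
      have ev1: "eventually (\<lambda>r::real. 0 \<le> r \<and> r < 1) (at_left 1)"
        by (rule eventually_at_leftI[of 0]) auto
      show "\<exists>Q. eventually Q (at_left 1) \<and> (\<forall>x y. Q x \<and> Q y \<longrightarrow> dist (f (of_real x * cis t)) (f (of_real y * cis t)) < e)"
      proof (intro exI conjI allI impI)
        show "eventually (\<lambda>r. (0 \<le> r \<and> r < 1) \<and> dist (P N (of_real r * cis t)) (P N (of_real 1 * cis t)) < e / 4) (at_left 1)"
          using ev1 ev by (rule eventually_conj)
        fix x y assume xy: "((0 \<le> x \<and> x < 1) \<and> dist (P N (of_real x * cis t)) (P N (of_real 1 * cis t)) < e / 4) \<and>
          ((0 \<le> y \<and> y < 1) \<and> dist (P N (of_real y * cis t)) (P N (of_real 1 * cis t)) < e / 4)"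
        have fe: "f z = g N z + P N z" for z by (simp add: g_def)
        have "dist (f (of_real x * cis t)) (f (of_real y * cis t)) \<le>
           dist (g N (of_real x * cis t)) (g N (of_real y * cis t)) + dist (P N (of_real x * cis t)) (P N (of_real y * cis t))"
          unfolding fe by (rule dist_triangle_add)
        also have "dist (g N (of_real x * cis t)) (g N (of_real y * cis t)) \<le> cmod (g N (of_real x * cis t)) + cmod (g N (of_real y * cis t))"
          unfolding dist_norm by (rule norm_triangle_ineq4)
        also have "dist (P N (of_real x * cis t)) (P N (of_real y * cis t)) \<le>
          dist (P N (of_real x * cis t)) (P N (of_real 1 * cis t)) + dist (P N (of_real y * cis t)) (P N (of_real 1 * cis t))"
          by (rule dist_triangle2)
        finally show "dist (f (of_real x * cis t)) (f (of_real y * cis t)) < e"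
          using gs[of x] gs[of y] xy by simp
      qed
    qed
  qed
qed

text \<open>Arcs may start at any angle, so the result is wanted on the whole line. The exceptional
  set is covered by countably many translates of a null set by multiples of
  \<open>2*pi\<close>.\<close>

lemma fatou_radial_limits:
  assumes "f \<in> hardy2"
  shows "AE t in lborel. \<exists>L. ((\<lambda>r. f (of_real r * cis t)) \<longlongrightarrow> L) (at_left 1)"
proof -
  obtain M where M: "0 \<le> M" "\<And>r. 0 \<le> r \<Longrightarrow> r < 1 \<Longrightarrow> circle_sq f r \<le> ennreal M"
    using hardy2_circle_sq[OF assms] by blast
  have f: "f holomorphic_on ball 0 1" using assms by (simp add: hardy2_def)
  obtain Z where Z: "Z \<in> null_sets lborel"
    "\<And>t. t \<in> {0..2*pi} - Z \<Longrightarrow> \<exists>L. ((\<lambda>r. f (of_real r * cis t)) \<longlongrightarrow> L) (at_left 1)"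
    using fatou_interval[OF f M(2,1)] by blast
  have [measurable]: "Z \<in> sets borel" using Z(1) by auto
  have "AE t in lborel. t \<notin> Z" using Z(1) by (rule AE_not_in)
  then have "AE t in lborel. 2*pi * real_of_int k + 1 * t \<notin> Z" for k :: int
    by (intro AE_borel_affine) auto
  then have "AE t in lborel. \<forall>k::int. 2*pi * real_of_int k + 1 * t \<notin> Z"
    by (simp add: AE_all_countable)
  then show ?thesis
  proof (rule eventually_mono)
    fix t assume t: "\<forall>k::int. 2*pi * real_of_int k + 1 * t \<notin> Z"
    define k where "k = - \<lfloor>t / (2*pi)\<rfloor>"
    define u where "u = 2*pi * real_of_int k + t"
    have "real_of_int \<lfloor>t / (2*pi)\<rfloor> \<le> t / (2*pi)" "t / (2*pi) < real_of_int \<lfloor>t / (2*pi)\<rfloor> + 1" by linarith+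
    then have "real_of_int \<lfloor>t / (2*pi)\<rfloor> * (2*pi) \<le> t" "t < (real_of_int \<lfloor>t / (2*pi)\<rfloor> + 1) * (2*pi)"
      by (simp_all only: pos_le_divide_eq[of "2*pi"] pos_divide_less_eq[of "2*pi"] mult_pos_pos zero_less_numeral pi_gt_zero)
    then have "u \<in> {0..2*pi}" unfolding u_def k_def by (auto simp: algebra_simps)
    moreover have "u \<notin> Z" using t[rule_format, of k] by (simp add: u_def)
    ultimately have "\<exists>L. ((\<lambda>r. f (of_real r * cis u)) \<longlongrightarrow> L) (at_left 1)" using Z(2) by blast
    moreover have "cis u = cis t"
      using cis_multiple_2pi[of "real_of_int k"] by (simp add: u_def cis_mult[symmetric])
    ultimately show "\<exists>L. ((\<lambda>r. f (of_real r * cis t)) \<longlongrightarrow> L) (at_left 1)" by simp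
  qed
qed

section \<open>Boundary values: measurability and mean square convergence\<close>

lemma bval_eqI: "((\<lambda>r. f (of_real r * cis t)) \<longlongrightarrow> L) (at_left 1) \<Longrightarrow> bval f t = L"
  unfolding bval_def by (rule tendsto_Lim) (simp_all add: trivial_limit_at_left_real)

lemma bval_tendsto_AE:
  assumes "f \<in> hardy2"
  shows "AE t in lborel. ((\<lambda>r. f (of_real r * cis t)) \<longlongrightarrow> bval f t) (at_left 1)"
  using fatou_radial_limits[OF assms] by (rule eventually_mono) (metis bval_eqI)

lemma bval_periodic: "bval f (t + 2*pi) = bval f t"
  by (simp add: bval_def cis_mult[symmetric])

text \<open>A countable stand-in for \<open>r -> 1\<close>, so that limits of measurable functions
  and Fatou's lemma for sequences apply.\<close>

definition radius_seq :: "nat \<Rightarrow> real" where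
  "radius_seq n = 1 - 1 / (real n + 2)"

lemma radius_seq: "0 \<le> radius_seq n" "radius_seq n < 1" "m \<le> n \<Longrightarrow> radius_seq m \<le> radius_seq n"
  by (auto simp: radius_seq_def field_simps)

lemma radius_seq_lim: "radius_seq \<longlonglongrightarrow> 1" "filterlim radius_seq (at_left 1) sequentially"
proof -
  have "(\<lambda>n. 1 - 1 / (real n + 2)) \<longlonglongrightarrow> 1 - 0"
    using LIMSEQ_ignore_initial_segment[OF lim_1_over_n[where 'a = real], of 2]
    by (intro tendsto_diff tendsto_const) (simp add: add.commute)
  then show l: "radius_seq \<longlonglongrightarrow> 1" by (simp add: radius_seq_def[abs_def])
  show "filterlim radius_seq (at_left 1) sequentially"
    unfolding filterlim_at using l radius_seq(2) by (auto simp: less_imp_neq)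
qed

lemma radius_seq_exceeds: "r < 1 \<Longrightarrow> \<exists>n. r < radius_seq n"
  using order_tendstoD(1)[OF radius_seq_lim(1), of r] by (auto simp: eventually_sequentially)

text \<open>Where the radial limit fails to exist, \<^const>\<open>bval\<close> takes one fixed junk value; it is therefore
  Borel measurable, not merely almost everywhere equal to a measurable function.\<close>

lemma bval_measurable:
  assumes f: "f holomorphic_on ball 0 1"
  shows "bval f \<in> borel_measurable borel"
proof -
  let ?lim = "\<lambda>t L. ((\<lambda>r. f (of_real r * cis t)) \<longlongrightarrow> L) (at_left 1)"
  define C where "C = {t. \<exists>L. ?lim t L}"
  \<comment> \<open>The Cauchy criterion for the radial limit. With a weak inequality and all pairs
    of radii beyond \<open>radius_seq n\<close>, each \<open>D m n\<close> is an intersection of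
    closed sets, and the convergence set becomes a countable combination of them.\<close>
  define D where "D m n = {t. \<forall>r\<in>{radius_seq n<..<1}. \<forall>s\<in>{radius_seq n<..<1}.
     dist (f (of_real r * cis t)) (f (of_real s * cis t)) \<le> 1 / (real m + 1)}" for m n :: nat
  have Dc: "closed (D m n)" for m n
  proof -
    have "D m n = (\<Inter>r\<in>{radius_seq n<..<1}. \<Inter>s\<in>{radius_seq n<..<1}.
       {t. dist (f (of_real r * cis t)) (f (of_real s * cis t)) \<le> 1 / (real m + 1)})"
      by (auto simp: D_def)
    also have "closed \<dots>"
      by (intro closed_INT ballI closed_Collect_le continuous_on_dist continuous_on_const
        holomorphic_circle_continuous[OF f]) (use radius_seq(1)[of n] in auto)
    finally show ?thesis .
  qed
  have "C = (\<Inter>m. \<Union>n. D m n)"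
  proof (intro equalityI subsetI)
    fix t assume "t \<in> C"
    then obtain L where L: "?lim t L" by (auto simp: C_def)
    show "t \<in> (\<Inter>m. \<Union>n. D m n)"
    proof
      fix m :: nat
      have "eventually (\<lambda>r. dist (f (of_real r * cis t)) L < 1 / (real m + 1) / 2) (at_left 1)"
        using L by (rule tendstoD) simp
      then obtain b where b: "b < 1" "\<And>r. b < r \<Longrightarrow> r < 1 \<Longrightarrow> dist (f (of_real r * cis t)) L < 1 / (real m + 1) / 2"
        by (auto simp: eventually_at_left_field)
      obtain n where n: "b < radius_seq n" using radius_seq_exceeds[OF b(1)] by blast
      have "t \<in> D m n" unfolding D_def
      proof (intro CollectI ballI)
        fix r s assume "r \<in> {radius_seq n<..<1}" "s \<in> {radius_seq n<..<1}"
        then show "dist (f (of_real r * cis t)) (f (of_real s * cis t)) \<le> 1 / (real m + 1)"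
          using b(2)[of r] b(2)[of s] n dist_triangle_half_l[of "f (of_real r * cis t)" L "1 / (real m + 1)"]
          by (fastforce simp: dist_commute)
      qed
      then show "t \<in> (\<Union>n. D m n)" by blast
    qed
  next
    fix t assume t: "t \<in> (\<Inter>m. \<Union>n. D m n)"
    have "\<exists>L. ?lim t L"
    proof (rule tendsto_at_left_if_cauchy)
      fix e :: real assume e: "e > 0"
      obtain m where m: "1 / (real m + 1) < e"
        using reals_Archimedean[of e] e by (auto simp: inverse_eq_divide add.commute)
      from t obtain n where n: "t \<in> D m n" by blast
      show "\<exists>P. eventually P (at_left 1) \<and> (\<forall>x y. P x \<and> P y \<longrightarrow> dist (f (of_real x * cis t)) (f (of_real y * cis t)) < e)"
      proof (intro exI conjI allI impI)
        show "eventually (\<lambda>r. r \<in> {radius_seq n<..<1}) (at_left 1)"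
          by (rule eventually_at_leftI[OF _ radius_seq(2)[of n]]) auto
        show "dist (f (of_real x * cis t)) (f (of_real y * cis t)) < e"
          if "x \<in> {radius_seq n<..<1} \<and> y \<in> {radius_seq n<..<1}" for x y
          using n that m unfolding D_def by fastforce
      qed
    qed
    then show "t \<in> C" by (simp add: C_def)
  qed
  then have Cs: "C \<in> sets borel" using Dc by auto
  \<comment> \<open>\<open>THE L. False\<close> is what \<open>Lim\<close> reduces to where no limit
    exists, so \<open>G\<close> converges to \<open>bval f\<close> at every point.\<close>
  define G where "G n t = (if t \<in> C then f (of_real (radius_seq n) * cis t) else (THE L. False))" for n t
  have "(\<lambda>t. f (of_real (radius_seq n) * cis t)) \<in> borel_measurable borel" for n
    by (intro holomorphic_circle_measurable f radius_seq)
  then have Gm: "G n \<in> borel_measurable borel" for n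
    unfolding G_def using Cs by (intro measurable_If_set) auto
  have Gl: "(\<lambda>n. G n t) \<longlonglongrightarrow> bval f t" for t
  proof (cases "t \<in> C")
    case True
    then obtain L where L: "?lim t L" by (auto simp: C_def)
    from filterlim_compose[OF L radius_seq_lim(2)] show ?thesis
      using True bval_eqI[OF L] by (simp add: G_def)
  next
    case False
    then have "(\<lambda>L. ?lim t L) = (\<lambda>L. False)" by (auto simp: C_def)
    then have "bval f t = (THE L. False)" unfolding bval_def t2_space_class.Lim_def by simp
    then show ?thesis using False by (simp add: G_def)
  qed
  show ?thesis by (rule borel_measurable_LIMSEQ_metric[OF Gm Gl])
qed

text \<open>The difference of two circles has coefficients \<open>a j * (q n ^ j - q k ^ j)\<close>,
  so by Parseval its square integral is at most \<open>2*pi * T n\<close>, uniformly in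
  \<open>k >= n\<close>. Fatou's lemma lets \<open>k\<close> go to infinity under the integral, and
  \<open>T n\<close> tends to 0 by Tannery's theorem.\<close>

lemma bval_L2_limit:
  assumes f: "f \<in> hardy2"
  shows "(\<lambda>n. \<integral>\<^sup>+t\<in>{0..2*pi}. ennreal ((cmod (f (of_real (radius_seq n) * cis t) - bval f t))\<^sup>2) \<partial>lborel) \<longlonglongrightarrow> 0"
proof -
  obtain M where M: "0 \<le> M" "\<And>r. 0 \<le> r \<Longrightarrow> r < 1 \<Longrightarrow> circle_sq f r \<le> ennreal M"
    using hardy2_circle_sq[OF f] by blast
  have fh: "f holomorphic_on ball 0 1" using f by (simp add: hardy2_def)
  obtain a where a: "is_powser a f" using holomorphic_is_powser[OF fh] .
  have sq: "summable (\<lambda>n. (cmod (a n))\<^sup>2)" using powser_square_summable[OF a M(2,1)] by blast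
  let ?q = radius_seq
  have [measurable]: "(\<lambda>t. f (of_real (?q n) * cis t)) \<in> borel_measurable borel" for n
    by (intro holomorphic_circle_measurable fh radius_seq)
  have [measurable]: "bval f \<in> borel_measurable borel" by (rule bval_measurable[OF fh])
  define T where "T n = (\<Sum>j. (cmod (a j))\<^sup>2 * (1 - ?q n ^ j)\<^sup>2)" for n
  have Tb: "norm ((cmod (a j))\<^sup>2 * (1 - ?q n ^ j)\<^sup>2) \<le> (cmod (a j))\<^sup>2" for j n
  proof -
    have "0 \<le> ?q n ^ j" "?q n ^ j \<le> 1" using radius_seq[of n] by (auto intro: power_le_one)
    then have "(1 - ?q n ^ j)\<^sup>2 \<le> 1" by (intro power_le_one) auto
    then show ?thesis by (simp add: mult_left_le)
  qed
  have Ts: "summable (\<lambda>j. (cmod (a j))\<^sup>2 * (1 - ?q n ^ j)\<^sup>2)" for n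
    by (rule summable_comparison_test'[OF sq, of 0]) (rule Tb)
  have T0: "T \<longlonglongrightarrow> 0"
  proof -
    have "(\<lambda>n. \<Sum>j. (cmod (a j))\<^sup>2 * (1 - ?q n ^ j)\<^sup>2) \<longlonglongrightarrow> (\<Sum>j. (0::real))"
    proof (rule tannerys_theorem[THEN conjunct2, THEN conjunct2])
      show "(\<lambda>n. (cmod (a j))\<^sup>2 * (1 - ?q n ^ j)\<^sup>2) \<longlonglongrightarrow> 0" for j
      proof -
        have "(\<lambda>n. (cmod (a j))\<^sup>2 * (1 - ?q n ^ j)\<^sup>2) \<longlonglongrightarrow> (cmod (a j))\<^sup>2 * (1 - 1 ^ j)\<^sup>2"
          by (intro tendsto_intros radius_seq_lim)
        then show ?thesis by simp
      qed
      show "\<forall>\<^sub>F (k, n) in sequentially \<times>\<^sub>F sequentially. norm ((cmod (a k))\<^sup>2 * (1 - ?q n ^ k)\<^sup>2) \<le> (cmod (a k))\<^sup>2"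
        using Tb by (intro always_eventually) auto
    qed (use sq in auto)
    then show ?thesis by (simp add: T_def[abs_def])
  qed
  have diff: "(\<integral>\<^sup>+t\<in>{0..2*pi}. ennreal ((cmod (f (of_real (?q n) * cis t) - f (of_real (?q k) * cis t)))\<^sup>2) \<partial>lborel)
     \<le> ennreal (2 * pi * T n)" if "n \<le> k" for n k
  proof -
    define b where "b j = a j * of_real (?q n) ^ j - a j * of_real (?q k) ^ j" for j
    have s: "summable (\<lambda>j. cmod (a j * of_real (?q m) ^ j))" for m
      using is_powser_summable_norm[OF a radius_seq(1,2), of m] radius_seq(1)[of m]
      by (simp add: norm_mult norm_power)
    have bs: "summable (\<lambda>j. cmod (b j))"
      by (rule summable_comparison_test'[OF summable_add[OF s[of n] s[of k]], of 0])
         (auto simp: b_def norm_triangle_ineq4)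
    have fs: "(\<lambda>j. a j * of_real (?q m) ^ j * cis (real j * t)) sums f (of_real (?q m) * cis t)" for m t
    proof -
      have "of_real (?q m) * cis t \<in> ball 0 1" using radius_seq[of m] by (simp add: norm_mult)
      then have "(\<lambda>j. a j * (of_real (?q m) * cis t) ^ j) sums f (of_real (?q m) * cis t)"
        using a unfolding is_powser_def by blast
      then show ?thesis by (simp add: power_mult_distrib Complex.DeMoivre mult.assoc)
    qed
    have "f (of_real (?q n) * cis t) - f (of_real (?q k) * cis t) = (\<Sum>j. b j * cis (real j * t))" for t
      using sums_unique[OF sums_diff[OF fs[of n t] fs[of k t]]] by (simp add: b_def left_diff_distrib)
    then have "(\<integral>\<^sup>+t\<in>{0..2*pi}. ennreal ((cmod (f (of_real (?q n) * cis t) - f (of_real (?q k) * cis t)))\<^sup>2) \<partial>lborel)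
      = ennreal (2 * pi * (\<Sum>j. (cmod (b j))\<^sup>2))"
      using parseval_cis[OF bs] by simp
    also have "\<dots> \<le> ennreal (2 * pi * T n)"
      unfolding T_def
    proof (intro ennreal_leI mult_left_mono suminf_le)
      show "summable (\<lambda>j. (cmod (b j))\<^sup>2)" using summable_square[OF bs] by simp
      show "(cmod (b j))\<^sup>2 \<le> (cmod (a j))\<^sup>2 * (1 - ?q n ^ j)\<^sup>2" for j
      proof -
        have "b j = a j * of_real (?q n ^ j - ?q k ^ j)" by (simp add: b_def algebra_simps)
        then have "cmod (b j) = cmod (a j) * \<bar>?q n ^ j - ?q k ^ j\<bar>" by (simp only: norm_mult norm_of_real)
        then have "(cmod (b j))\<^sup>2 = (cmod (a j))\<^sup>2 * \<bar>?q n ^ j - ?q k ^ j\<bar>\<^sup>2" by (simp only: power_mult_distrib)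
        moreover have "?q n ^ j \<le> ?q k ^ j" "?q k ^ j \<le> 1"
          using radius_seq[of n] radius_seq[of k] radius_seq(3)[OF that] by (auto intro: power_mono power_le_one)
        then have "\<bar>?q n ^ j - ?q k ^ j\<bar>\<^sup>2 \<le> (1 - ?q n ^ j)\<^sup>2" by (intro power_mono) auto
        ultimately show ?thesis by (simp add: mult_left_mono)
      qed
    qed (use Ts in auto)
    finally show ?thesis .
  qed
  have le: "(\<integral>\<^sup>+t\<in>{0..2*pi}. ennreal ((cmod (f (of_real (?q n) * cis t) - bval f t))\<^sup>2) \<partial>lborel) \<le> ennreal (2 * pi * T n)" for n
  proof -
    let ?u = "\<lambda>k t. ennreal ((cmod (f (of_real (?q n) * cis t) - f (of_real (?q k) * cis t)))\<^sup>2) * indicator {0..2*pi} t"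
    have "(\<integral>\<^sup>+t\<in>{0..2*pi}. ennreal ((cmod (f (of_real (?q n) * cis t) - bval f t))\<^sup>2) \<partial>lborel)
       = (\<integral>\<^sup>+t. liminf (\<lambda>k. ?u k t) \<partial>lborel)"
    proof (rule nn_integral_cong_AE, rule eventually_mono[OF bval_tendsto_AE[OF f]])
      fix t assume L: "((\<lambda>r. f (of_real r * cis t)) \<longlongrightarrow> bval f t) (at_left 1)"
      have "(\<lambda>k. f (of_real (?q k) * cis t)) \<longlonglongrightarrow> bval f t"
        using filterlim_compose[OF L radius_seq_lim(2)] .
      then have "(\<lambda>k. (cmod (f (of_real (?q n) * cis t) - f (of_real (?q k) * cis t)))\<^sup>2) \<longlonglongrightarrow>
         (cmod (f (of_real (?q n) * cis t) - bval f t))\<^sup>2"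
        by (intro tendsto_intros)
      then have "(\<lambda>k. ?u k t) \<longlonglongrightarrow> ennreal ((cmod (f (of_real (?q n) * cis t) - bval f t))\<^sup>2) * indicator {0..2*pi} t"
        by (cases "t \<in> {0..2*pi}") (auto intro: tendsto_ennrealI)
      then show "ennreal ((cmod (f (of_real (?q n) * cis t) - bval f t))\<^sup>2) * indicator {0..2*pi} t = liminf (\<lambda>k. ?u k t)"
        by (intro lim_imp_Liminf[symmetric]) auto
    qed
    also have "\<dots> \<le> liminf (\<lambda>k. \<integral>\<^sup>+t. ?u k t \<partial>lborel)"
      by (rule nn_integral_liminf) measurable
    also have "\<dots> \<le> ennreal (2 * pi * T n)"
      by (rule Liminf_le) (use diff in \<open>auto simp: eventually_sequentially intro!: exI[of _ n]\<close>)
    finally show ?thesis .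
  qed
  have "(\<lambda>n. 2 * pi * T n) \<longlonglongrightarrow> 2 * pi * 0" by (intro tendsto_intros T0)
  then have "(\<lambda>n. ennreal (2 * pi * T n)) \<longlonglongrightarrow> ennreal 0" by (intro tendsto_ennrealI) simp
  then have "(\<lambda>n. ennreal (2 * pi * T n)) \<longlonglongrightarrow> 0" by simp
  then show ?thesis
    by (rule tendsto_sandwich[OF _ _ tendsto_const, rotated 2]) (use le in auto)
qed

section \<open>From mean oscillation to box energy\<close>

lemma cmod_one_minus_ge:
  assumes "cmod z \<le> 1" "cmod w \<le> 1"
  shows "1 - cmod w \<le> cmod (1 - cnj w * z)" "1 - cmod z \<le> cmod (1 - cnj w * z)"
proof -
  have "1 - cmod w * cmod z \<le> cmod (1 - cnj w * z)"
    using norm_triangle_ineq2[of 1 "cnj w * z"] by (simp add: norm_mult)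
  moreover have "cmod w * cmod z \<le> cmod w" "cmod w * cmod z \<le> cmod z"
    using assms by (auto intro: mult_left_le mult_left_le_one_le)
  ultimately show "1 - cmod w \<le> cmod (1 - cnj w * z)" "1 - cmod z \<le> cmod (1 - cnj w * z)" by linarith+
qed

text \<open>Shrinking the radius moves \<open>cnj w * \<zeta>\<close> by at most
  \<open>1 - r\<close>, which the modulus on the right dominates as well. This trades the kernel on
  an inner circle for the one on the boundary at the cost of a factor 2.\<close>

lemma cmod_one_minus_radial:
  assumes "cmod \<zeta> = 1" "0 \<le> r" "r \<le> 1" "cmod w \<le> 1"
  shows "cmod (1 - cnj w * \<zeta>) \<le> 2 * cmod (1 - cnj w * (of_real r * \<zeta>))"
proof -
  have "cmod (1 - cnj w * \<zeta>) \<le> cmod (1 - cnj w * (of_real r * \<zeta>)) + cmod (cnj w * (of_real (1 - r) * \<zeta>))"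
    using norm_triangle_ineq4[of "1 - cnj w * (of_real r * \<zeta>)" "cnj w * (of_real (1 - r) * \<zeta>)"]
    by (simp add: algebra_simps)
  also have "cmod (cnj w * (of_real (1 - r) * \<zeta>)) = cmod w * (1 - r)"
    using assms by (simp add: norm_mult del: of_real_diff)
  also have "\<dots> \<le> 1 - r" using assms by (intro mult_left_le_one_le) auto
  also have "\<dots> \<le> cmod (1 - cnj w * (of_real r * \<zeta>))"
    using cmod_one_minus_ge(2)[of "of_real r * \<zeta>" w] assms by (simp add: norm_mult)
  finally show ?thesis by simp
qed

lemma ennreal_linear_combination:
  "0 \<le> x \<Longrightarrow> 0 \<le> A \<Longrightarrow> 0 \<le> y \<Longrightarrow> 0 \<le> B \<Longrightarrow>
    ennreal (x * A + y * B) = ennreal x * ennreal A + ennreal y * ennreal B"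
  by (simp add: ennreal_mult)

lemma cmod_sq_add_le: "(cmod (x + y))\<^sup>2 \<le> 2 * (cmod x)\<^sup>2 + 2 * (cmod y)\<^sup>2"
proof -
  have "(cmod (x + y))\<^sup>2 \<le> (cmod x + cmod y)\<^sup>2" by (intro power_mono norm_triangle_ineq) auto
  also have "\<dots> \<le> 2 * (cmod x)\<^sup>2 + 2 * (cmod y)\<^sup>2"
    using zero_le_power2[of "cmod x - cmod y"] by (simp add: power2_eq_square algebra_simps)
  finally show ?thesis .
qed

lemma nn_integral_sq_add_le:
  fixes X Y :: "'a \<Rightarrow> complex"
  assumes [measurable]: "X \<in> borel_measurable M" "Y \<in> borel_measurable M" "A \<in> sets M"
  shows "(\<integral>\<^sup>+t\<in>A. ennreal ((cmod (X t + Y t))\<^sup>2) \<partial>M) \<le>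
    2 * (\<integral>\<^sup>+t\<in>A. ennreal ((cmod (X t))\<^sup>2) \<partial>M) + 2 * (\<integral>\<^sup>+t\<in>A. ennreal ((cmod (Y t))\<^sup>2) \<partial>M)"
proof -
  have "(\<integral>\<^sup>+t\<in>A. ennreal ((cmod (X t + Y t))\<^sup>2) \<partial>M) \<le>
    (\<integral>\<^sup>+t. 2 * (ennreal ((cmod (X t))\<^sup>2) * indicator A t) + 2 * (ennreal ((cmod (Y t))\<^sup>2) * indicator A t) \<partial>M)"
  proof (intro nn_integral_mono)
    fix t
    have "ennreal ((cmod (X t + Y t))\<^sup>2) \<le> ennreal (2 * (cmod (X t))\<^sup>2 + 2 * (cmod (Y t))\<^sup>2)"
      by (intro ennreal_leI cmod_sq_add_le)
    also have "\<dots> = 2 * ennreal ((cmod (X t))\<^sup>2) + 2 * ennreal ((cmod (Y t))\<^sup>2)"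
      by (simp add: ennreal_plus ennreal_mult)
    finally show "ennreal ((cmod (X t + Y t))\<^sup>2) * indicator A t \<le>
       2 * (ennreal ((cmod (X t))\<^sup>2) * indicator A t) + 2 * (ennreal ((cmod (Y t))\<^sup>2) * indicator A t)"
      by (auto simp: indicator_def)
  qed
  also have "\<dots> = 2 * (\<integral>\<^sup>+t\<in>A. ennreal ((cmod (X t))\<^sup>2) \<partial>M) + 2 * (\<integral>\<^sup>+t\<in>A. ennreal ((cmod (Y t))\<^sup>2) \<partial>M)"
    by (simp add: nn_integral_add nn_integral_cmult)
  finally show ?thesis .
qed

text \<open>The mean is first pushed outward to radius \<open>radius_seq n\<close>, then
  \<open>f\<close> is replaced by its boundary value. The factor 8 is 2 from squaring a sum times 4
  from the kernel comparison. In the error term the kernel is at most \<open>1 / s^2\<close> with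
  \<open>w\<close> fixed, so mean square convergence removes it.\<close>

lemma quotient_circle_bound:
  assumes f: "f \<in> hardy2" and w: "cmod w < 1" and \<rho>: "0 \<le> \<rho>" "\<rho> < 1"
  shows "circle_sq (\<lambda>z. (f z - c) / (1 - cnj w * z)) \<rho> \<le>
    8 * (\<integral>\<^sup>+t\<in>{0..2*pi}. ennreal ((cmod (bval f t - c))\<^sup>2) * ennreal (1 / (cmod (1 - cnj w * cis t))\<^sup>2) \<partial>lborel)" (is "_ \<le> 8 * ?X")
proof -
  have fh: "f holomorphic_on ball 0 1" using f by (simp add: hardy2_def)
  define h where "h z = (f z - c) / (1 - cnj w * z)" for z
  define s where "s = 1 - cmod w"
  have s: "0 < s" using w by (simp add: s_def)
  let ?q = radius_seq
  let ?e = "\<lambda>n. \<integral>\<^sup>+t\<in>{0..2*pi}. ennreal ((cmod (f (of_real (?q n) * cis t) - bval f t))\<^sup>2) \<partial>lborel"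
  have [measurable]: "(\<lambda>t. f (of_real (?q n) * cis t)) \<in> borel_measurable borel" for n
    by (intro holomorphic_circle_measurable fh radius_seq)
  have [measurable]: "bval f \<in> borel_measurable borel" by (rule bval_measurable[OF fh])
  have ge: "s \<le> cmod (1 - cnj w * z)" if "cmod z \<le> 1" for z
    using cmod_one_minus_ge(1)[OF that] w by (simp add: s_def)
  have nz: "1 - cnj w * z \<noteq> 0" if "z \<in> ball 0 1" for z
    using ge[of z] s that by auto
  have hh: "h holomorphic_on ball 0 1" unfolding h_def
    by (intro holomorphic_intros fh) (use nz in auto)
  have main: "circle_sq h \<rho> \<le> 8 * ?X + ennreal (2 / s\<^sup>2) * ?e n" if n: "\<rho> \<le> ?q n" for n
  proof -
    have "circle_sq h \<rho> \<le> circle_sq h (?q n)"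
      by (rule circle_sq_mono[OF hh \<rho>(1) n radius_seq(2)])
    also have "\<dots> \<le> (\<integral>\<^sup>+t. 8 * (ennreal ((cmod (bval f t - c))\<^sup>2) * ennreal (1 / (cmod (1 - cnj w * cis t))\<^sup>2) * indicator {0..2*pi} t)
        + ennreal (2 / s\<^sup>2) * (ennreal ((cmod (f (of_real (?q n) * cis t) - bval f t))\<^sup>2) * indicator {0..2*pi} t) \<partial>lborel)"
      unfolding circle_sq_def
    proof (intro nn_integral_mono)
      fix t :: real
      let ?z = "of_real (?q n) * cis t"
      let ?A = "cmod (bval f t - c)" and ?D = "cmod (f ?z - bval f t)"
      let ?k = "cmod (1 - cnj w * ?z)" and ?k1 = "cmod (1 - cnj w * cis t)"
      have z: "cmod ?z \<le> 1" using radius_seq(1,2)[of n] by (simp add: norm_mult)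
      have k: "s \<le> ?k" "s \<le> ?k1" "?k1 \<le> 2 * ?k"
        using ge[OF z] ge[of "cis t"] cmod_one_minus_radial[of "cis t" "?q n" w] radius_seq(1,2)[of n] w by auto
      have kp: "0 < ?k" "0 < ?k1" using k s by linarith+
      have k1: "1 / ?k\<^sup>2 \<le> 1 / s\<^sup>2" using kp k s by (intro divide_left_mono power_mono) auto
      have k2: "1 / ?k\<^sup>2 \<le> 4 * (1 / ?k1\<^sup>2)"
      proof -
        have "?k1\<^sup>2 \<le> (2 * ?k)\<^sup>2" using k by (intro power_mono) auto
        moreover have "0 < ?k\<^sup>2" "0 < ?k1\<^sup>2" using kp by auto
        moreover have "1 / b \<le> 4 * (1 / a)" if "a \<le> 4 * b" "0 < b" "0 < a" for a b :: real
          using that by (simp add: field_simps)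
        ultimately show ?thesis by (simp add: power_mult_distrib)
      qed
      have "(cmod (h ?z))\<^sup>2 = (cmod ((bval f t - c) + (f ?z - bval f t)))\<^sup>2 * (1 / ?k\<^sup>2)"
        by (simp add: h_def norm_divide power_divide)
      also have "\<dots> \<le> (2 * ?A\<^sup>2 + 2 * ?D\<^sup>2) * (1 / ?k\<^sup>2)"
        by (intro mult_right_mono cmod_sq_add_le) auto
      also have "\<dots> = 2 * ?A\<^sup>2 * (1 / ?k\<^sup>2) + 2 * ?D\<^sup>2 * (1 / ?k\<^sup>2)" by (simp only: distrib_right)
      also have "\<dots> \<le> 2 * ?A\<^sup>2 * (4 * (1 / ?k1\<^sup>2)) + 2 * ?D\<^sup>2 * (1 / s\<^sup>2)"
        by (intro add_mono mult_left_mono k1 k2) auto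
      also have "\<dots> = 8 * (?A\<^sup>2 * (1 / ?k1\<^sup>2)) + 2 / s\<^sup>2 * ?D\<^sup>2" by simp
      finally have "ennreal ((cmod (h ?z))\<^sup>2) \<le> ennreal (8 * (?A\<^sup>2 * (1 / ?k1\<^sup>2)) + 2 / s\<^sup>2 * ?D\<^sup>2)" by (rule ennreal_leI)
      also have "\<dots> = 8 * (ennreal (?A\<^sup>2) * ennreal (1 / ?k1\<^sup>2)) + ennreal (2 / s\<^sup>2) * ennreal (?D\<^sup>2)"
        by (subst ennreal_plus, simp, simp, subst ennreal_mult, simp, simp, subst ennreal_mult, simp, simp, subst ennreal_mult) simp_all
      finally show "ennreal ((cmod (h ?z))\<^sup>2) * indicator {0..2*pi} t \<le>
         8 * (ennreal (?A\<^sup>2) * ennreal (1 / ?k1\<^sup>2) * indicator {0..2*pi} t) + ennreal (2 / s\<^sup>2) * (ennreal (?D\<^sup>2) * indicator {0..2*pi} t)"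
        by (cases "t \<in> {0..2*pi}") simp_all
    qed
    also have "\<dots> = 8 * ?X + ennreal (2 / s\<^sup>2) * ?e n"
      by (subst nn_integral_add, measurable) (simp add: nn_integral_cmult)
    finally show ?thesis .
  qed
  have "(\<lambda>n. 8 * ?X + ennreal (2 / s\<^sup>2) * ?e n) \<longlonglongrightarrow> 8 * ?X + ennreal (2 / s\<^sup>2) * 0"
    by (intro tendsto_add tendsto_const ennreal_tendsto_cmult bval_L2_limit f) auto
  moreover have "eventually (\<lambda>n. circle_sq h \<rho> \<le> 8 * ?X + ennreal (2 / s\<^sup>2) * ?e n) sequentially"
    using order_tendstoD(1)[OF radius_seq_lim(1) \<rho>(2)]
    by (rule eventually_mono) (rule main, simp)
  ultimately have "circle_sq h \<rho> \<le> 8 * ?X + ennreal (2 / s\<^sup>2) * 0"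
    by (intro tendsto_lowerbound) auto
  then show ?thesis by (simp add: h_def[abs_def])
qed

lemma cmod_one_minus_cis_le: "cmod (1 - cis p) \<le> \<bar>p\<bar>"
proof -
  have "(cmod (1 - cis p))\<^sup>2 = 2 - 2 * cos p"
    using sin_cos_squared_add[of p] unfolding cmod_power2 by (simp add: power2_eq_square algebra_simps)
  also have "cos p = cos (2 * (p/2))" by simp
  also have "2 - 2 * \<dots> = 4 * (sin (p/2))\<^sup>2"
    by (simp only: cos_double_sin) simp
  also have "(sin (p/2))\<^sup>2 \<le> (p/2)\<^sup>2"
    using abs_sin_x_le_abs_x[of "p/2"] unfolding abs_le_square_iff .
  finally have "(cmod (1 - cis p))\<^sup>2 \<le> \<bar>p\<bar>\<^sup>2" by (simp add: power_divide)
  then show ?thesis by (rule power2_le_imp_le) simp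
qed

lemma carleson_boxD:
  assumes "z \<in> carleson_box a l"
  shows "1 - l / (2*pi) \<le> cmod z" "cmod z < 1" "\<exists>t\<in>{a..a+l}. z = of_real (cmod z) * cis t"
proof -
  show "1 - l / (2*pi) \<le> cmod z" "cmod z < 1" using assms by (auto simp: carleson_box_def)
  from assms obtain t where t: "t \<in> {a..a+l}" "z / of_real (cmod z) = cis t" by (auto simp: carleson_box_def)
  then have "z = of_real (cmod z) * cis t" by (cases "z = 0") (auto simp: field_simps)
  with t show "\<exists>t\<in>{a..a+l}. z = of_real (cmod z) * cis t" by blast
qed

text \<open>With \<open>w\<close> the top centre of the box, \<open>f' = (1 - cnj w z) h' - cnj w h\<close> for
  \<open>h = (f - c) / (1 - cnj w z)\<close>, and \<open>1 - cnj w z\<close> is comparable to \<open>s\<close> on the box.\<close>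

lemma box_energy_le_quotient:
  assumes f: "f holomorphic_on ball 0 1" and l: "0 < l" "l \<le> 2*pi" and s: "s = l / (2*pi)"
    and w: "w = of_real (1 - s) * cis (a + l/2)"
    and Q: "\<And>r. 0 \<le> r \<Longrightarrow> r < 1 \<Longrightarrow> circle_sq (\<lambda>z. (f z - c) / (1 - cnj w * z)) r \<le> ennreal Q" "0 \<le> Q"
  shows "box_energy f a l \<le> ennreal (((2 + pi)\<^sup>2 + 4) / pi * s\<^sup>2 * Q)"
proof -
  have s01: "0 < s" "s \<le> 1" using l by (auto simp: s field_simps)
  have cw: "cmod w = 1 - s" using s01 by (simp add: w norm_mult del: of_real_diff)
  define h where "h z = (f z - c) / (1 - cnj w * z)" for z
  have ge: "s \<le> cmod (1 - cnj w * z)" if "cmod z \<le> 1" for z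
    using cmod_one_minus_ge(1)[OF that, of w] cw s01 by simp
  have nz: "1 - cnj w * z \<noteq> 0" if "z \<in> ball 0 1" for z
    using ge[of z] s01 that by auto
  have hh: "h holomorphic_on ball 0 1" unfolding h_def
    by (intro holomorphic_intros f) (use nz in auto)
  have Q': "circle_sq h r \<le> ennreal Q" if "0 \<le> r" "r < 1" for r
    using Q(1)[OF that] by (simp add: h_def[abs_def])
  have dh: "continuous_on (ball 0 1) (deriv h)" "continuous_on (ball 0 1) h"
    by (intro holomorphic_on_imp_continuous_on holomorphic_deriv hh, auto)
       (intro holomorphic_on_imp_continuous_on hh)
  have df: "deriv f z = deriv h z * (1 - cnj w * z) - h z * cnj w" if z: "z \<in> ball 0 1" for z
  proof -
    have "(h has_field_derivative deriv h z) (at z)"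
      using holomorphic_derivI[OF hh open_ball z] .
    then have "((\<lambda>z. h z * (1 - cnj w * z) + c) has_field_derivative deriv h z * (1 - cnj w * z) - h z * cnj w) (at z)"
      by (auto intro!: derivative_eq_intros)
    moreover have "h x * (1 - cnj w * x) + c = f x" if "x \<in> ball 0 1" for x
      using ge[of x] s01 that by (auto simp: h_def)
    ultimately have "(f has_field_derivative deriv h z * (1 - cnj w * z) - h z * cnj w) (at z)"
      by (rule has_field_derivative_transform_within_open[OF _ open_ball z])
    then show ?thesis by (rule DERIV_imp_deriv)
  qed
  \<comment> \<open>The two terms of \<open>f'\<close> gain \<open>s^2\<close> in different ways.
    The one in \<open>h'\<close> carries \<open>|1 - cnj w z|^2\<close> and can be integrated over
    the whole disc with weight \<open>V\<close>. The one in \<open>h\<close> has no such factor; for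
    it \<open>W\<close> keeps the restriction to an annulus of width \<open>s\<close>, where the
    weight is at most \<open>2 * s\<close>.\<close>
  define W where "W r = max 0 (1 - r\<^sup>2) * indicator {1 - s..} r" for r :: real
  define V where "V r = max 0 (1 - r\<^sup>2)" for r :: real
  let ?c1 = "2 * (2 + pi)\<^sup>2 * s\<^sup>2 / pi" and ?c2 = "2 / pi"
  have "box_energy f a l \<le> (\<integral>\<^sup>+z. ennreal ?c1 * (ennreal ((cmod (deriv h z))\<^sup>2 * V (cmod z)) * indicator (ball 0 1) z) +
       ennreal ?c2 * (ennreal ((cmod (h z))\<^sup>2 * W (cmod z)) * indicator (ball 0 1) z) \<partial>lborel)"
    unfolding box_energy_def
  proof (intro nn_integral_mono)
    fix z :: complex
    show "ennreal ((cmod (deriv f z))\<^sup>2 * (1 - (cmod z)\<^sup>2) / pi) * indicator (carleson_box a l) z \<le>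
      ennreal ?c1 * (ennreal ((cmod (deriv h z))\<^sup>2 * V (cmod z)) * indicator (ball 0 1) z) +
       ennreal ?c2 * (ennreal ((cmod (h z))\<^sup>2 * W (cmod z)) * indicator (ball 0 1) z)"
    proof (cases "z \<in> carleson_box a l")
      case True
      note zb = carleson_boxD[OF True]
      obtain t where t: "t \<in> {a..a+l}" "z = of_real (cmod z) * cis t" using zb(3) by blast
      define r where "r = cmod z"
      have r: "1 - s \<le> r" "r < 1" "0 \<le> r" using zb by (auto simp: r_def s)
      have r2: "r\<^sup>2 \<le> 1" using r by (simp add: power_le_one)
      define p where "p = t - (a + l/2)"
      have p: "\<bar>p\<bar> \<le> pi * s" using t(1) by (auto simp: p_def s abs_le_iff field_simps)
      have wz: "cnj w * z = of_real ((1 - s) * r) * cis p"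
      proof -
        have "cnj w = of_real (1 - s) * cis (- (a + l/2))" by (simp add: w cis_cnj)
        then have "cnj w * z = of_real (1 - s) * cis (- (a + l/2)) * (of_real r * cis t)"
          using t(2) by (simp only: r_def)
        also have "\<dots> = of_real ((1 - s) * r) * (cis (- (a + l/2)) * cis t)" by simp
        also have "cis (- (a + l/2)) * cis t = cis p" by (simp add: cis_mult p_def algebra_simps)
        finally show ?thesis .
      qed
      have x1: "0 \<le> (1 - s) * r" "(1 - s) * r \<le> 1"
        using r s01 by (auto intro: mult_le_one)
      \<comment> \<open>Radial and angular deviations are separated: \<open>1 - (1 - s) * r\<close>
        is at most \<open>2 * s\<close>, and \<open>|1 - cis p|\<close> is at most
        \<open>pi * s\<close>.\<close>
      have "cmod (1 - cnj w * z) \<le> cmod (of_real (1 - (1 - s) * r)) + cmod (of_real ((1 - s) * r) * (1 - cis p))"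
        using norm_triangle_ineq[of "of_real (1 - (1 - s) * r)" "of_real ((1 - s) * r) * (1 - cis p)"]
        unfolding wz by (simp add: algebra_simps)
      also have "cmod (of_real (1 - (1 - s) * r)) = 1 - (1 - s) * r" using x1 by (simp del: of_real_diff of_real_mult)
      also have "cmod (of_real ((1 - s) * r) * (1 - cis p)) \<le> 1 * (pi * s)"
        unfolding norm_mult using x1 p cmod_one_minus_cis_le[of p] by (intro mult_mono) (auto simp del: of_real_mult)
      also have "1 - (1 - s) * r \<le> 2 * s"
      proof -
        have "(1 - s) * (1 - s) \<le> (1 - s) * r" using r s01 by (intro mult_left_mono) auto
        moreover have "1 - 2 * s \<le> (1 - s) * (1 - s)" by (simp add: algebra_simps)
        ultimately show ?thesis by linarith
      qed
      finally have up: "cmod (1 - cnj w * z) \<le> (2 + pi) * s" by (simp add: algebra_simps)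
      have zball: "z \<in> ball 0 1" using zb by simp
      have "(cmod (deriv f z))\<^sup>2 = (cmod (deriv h z * (1 - cnj w * z) + - (h z * cnj w)))\<^sup>2"
        using df[OF zball] by simp
      also have "\<dots> \<le> 2 * (cmod (deriv h z * (1 - cnj w * z)))\<^sup>2 + 2 * (cmod (h z * cnj w))\<^sup>2"
        using cmod_sq_add_le[of "deriv h z * (1 - cnj w * z)" "- (h z * cnj w)"] by simp
      also have "(cmod (deriv h z * (1 - cnj w * z)))\<^sup>2 \<le> (cmod (deriv h z) * ((2 + pi) * s))\<^sup>2"
        unfolding norm_mult by (intro power_mono mult_left_mono up) auto
      also have "(cmod (h z * cnj w))\<^sup>2 \<le> (cmod (h z) * 1)\<^sup>2"
        unfolding norm_mult using cw s01 by (intro power_mono mult_left_mono) auto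
      finally have d: "(cmod (deriv f z))\<^sup>2 \<le> 2 * (2 + pi)\<^sup>2 * s\<^sup>2 * (cmod (deriv h z))\<^sup>2 + 2 * (cmod (h z))\<^sup>2"
        by (simp add: power_mult_distrib mult_ac)
      have "(cmod (deriv f z))\<^sup>2 * (1 - r\<^sup>2) / pi \<le> (2 * (2 + pi)\<^sup>2 * s\<^sup>2 * (cmod (deriv h z))\<^sup>2 + 2 * (cmod (h z))\<^sup>2) * (1 - r\<^sup>2) / pi"
        using r2 by (intro divide_right_mono mult_right_mono d) auto
      also have "\<dots> = ?c1 * ((cmod (deriv h z))\<^sup>2 * V r) + ?c2 * ((cmod (h z))\<^sup>2 * W r)"
        using r r2 by (simp add: V_def W_def indicator_def) (simp add: field_simps)
      finally have "ennreal ((cmod (deriv f z))\<^sup>2 * (1 - r\<^sup>2) / pi) \<le> ennreal (?c1 * ((cmod (deriv h z))\<^sup>2 * V r) + ?c2 * ((cmod (h z))\<^sup>2 * W r))"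
        by (rule ennreal_leI)
      also have "\<dots> = ennreal ?c1 * ennreal ((cmod (deriv h z))\<^sup>2 * V r) + ennreal ?c2 * ennreal ((cmod (h z))\<^sup>2 * W r)"
      proof -
        have VW: "0 \<le> V r" "0 \<le> W r" by (auto simp: V_def W_def)
        show ?thesis by (rule ennreal_linear_combination) (use VW in auto)
      qed
      finally show ?thesis using True zball by (simp add: r_def)
    qed simp
  qed
  also have "\<dots> = ennreal ?c1 * (\<integral>\<^sup>+z\<in>ball 0 1. ennreal ((cmod (deriv h z))\<^sup>2 * V (cmod z)) \<partial>lborel) +
       ennreal ?c2 * (\<integral>\<^sup>+z\<in>ball 0 1. ennreal ((cmod (h z))\<^sup>2 * W (cmod z)) \<partial>lborel)"
  proof -
    have [measurable]: "V \<in> borel_measurable borel" "W \<in> borel_measurable borel" unfolding V_def W_def by measurable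
    note [measurable] = cmod_sq_indicator_measurable[OF _ dh(1), of "\<lambda>z. V (cmod z)"]
      cmod_sq_indicator_measurable[OF _ dh(2), of "\<lambda>z. W (cmod z)"]
    show ?thesis by (simp add: nn_integral_add nn_integral_cmult)
  qed
  also have "\<dots> \<le> ennreal ?c1 * ennreal (Q / 2) + ennreal ?c2 * ennreal (2 * s\<^sup>2 * Q)"
  proof (intro add_mono mult_left_mono)
    have "(\<integral>\<^sup>+z\<in>ball 0 1. ennreal ((cmod (deriv h z))\<^sup>2 * V (cmod z)) \<partial>lborel) =
       (\<integral>\<^sup>+z\<in>ball 0 1. ennreal ((cmod (deriv h z))\<^sup>2 * (1 - (cmod z)\<^sup>2)) \<partial>lborel)"
      by (intro nn_integral_cong) (auto simp: indicator_def V_def max_def power_le_one)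
    also have "\<dots> \<le> ennreal (Q / 2)" by (rule littlewood_paley[OF hh Q' Q(2)])
    finally show "(\<integral>\<^sup>+z\<in>ball 0 1. ennreal ((cmod (deriv h z))\<^sup>2 * V (cmod z)) \<partial>lborel) \<le> ennreal (Q / 2)" .
    have "(\<integral>\<^sup>+z\<in>ball 0 1. ennreal ((cmod (h z))\<^sup>2 * W (cmod z)) \<partial>lborel) =
      (\<integral>\<^sup>+r\<in>{0<..<1}. ennreal (r * W r) * circle_sq h r \<partial>lborel)"
      by (rule nn_integral_disc_circles[OF dh(2)]) (auto simp: W_def)
    also have "\<dots> \<le> (\<integral>\<^sup>+r. ennreal (2 * s * Q) * indicator {1 - s..1} r \<partial>lborel)"
    proof (intro nn_integral_mono)
      fix r :: real
      show "ennreal (r * W r) * circle_sq h r * indicator {0<..<1} r \<le> ennreal (2 * s * Q) * indicator {1 - s..1} r"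
      proof (cases "r \<in> {0<..<1} \<and> 1 - s \<le> r")
        case True
        then have r: "0 < r" "r < 1" "1 - s \<le> r" "r\<^sup>2 \<le> 1" by (auto simp: power_le_one)
        have "r * W r \<le> 1 * (2 * s)"
        proof (rule mult_mono)
          have "1 - r\<^sup>2 = (1 - r) * (1 + r)" by (simp add: power2_eq_square algebra_simps)
          also have "\<dots> \<le> s * 2" using r s01 by (intro mult_mono) auto
          finally show "W r \<le> 2 * s" using r s01 by (simp add: W_def)
        qed (use r in \<open>auto simp: W_def\<close>)
        then have "ennreal (r * W r) \<le> ennreal (2 * s)" by (intro ennreal_leI) simp
        then have "ennreal (r * W r) * circle_sq h r \<le> ennreal (2 * s) * ennreal Q"
          by (rule mult_mono[OF _ Q']) (use r in auto)
        also have "\<dots> = ennreal (2 * s * Q)" using s01 Q by (simp add: ennreal_mult)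
        finally show ?thesis using r by simp
      qed (auto simp: W_def)
    qed
    also have "\<dots> = ennreal (2 * s * Q) * ennreal s" using s01 by (simp add: nn_integral_cmult)
    also have "\<dots> = ennreal (2 * s\<^sup>2 * Q)" using s01 Q by (simp add: ennreal_mult[symmetric] power2_eq_square mult_ac)
    finally show "(\<integral>\<^sup>+z\<in>ball 0 1. ennreal ((cmod (h z))\<^sup>2 * W (cmod z)) \<partial>lborel) \<le> ennreal (2 * s\<^sup>2 * Q)" .
  qed auto
  also have "\<dots> = ennreal (?c1 * (Q / 2) + ?c2 * (2 * s\<^sup>2 * Q))"
    using Q(2) s01 by (simp add: ennreal_mult[symmetric] ennreal_plus[symmetric] del: ennreal_plus)
  also have "?c1 * (Q / 2) + ?c2 * (2 * s\<^sup>2 * Q) = ((2 + pi)\<^sup>2 + 4) / pi * s\<^sup>2 * Q"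
    by (simp add: field_simps)
  finally show ?thesis .
qed

text \<open>Constants of consecutive arcs differ by at most \<open>Q\<close>: both are compared with
  \<open>F\<close> on the smaller arc, whose length is at least half of the larger. Since
  \<open>lam < 1\<close>, the bound \<open>6 * M * \<sigma>^(lam-1)\<close> for the squared
  difference is largest on the first arc, where \<open>\<sigma>\<close> is \<open>s\<close>. After
  \<open>k\<close> steps the drift is at most \<open>k * Q\<close>, which is harmless against a
  kernel decaying like \<open>4^(-k)\<close>.\<close>

lemma dyadic_oscillation:
  fixes F :: "real \<Rightarrow> complex" and A :: "nat \<Rightarrow> complex"
  assumes [measurable]: "F \<in> borel_measurable borel" and lam: "0 < lam" "lam < 1" and s: "0 < s" "s \<le> 1" and M: "0 \<le> M"
    and osc: "\<And>k. (\<integral>\<^sup>+t\<in>{\<theta> - arc_radius s k..\<theta> + arc_radius s k}. ennreal ((cmod (F t - A k))\<^sup>2) \<partial>lborel)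
       \<le> ennreal (2 * pi * M * (arc_radius s k / pi) powr lam)"
  shows "(\<integral>\<^sup>+t\<in>{\<theta> - arc_radius s k..\<theta> + arc_radius s k}. ennreal ((cmod (F t - A 0))\<^sup>2) \<partial>lborel)
       \<le> ennreal (28 * pi * M * s powr lam * ((1 + (real k)\<^sup>2) * 2 ^ k))"
proof -
  let ?R = "arc_radius s"
  let ?I = "\<lambda>k. {\<theta> - ?R k..\<theta> + ?R k}"
  define \<sigma> where "\<sigma> k = ?R k / pi" for k
  have \<sigma>e: "\<sigma> k = min 1 (s * 2 ^ k)" for k
    by (simp add: \<sigma>_def arc_radius_def min_def field_simps)
  have R: "?R k = pi * \<sigma> k" "0 \<le> ?R k" for k using s by (auto simp: \<sigma>_def arc_radius_def)
  have s2: "s \<le> s * 2 ^ k" for k using s by (simp add: mult_le_cancel_left1)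
  have \<sigma>: "s \<le> \<sigma> k" "\<sigma> k \<le> 1" "\<sigma> k \<le> s * 2 ^ k" "\<sigma> k \<le> \<sigma> (Suc k)" "\<sigma> (Suc k) \<le> 2 * \<sigma> k" "0 < \<sigma> k" for k
  proof -
    have "0 < s * 2 ^ k" using s by simp
    then show "s \<le> \<sigma> k" "\<sigma> k \<le> 1" "\<sigma> k \<le> s * 2 ^ k" "\<sigma> k \<le> \<sigma> (Suc k)" "\<sigma> (Suc k) \<le> 2 * \<sigma> k" "0 < \<sigma> k"
      using s s2[of k] unfolding \<sigma>e power_Suc mult.left_commute[of s 2] by linarith+
  qed
  have osc': "(\<integral>\<^sup>+t\<in>?I k. ennreal ((cmod (F t - A k))\<^sup>2) \<partial>lborel) \<le> ennreal (2 * pi * M * \<sigma> k powr lam)" for k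
    using osc[of k] by (simp add: \<sigma>_def)
  have const: "(\<integral>\<^sup>+t\<in>?I k. ennreal ((cmod d)\<^sup>2) \<partial>lborel) = ennreal (2 * pi * \<sigma> k * (cmod d)\<^sup>2)" for k d
    using R[of k] \<sigma>(6)[of k] by (simp add: nn_integral_cmult ennreal_mult[symmetric] mult_ac)
  define Q where "Q = sqrt (6 * M * s powr (lam - 1))"
  have step: "cmod (A (Suc k) - A k) \<le> Q" for k
  proof -
    have "ennreal (2 * pi * \<sigma> k * (cmod (A (Suc k) - A k))\<^sup>2) =
        (\<integral>\<^sup>+t\<in>?I k. ennreal ((cmod ((F t - A k) + (A (Suc k) - F t)))\<^sup>2) \<partial>lborel)"
      using const[where k = k and d = "A (Suc k) - A k"] by simp
    also have "\<dots> \<le> 2 * (\<integral>\<^sup>+t\<in>?I k. ennreal ((cmod (F t - A k))\<^sup>2) \<partial>lborel) + 2 * (\<integral>\<^sup>+t\<in>?I k. ennreal ((cmod (A (Suc k) - F t))\<^sup>2) \<partial>lborel)"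
      by (rule nn_integral_sq_add_le) auto
    also have "\<dots> \<le> 2 * ennreal (2 * pi * M * \<sigma> k powr lam) + 2 * ennreal (2 * pi * M * \<sigma> (Suc k) powr lam)"
    proof (intro add_mono mult_left_mono osc')
      have "(\<integral>\<^sup>+t\<in>?I k. ennreal ((cmod (A (Suc k) - F t))\<^sup>2) \<partial>lborel) \<le> (\<integral>\<^sup>+t\<in>?I (Suc k). ennreal ((cmod (F t - A (Suc k)))\<^sup>2) \<partial>lborel)"
      proof -
        have "?R k \<le> ?R (Suc k)" unfolding R(1) using \<sigma>(4)[of k] by (intro mult_left_mono) auto
        then show ?thesis by (intro nn_integral_mono) (auto simp: indicator_def norm_minus_commute)
      qed
      also have "\<dots> \<le> ennreal (2 * pi * M * \<sigma> (Suc k) powr lam)" by (rule osc')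
      finally show "(\<integral>\<^sup>+t\<in>?I k. ennreal ((cmod (A (Suc k) - F t))\<^sup>2) \<partial>lborel) \<le> ennreal (2 * pi * M * \<sigma> (Suc k) powr lam)" .
    qed auto
    also have "\<dots> = ennreal (4 * pi * M * (\<sigma> k powr lam + \<sigma> (Suc k) powr lam))"
      using M by (simp add: ennreal_mult[symmetric] ennreal_plus[symmetric] ennreal_numeral[symmetric] algebra_simps del: ennreal_plus ennreal_numeral)
    also have "\<dots> \<le> ennreal (4 * pi * M * (3 * \<sigma> k powr lam))"
    proof (intro ennreal_leI mult_left_mono)
      have "\<sigma> (Suc k) powr lam \<le> (2 * \<sigma> k) powr lam" using \<sigma>[of k] \<sigma>(6)[of "Suc k"] lam by (intro powr_mono2) auto
      also have "\<dots> = 2 powr lam * \<sigma> k powr lam" using \<sigma>(6)[of k] by (simp add: powr_mult)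
      also have "\<dots> \<le> 2 powr 1 * \<sigma> k powr lam" using lam by (intro mult_right_mono powr_mono) auto
      finally show "\<sigma> k powr lam + \<sigma> (Suc k) powr lam \<le> 3 * \<sigma> k powr lam" by simp
    qed (use M in auto)
    finally have "2 * pi * \<sigma> k * (cmod (A (Suc k) - A k))\<^sup>2 \<le> 4 * pi * M * (3 * \<sigma> k powr lam)"
      using M by (subst (asm) ennreal_le_iff) auto
    then have "(cmod (A (Suc k) - A k))\<^sup>2 \<le> 6 * M * (\<sigma> k powr lam / \<sigma> k)"
      using \<sigma>(6)[of k] by (simp add: field_simps)
    also have "\<sigma> k powr lam / \<sigma> k = \<sigma> k powr (lam - 1)" using \<sigma>(6)[of k] by (simp add: powr_diff)
    also have "\<dots> \<le> s powr (lam - 1)" using \<sigma>(1)[of k] s lam by (intro powr_mono2') auto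
    finally have "(cmod (A (Suc k) - A k))\<^sup>2 \<le> 6 * M * s powr (lam - 1)" using M by (simp add: mult_left_mono)
    then show ?thesis unfolding Q_def by (rule real_le_rsqrt)
  qed
  have tele: "cmod (A k - A 0) \<le> real k * Q" for k
  proof (induction k)
    case (Suc k)
    have "cmod (A (Suc k) - A 0) \<le> cmod (A (Suc k) - A k) + cmod (A k - A 0)"
      using norm_triangle_ineq[of "A (Suc k) - A k" "A k - A 0"] by simp
    then show ?case using step[of k] Suc by (simp add: algebra_simps)
  qed simp
  have "(\<integral>\<^sup>+t\<in>?I k. ennreal ((cmod (F t - A 0))\<^sup>2) \<partial>lborel) = (\<integral>\<^sup>+t\<in>?I k. ennreal ((cmod ((F t - A k) + (A k - A 0)))\<^sup>2) \<partial>lborel)"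
    by simp
  also have "\<dots> \<le> 2 * (\<integral>\<^sup>+t\<in>?I k. ennreal ((cmod (F t - A k))\<^sup>2) \<partial>lborel) + 2 * (\<integral>\<^sup>+t\<in>?I k. ennreal ((cmod (A k - A 0))\<^sup>2) \<partial>lborel)"
    by (rule nn_integral_sq_add_le) auto
  also have "\<dots> \<le> 2 * ennreal (2 * pi * M * \<sigma> k powr lam) + 2 * ennreal (2 * pi * \<sigma> k * (real k * Q)\<^sup>2)"
    unfolding const using tele[of k] \<sigma>(6)[of k] by (intro add_mono mult_left_mono osc' ennreal_leI power_mono) auto
  also have "\<dots> = ennreal (4 * pi * M * \<sigma> k powr lam + 4 * pi * \<sigma> k * (real k * Q)\<^sup>2)"
    using M \<sigma>(6)[of k] by (simp add: ennreal_mult[symmetric] ennreal_plus[symmetric] ennreal_numeral[symmetric] algebra_simps del: ennreal_plus ennreal_numeral)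
  also have "\<dots> \<le> ennreal (28 * pi * M * s powr lam * ((1 + (real k)\<^sup>2) * 2 ^ k))"
  proof (intro ennreal_leI)
    have "\<sigma> k powr lam \<le> (s * 2 ^ k) powr lam" using \<sigma>(3)[of k] \<sigma>(6)[of k] lam by (intro powr_mono2) auto
    also have "\<dots> = s powr lam * (2 ^ k) powr lam" using s by (simp add: powr_mult)
    also have "\<dots> \<le> s powr lam * (2 ^ k) powr 1" using lam by (intro mult_left_mono powr_mono) auto
    finally have "\<sigma> k powr lam \<le> s powr lam * 2 ^ k" by simp
    then have 1: "4 * pi * M * \<sigma> k powr lam \<le> 4 * pi * M * (s powr lam * 2 ^ k)" using M by (intro mult_left_mono) auto
    have "(real k * Q)\<^sup>2 = (real k)\<^sup>2 * (6 * M * s powr (lam - 1))"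
      using M by (simp add: Q_def power_mult_distrib)
    then have "4 * pi * \<sigma> k * (real k * Q)\<^sup>2 = 4 * pi * \<sigma> k * ((real k)\<^sup>2 * (6 * M * s powr (lam - 1)))"
      by (simp only:)
    also have "\<dots> \<le> 4 * pi * (s * 2 ^ k) * ((real k)\<^sup>2 * (6 * M * s powr (lam - 1)))"
      using M \<sigma>(3)[of k] by (intro mult_right_mono mult_left_mono) auto
    also have "\<dots> = 24 * pi * M * (s * s powr (lam - 1)) * ((real k)\<^sup>2 * 2 ^ k)" by (simp add: mult_ac)
    also have "s * s powr (lam - 1) = s powr lam" using s by (simp add: powr_diff)
    finally have 2: "4 * pi * \<sigma> k * (real k * Q)\<^sup>2 \<le> 24 * pi * M * s powr lam * ((real k)\<^sup>2 * 2 ^ k)" .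
    have "0 \<le> pi * M * s powr lam * 2 ^ k" "0 \<le> pi * M * s powr lam * ((real k)\<^sup>2 * 2 ^ k)" using M by auto
    moreover have "4 * pi * M * (s powr lam * 2 ^ k) = 4 * (pi * M * s powr lam * 2 ^ k)"
      "24 * pi * M * s powr lam * ((real k)\<^sup>2 * 2 ^ k) = 24 * (pi * M * s powr lam * ((real k)\<^sup>2 * 2 ^ k))"
      "28 * pi * M * s powr lam * ((1 + (real k)\<^sup>2) * 2 ^ k) =
        28 * (pi * M * s powr lam * 2 ^ k) + 28 * (pi * M * s powr lam * ((real k)\<^sup>2 * 2 ^ k))"
      by (simp_all add: algebra_simps)
    ultimately show "4 * pi * M * \<sigma> k powr lam + 4 * pi * \<sigma> k * (real k * Q)\<^sup>2 \<le> 28 * pi * M * s powr lam * ((1 + (real k)\<^sup>2) * 2 ^ k)"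
      using 1 2 by linarith
  qed
  finally show ?thesis .
qed

lemma bval_L2:
  assumes f: "f \<in> hardy2"
  shows "(\<integral>\<^sup>+t\<in>{a..a+2*pi}. ennreal ((cmod (bval f t))\<^sup>2) \<partial>lborel) < top"
proof -
  have fh: "f holomorphic_on ball 0 1" using f by (simp add: hardy2_def)
  have [measurable]: "bval f \<in> borel_measurable borel" by (rule bval_measurable[OF fh])
  have [measurable]: "(\<lambda>t. f (of_real (radius_seq n) * cis t)) \<in> borel_measurable borel" for n
    by (intro holomorphic_circle_measurable fh radius_seq)
  obtain M where M: "0 \<le> M" "\<And>r. 0 \<le> r \<Longrightarrow> r < 1 \<Longrightarrow> circle_sq f r \<le> ennreal M"
    using hardy2_circle_sq[OF f] by blast
  let ?e = "\<lambda>n. \<integral>\<^sup>+t\<in>{0..2*pi}. ennreal ((cmod (f (of_real (radius_seq n) * cis t) - bval f t))\<^sup>2) \<partial>lborel"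
  have "eventually (\<lambda>n. ?e n < 1) sequentially"
    using order_tendstoD(2)[OF bval_L2_limit[OF f], of 1] by simp
  then obtain n where n: "?e n < 1" by (auto simp: eventually_sequentially)
  have "(\<integral>\<^sup>+t\<in>{a..a+2*pi}. ennreal ((cmod (bval f t))\<^sup>2) \<partial>lborel) = (\<integral>\<^sup>+t\<in>{0..2*pi}. ennreal ((cmod (bval f t))\<^sup>2) \<partial>lborel)"
    by (rule nn_integral_periodic_window) (auto simp: bval_periodic)
  also have "\<dots> = (\<integral>\<^sup>+t\<in>{0..2*pi}. ennreal ((cmod ((bval f t - f (of_real (radius_seq n) * cis t)) + f (of_real (radius_seq n) * cis t)))\<^sup>2) \<partial>lborel)"
    by simp
  also have "\<dots> \<le> 2 * (\<integral>\<^sup>+t\<in>{0..2*pi}. ennreal ((cmod (bval f t - f (of_real (radius_seq n) * cis t)))\<^sup>2) \<partial>lborel)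
      + 2 * circle_sq f (radius_seq n)"
    unfolding circle_sq_def by (rule nn_integral_sq_add_le) auto
  also have "(\<integral>\<^sup>+t\<in>{0..2*pi}. ennreal ((cmod (bval f t - f (of_real (radius_seq n) * cis t)))\<^sup>2) \<partial>lborel) = ?e n"
    by (simp add: norm_minus_commute)
  also have "2 * ?e n + 2 * circle_sq f (radius_seq n) \<le> 2 * 1 + 2 * ennreal M"
    using n M(2)[OF radius_seq(1,2)] by (intro add_mono mult_left_mono) auto
  also have "\<dots> < top" by (simp add: ennreal_mult_less_top)
  finally show ?thesis .
qed

text \<open>\<open>morrey\<close> is defined through Bochner integrals, which are 0 for
  non-integrable functions. Integrability turns its condition into a genuine bound on the
  oscillation.\<close>

lemma bval_set_integrable:
  assumes f: "f \<in> hardy2" and l: "l \<le> 2*pi"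
  shows "set_integrable lborel {a..a+l} (\<lambda>t. (cmod (bval f t - c))\<^sup>2)" "set_integrable lborel {a..a+l} (bval f)"
proof -
  have fh: "f holomorphic_on ball 0 1" using f by (simp add: hardy2_def)
  have [measurable]: "bval f \<in> borel_measurable borel" by (rule bval_measurable[OF fh])
  have L2: "(\<integral>\<^sup>+t\<in>{a..a+l}. ennreal ((cmod (bval f t - c))\<^sup>2) \<partial>lborel) < top" for c
  proof -
    have "(\<integral>\<^sup>+t\<in>{a..a+l}. ennreal ((cmod (bval f t + - c))\<^sup>2) \<partial>lborel) \<le>
      2 * (\<integral>\<^sup>+t\<in>{a..a+l}. ennreal ((cmod (bval f t))\<^sup>2) \<partial>lborel) + 2 * (\<integral>\<^sup>+t\<in>{a..a+l}. ennreal ((cmod (-c))\<^sup>2) \<partial>lborel)"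
      by (rule nn_integral_sq_add_le) auto
    also have "\<dots> \<le> 2 * (\<integral>\<^sup>+t\<in>{a..a+2*pi}. ennreal ((cmod (bval f t))\<^sup>2) \<partial>lborel) + 2 * (\<integral>\<^sup>+t\<in>{a..a+l}. ennreal ((cmod (-c))\<^sup>2) \<partial>lborel)"
      using l by (intro add_mono mult_left_mono nn_integral_mono) (auto simp: indicator_def)
    also have "\<dots> < top" using bval_L2[OF f, of a]
      by (simp add: ennreal_mult_less_top nn_integral_cmult emeasure_lborel_Icc_eq)
    finally show ?thesis by simp
  qed
  show "set_integrable lborel {a..a+l} (\<lambda>t. (cmod (bval f t - c))\<^sup>2)" for c
    unfolding set_integrable_def
  proof (rule integrableI_bounded)
    have "(\<integral>\<^sup>+t. ennreal (norm (indicat_real {a..a+l} t *\<^sub>R (cmod (bval f t - c))\<^sup>2)) \<partial>lborel) =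
       (\<integral>\<^sup>+t\<in>{a..a+l}. ennreal ((cmod (bval f t - c))\<^sup>2) \<partial>lborel)"
      by (intro nn_integral_cong) (auto simp: indicator_def)
    then show "(\<integral>\<^sup>+t. ennreal (norm (indicat_real {a..a+l} t *\<^sub>R (cmod (bval f t - c))\<^sup>2)) \<partial>lborel) < \<infinity>"
      using L2 by simp
  qed measurable
  show "set_integrable lborel {a..a+l} (bval f)"
    unfolding set_integrable_def
  proof (rule integrableI_bounded)
    have "(\<integral>\<^sup>+t. ennreal (norm (indicat_real {a..a+l} t *\<^sub>R bval f t)) \<partial>lborel) \<le>
       (\<integral>\<^sup>+t. ennreal ((cmod (bval f t - 0))\<^sup>2) * indicator {a..a+l} t + indicator {a..a+l} t \<partial>lborel)"
    proof (intro nn_integral_mono)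
      fix t
      have "cmod (bval f t) \<le> (cmod (bval f t))\<^sup>2 + 1"
      proof -
        have "2 * cmod (bval f t) \<le> (cmod (bval f t))\<^sup>2 + 1"
          using zero_le_power2[of "cmod (bval f t) - 1"] unfolding power2_diff by simp
        then show ?thesis using norm_ge_zero[of "bval f t"] by linarith
      qed
      then have "ennreal (cmod (bval f t)) \<le> ennreal ((cmod (bval f t))\<^sup>2) + 1"
        by (metis ennreal_1 ennreal_leI ennreal_plus zero_le_one zero_le_power2)
      then show "ennreal (norm (indicat_real {a..a+l} t *\<^sub>R bval f t)) \<le>
         ennreal ((cmod (bval f t - 0))\<^sup>2) * indicator {a..a+l} t + indicator {a..a+l} t"
        by (auto simp: indicator_def)
    qed
    also have "\<dots> = (\<integral>\<^sup>+t\<in>{a..a+l}. ennreal ((cmod (bval f t - 0))\<^sup>2) \<partial>lborel) + emeasure lborel {a..a+l}"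
      by (subst nn_integral_add) auto
    also have "\<dots> < \<infinity>" using L2[of 0] by (simp add: emeasure_lborel_Icc_eq)
    finally show "(\<integral>\<^sup>+t. ennreal (norm (indicat_real {a..a+l} t *\<^sub>R bval f t)) \<partial>lborel) < \<infinity>" .
  qed measurable
qed

lemma summable_square_geometric: "summable (\<lambda>k. (1 + (real k)\<^sup>2) / 2 ^ k)"
proof (rule summable_ratio_test)
  fix k :: nat assume k: "5 \<le> k"
  \<comment> \<open>5 is the least natural number for which the factor \<open>3/2\<close> works; the
    denominator halves it to the ratio \<open>3/4\<close>.\<close>
  have "1 + (1 + x)\<^sup>2 \<le> 3/2 * (1 + x\<^sup>2)" if "5 \<le> x" for x :: real
  proof -
    have "5 * x \<le> x * x" using that by (intro mult_right_mono) auto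
    moreover have "1 + (1 + 2 * x + y) \<le> 3/2 * (1 + y)" if "5 * x \<le> y" for y
      using that \<open>5 \<le> x\<close> by (simp add: field_simps)
    ultimately have "1 + (1 + 2 * x + x * x) \<le> 3/2 * (1 + x * x)" by blast
    moreover have "(1 + x)\<^sup>2 = 1 + 2 * x + x * x" "x\<^sup>2 = x * x" by (simp_all add: power2_eq_square algebra_simps)
    ultimately show ?thesis by (simp only:)
  qed
  from this[of "real k"] k have "1 + (real (Suc k))\<^sup>2 \<le> 3/2 * (1 + (real k)\<^sup>2)" by simp
  then have "(1 + (real (Suc k))\<^sup>2) / 2 ^ Suc k \<le> (3/2 * (1 + (real k)\<^sup>2)) / 2 ^ Suc k"
    by (rule divide_right_mono) simp
  then show "norm ((1 + (real (Suc k))\<^sup>2) / 2 ^ Suc k) \<le> 3/4 * norm ((1 + (real k)\<^sup>2) / 2 ^ k)"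
    by simp
qed simp

definition osc_const :: real where
  "osc_const = (\<Sum>k. (1 + (real k)\<^sup>2) / 2 ^ k)"

text \<open>The quotient estimate is used with \<open>c\<close> the average over the arc itself and
  \<open>w\<close> the top centre of its box. Kernel decay \<open>4^(-k) / s^2\<close> against
  oscillation \<open>s^lam * (1 + k^2) * 2^k\<close> sums to a multiple of
  \<open>s^lam / s^2\<close>, and the factor \<open>s^2\<close> of the box estimate cancels the
  denominator.\<close>

lemma morrey_box_energy:
  assumes lam: "0 < lam" "lam < 1" and f: "f \<in> morrey lam"
  obtains B where "0 \<le> B"
    "\<And>a l. (a, l) \<in> arc_params \<Longrightarrow> ennreal ((l / (2*pi)) powr (- lam)) * box_energy f a l \<le> ennreal B"
proof -
  from f obtain M0 where fH: "f \<in> hardy2" and M0: "\<And>a l. (a, l) \<in> arc_params \<Longrightarrow> (l / (2*pi)) powr (- lam) *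
          ((LINT t:{a..a+l}|lborel. (cmod (bval f t - arc_avg f a l))\<^sup>2) / (2*pi)) \<le> M0"
    unfolding morrey_def by fast
  have fh: "f holomorphic_on ball 0 1" using fH by (simp add: hardy2_def)
  have [measurable]: "bval f \<in> borel_measurable borel" by (rule bval_measurable[OF fh])
  define M where "M = max M0 0"
  have M: "0 \<le> M" by (simp add: M_def)
  have osc: "(\<integral>\<^sup>+t\<in>{a..a+l}. ennreal ((cmod (bval f t - arc_avg f a l))\<^sup>2) \<partial>lborel) \<le> ennreal (2 * pi * M * (l / (2*pi)) powr lam)"
    if l: "0 < l" "l \<le> 2*pi" for a l
  proof -
    let ?J = "LINT t:{a..a+l}|lborel. (cmod (bval f t - arc_avg f a l))\<^sup>2"
    have "(l / (2*pi)) powr (- lam) * (?J / (2*pi)) \<le> M"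
      using M0[of a l] l by (simp add: arc_params_def M_def)
    then have "(l / (2*pi)) powr lam * ((l / (2*pi)) powr (- lam) * (?J / (2*pi))) \<le> (l / (2*pi)) powr lam * M"
      by (intro mult_left_mono) auto
    moreover have "(l / (2*pi)) powr lam * (l / (2*pi)) powr (- lam) = 1"
      using l by (simp add: powr_add[symmetric])
    ultimately have "?J \<le> 2 * pi * M * (l / (2*pi)) powr lam"
      by (simp add: mult.assoc[symmetric]) (simp add: field_simps)
    then show ?thesis
      by (subst nn_integral_eq_set_integral[OF bval_set_integrable(1)[OF fH l(2)]]) (auto intro: ennreal_leI)
  qed
  define K where "K = ((2 + pi)\<^sup>2 + 4) / pi * (8 * (112 * pi * M * osc_const))"
  have osc0: "0 \<le> osc_const" unfolding osc_const_def by (intro suminf_nonneg summable_square_geometric) auto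
  have "ennreal ((l / (2*pi)) powr (- lam)) * box_energy f a l \<le> ennreal K" if al: "(a, l) \<in> arc_params" for a l
  proof -
    have l: "0 < l" "l \<le> 2*pi" using al by (auto simp: arc_params_def)
    define s where "s = l / (2*pi)"
    have s: "0 < s" "s \<le> 1" using l by (auto simp: s_def field_simps)
    define \<theta> where "\<theta> = a + l/2"
    define w where "w = of_real (1 - s) * cis \<theta>"
    have w: "cmod w < 1" using s by (simp add: w_def norm_mult del: of_real_diff)
    \<comment> \<open>Since \<open>pi * s = l/2\<close>, the arc for \<open>k = 0\<close> is
      \<open>{a..a+l}\<close>, so \<open>A 0\<close> is the average over the given arc.\<close>
    define A where "A k = arc_avg f (\<theta> - arc_radius s k) (2 * arc_radius s k)" for k
    have R: "0 < arc_radius s k" "arc_radius s k \<le> pi" for k using s by (auto simp: arc_radius_def)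
    let ?I = "\<lambda>k. {\<theta> - arc_radius s k..\<theta> + arc_radius s k}"
    have oscA: "(\<integral>\<^sup>+t\<in>?I k. ennreal ((cmod (bval f t - A k))\<^sup>2) \<partial>lborel) \<le> ennreal (2 * pi * M * (arc_radius s k / pi) powr lam)" for k
    proof -
      have "\<theta> - arc_radius s k + 2 * arc_radius s k = \<theta> + arc_radius s k" by simp
      note e = this
      have "0 < 2 * arc_radius s k" "2 * arc_radius s k \<le> 2 * pi" using R[of k] by auto
      from osc[OF this, of "\<theta> - arc_radius s k"] show ?thesis unfolding A_def e by simp
    qed
    have dy: "(\<integral>\<^sup>+t\<in>?I k. ennreal ((cmod (bval f t - A 0))\<^sup>2) \<partial>lborel)
       \<le> ennreal (28 * pi * M * s powr lam * ((1 + (real k)\<^sup>2) * 2 ^ k))" for k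
      by (rule dyadic_oscillation[OF _ lam s M oscA]) measurable
    define X where "X = (\<integral>\<^sup>+t\<in>{0..2*pi}. ennreal ((cmod (bval f t - A 0))\<^sup>2) * ennreal (1 / (cmod (1 - cnj w * cis t))\<^sup>2) \<partial>lborel)"
    \<comment> \<open>112 is the 4 of the kernel bound times the 28 of the oscillation
      bound.\<close>
    define q where "q = 112 * pi * M * osc_const * (s powr lam / s\<^sup>2)"
    have q0: "0 \<le> q" using M osc0 s by (auto simp: q_def)
    have X: "X \<le> ennreal q"
    proof -
      have "X = (\<integral>\<^sup>+t\<in>{\<theta>-pi..\<theta>-pi+2*pi}. ennreal ((cmod (bval f t - A 0))\<^sup>2) * ennreal (1 / (cmod (1 - cnj w * cis t))\<^sup>2) \<partial>lborel)"
        unfolding X_def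
        by (rule nn_integral_periodic_window[symmetric]) (measurable, simp add: bval_periodic cis_mult[symmetric])
      also have "\<dots> = (\<integral>\<^sup>+t\<in>{\<theta>-pi..\<theta>+pi}. ennreal ((cmod (bval f t - A 0))\<^sup>2) * ennreal (1 / (cmod (1 - of_real (1-s) * cis (t-\<theta>)))\<^sup>2) \<partial>lborel)"
      proof -
        have "cnj w * cis t = of_real (1-s) * cis (t-\<theta>)" for t
        proof -
          have "cnj w = of_real (1-s) * cis (-\<theta>)" by (simp add: w_def cis_cnj)
          moreover have "cis (-\<theta>) * cis t = cis (t-\<theta>)" by (simp add: cis_mult)
          ultimately show ?thesis by (simp only: mult.assoc)
        qed
        moreover have "\<theta> - pi + 2*pi = \<theta> + pi" by simp
        ultimately show ?thesis by (simp only:)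
      qed
      also have "\<dots> \<le> (\<Sum>k. ennreal (4 / (s\<^sup>2 * 4 ^ k)) * (\<integral>\<^sup>+t\<in>?I k. ennreal ((cmod (bval f t - A 0))\<^sup>2) \<partial>lborel))"
        by (rule dyadic_kernel_bound[OF _ s]) measurable
      also have "\<dots> \<le> (\<Sum>k. ennreal (112 * pi * M * (s powr lam / s\<^sup>2) * ((1 + (real k)\<^sup>2) / 2 ^ k)))"
      proof (intro suminf_le)
        fix k
        have "ennreal (4 / (s\<^sup>2 * 4 ^ k)) * (\<integral>\<^sup>+t\<in>?I k. ennreal ((cmod (bval f t - A 0))\<^sup>2) \<partial>lborel) \<le>
          ennreal (4 / (s\<^sup>2 * 4 ^ k)) * ennreal (28 * pi * M * s powr lam * ((1 + (real k)\<^sup>2) * 2 ^ k))"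
          by (intro mult_left_mono dy) auto
        also have "\<dots> = ennreal (4 / (s\<^sup>2 * 4 ^ k) * (28 * pi * M * s powr lam * ((1 + (real k)\<^sup>2) * 2 ^ k)))"
          using M by (intro ennreal_mult[symmetric]) auto
        also have "4 / (s\<^sup>2 * 4 ^ k) * (28 * pi * M * s powr lam * ((1 + (real k)\<^sup>2) * 2 ^ k)) =
          112 * pi * M * (s powr lam / s\<^sup>2) * ((1 + (real k)\<^sup>2) / 2 ^ k)"
        proof -
          have "(4::real) ^ k = 2 ^ k * 2 ^ k" by (simp add: power_mult_distrib[symmetric])
          then show ?thesis using s by (simp add: field_simps)
        qed
        finally show "ennreal (4 / (s\<^sup>2 * 4 ^ k)) * (\<integral>\<^sup>+t\<in>?I k. ennreal ((cmod (bval f t - A 0))\<^sup>2) \<partial>lborel)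
          \<le> ennreal (112 * pi * M * (s powr lam / s\<^sup>2) * ((1 + (real k)\<^sup>2) / 2 ^ k))" .
      qed auto
      also have "\<dots> = ennreal q"
      proof -
        have "(\<lambda>k. 112 * pi * M * (s powr lam / s\<^sup>2) * ((1 + (real k)\<^sup>2) / 2 ^ k)) sums (112 * pi * M * (s powr lam / s\<^sup>2) * osc_const)"
          unfolding osc_const_def by (intro sums_mult summable_sums summable_square_geometric)
        then have "(\<lambda>k. 112 * pi * M * (s powr lam / s\<^sup>2) * ((1 + (real k)\<^sup>2) / 2 ^ k)) sums q" by (simp add: q_def mult_ac)
        then show ?thesis using M by (intro suminf_ennreal_eq) auto
      qed
      finally show ?thesis .
    qed
    have "box_energy f a l \<le> ennreal (((2 + pi)\<^sup>2 + 4) / pi * s\<^sup>2 * (8 * q))"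
    proof (rule box_energy_le_quotient[OF fh l s_def, where c = "A 0"])
      show "w = of_real (1 - s) * cis (a + l / 2)" by (simp add: w_def \<theta>_def)
      fix r :: real assume r: "0 \<le> r" "r < 1"
      have "circle_sq (\<lambda>z. (f z - A 0) / (1 - cnj w * z)) r \<le> 8 * X"
        unfolding X_def by (rule quotient_circle_bound[OF fH w r])
      also have "\<dots> \<le> 8 * ennreal q" by (intro mult_left_mono X) auto
      also have "\<dots> = ennreal (8 * q)" using q0 by (simp add: ennreal_mult)
      finally show "circle_sq (\<lambda>z. (f z - A 0) / (1 - cnj w * z)) r \<le> ennreal (8 * q)" .
    qed (use q0 in auto)
    also have "((2 + pi)\<^sup>2 + 4) / pi * s\<^sup>2 * (8 * q) = K * s powr lam"
      using s by (simp add: q_def K_def)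
    finally have "ennreal (s powr (- lam)) * box_energy f a l \<le> ennreal (s powr (- lam)) * ennreal (K * s powr lam)"
      by (intro mult_left_mono) auto
    also have "\<dots> = ennreal (s powr (- lam) * (K * s powr lam))"
      using M osc0 by (intro ennreal_mult[symmetric]) (auto simp: K_def)
    also have "s powr (- lam) * (K * s powr lam) = K * (s powr (-lam) * s powr lam)" by simp
    also have "s powr (-lam) * s powr lam = 1" using s by (simp add: powr_add[symmetric])
    finally show ?thesis by (simp add: s_def)
  qed
  moreover have "0 \<le> K" using M osc0 by (simp add: K_def)
  ultimately show thesis by (rule that[rotated])
qed

section \<open>The seminorm of box energies\<close>

lemma carleson_box_subset: "carleson_box a l \<subseteq> ball 0 1"
  by (auto simp: carleson_box_def)

lemma carleson_box_sets[measurable]: "carleson_box a l \<in> sets borel"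
proof -
  have "closed (cis ` {a..a+l})"
    by (intro compact_imp_closed compact_continuous_image continuous_intros) auto
  then have [measurable]: "cis ` {a..a+l} \<in> sets borel" by (rule borel_closed)
  have eq: "carleson_box a l = {z. 1 - l / (2*pi) \<le> cmod z} \<inter> {z. cmod z < 1} \<inter>
    ((\<lambda>z. z / of_real (cmod z)) -` (cis ` {a..a+l}) \<inter> space borel)"
    by (auto simp: carleson_box_def)
  have "(\<lambda>z::complex. z / of_real (cmod z)) \<in> borel_measurable borel" by measurable
  then have m: "(\<lambda>z. z / of_real (cmod z)) -` (cis ` {a..a+l}) \<inter> space borel \<in> sets (borel :: complex measure)"
    by (rule measurable_sets) measurable
  have "{z::complex. 1 - l / (2*pi) \<le> cmod z} \<in> sets borel" "{z::complex. cmod z < 1} \<in> sets borel"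
    by measurable
  then show ?thesis unfolding eq by (intro sets.Int m)
qed

lemma box_density_measurable:
  assumes "f holomorphic_on ball 0 1"
  shows "(\<lambda>z. ennreal ((cmod (deriv f z))\<^sup>2 * (1 - (cmod z)\<^sup>2) / pi) * indicator (carleson_box a l) z) \<in> borel_measurable borel"
proof -
  have "continuous_on (carleson_box a l) (deriv f)"
    using carleson_box_subset by (intro holomorphic_on_imp_continuous_on[OF holomorphic_on_subset[OF holomorphic_deriv[OF assms]]]) auto
  from cmod_sq_indicator_measurable[OF _ this, of "\<lambda>z. (1 - (cmod z)\<^sup>2) / pi"] show ?thesis by simp
qed

text \<open>A bound for the root of the normalised energy, stated as an inequality in
  \<open>ennreal\<close>. It asserts finiteness, which a value of \<open>morrey_norm\<close> with
  its \<open>enn2real\<close> cannot, and the bounds \<open>x\<close> add like norms.\<close>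

definition arc_bound :: "real \<Rightarrow> (complex \<Rightarrow> complex) \<Rightarrow> real \<Rightarrow> real \<Rightarrow> real \<Rightarrow> bool" where
  "arc_bound lam f a l x \<longleftrightarrow> ennreal ((l / (2*pi)) powr (- lam)) * box_energy f a l \<le> ennreal (x\<^sup>2)"

definition box_bound :: "real \<Rightarrow> (complex \<Rightarrow> complex) \<Rightarrow> real \<Rightarrow> bool" where
  "box_bound lam f x \<longleftrightarrow> f holomorphic_on ball 0 1 \<and> 0 \<le> x \<and> (\<forall>(a, l)\<in>arc_params. arc_bound lam f a l x)"

lemma arc_bound_mono: "arc_bound lam f a l x \<Longrightarrow> 0 \<le> x \<Longrightarrow> x \<le> y \<Longrightarrow> arc_bound lam f a l y"
  unfolding arc_bound_def by (erule order_trans) (auto intro!: ennreal_leI power_mono)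

lemma box_energy_mono_deriv:
  assumes "\<And>z. z \<in> ball 0 1 \<Longrightarrow> cmod (deriv h z) \<le> c * cmod (deriv f z)" "0 \<le> c" "f holomorphic_on ball 0 1"
  shows "box_energy h a l \<le> ennreal (c\<^sup>2) * box_energy f a l"
proof -
  have "box_energy h a l \<le> (\<integral>\<^sup>+z. ennreal (c\<^sup>2) * (ennreal ((cmod (deriv f z))\<^sup>2 * (1 - (cmod z)\<^sup>2) / pi) * indicator (carleson_box a l) z) \<partial>lborel)"
    unfolding box_energy_def
  proof (intro nn_integral_mono)
    fix z :: complex
    show "ennreal ((cmod (deriv h z))\<^sup>2 * (1 - (cmod z)\<^sup>2) / pi) * indicator (carleson_box a l) z \<le>
       ennreal (c\<^sup>2) * (ennreal ((cmod (deriv f z))\<^sup>2 * (1 - (cmod z)\<^sup>2) / pi) * indicator (carleson_box a l) z)"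
    proof (cases "z \<in> carleson_box a l")
      case True
      then have z: "z \<in> ball 0 1" using carleson_box_subset by blast
      then have z2: "0 \<le> (1 - (cmod z)\<^sup>2) / pi" by (simp add: power_le_one)
      have "(cmod (deriv h z))\<^sup>2 \<le> (c * cmod (deriv f z))\<^sup>2" by (intro power_mono assms z) auto
      then have "(cmod (deriv h z))\<^sup>2 * ((1 - (cmod z)\<^sup>2) / pi) \<le> (c * cmod (deriv f z))\<^sup>2 * ((1 - (cmod z)\<^sup>2) / pi)"
        using z2 by (rule mult_right_mono)
      then have "(cmod (deriv h z))\<^sup>2 * (1 - (cmod z)\<^sup>2) / pi \<le> c\<^sup>2 * ((cmod (deriv f z))\<^sup>2 * (1 - (cmod z)\<^sup>2) / pi)"
        by (simp add: power_mult_distrib mult.assoc)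
      then have "ennreal ((cmod (deriv h z))\<^sup>2 * (1 - (cmod z)\<^sup>2) / pi) \<le> ennreal (c\<^sup>2 * ((cmod (deriv f z))\<^sup>2 * (1 - (cmod z)\<^sup>2) / pi))"
        by (rule ennreal_leI)
      also have "\<dots> = ennreal (c\<^sup>2) * ennreal ((cmod (deriv f z))\<^sup>2 * (1 - (cmod z)\<^sup>2) / pi)"
        by (rule ennreal_mult') simp
      finally show ?thesis using True by simp
    qed simp
  qed
  also have "\<dots> = ennreal (c\<^sup>2) * box_energy f a l"
    unfolding box_energy_def by (rule nn_integral_cmult) (simp add: box_density_measurable[OF assms(3)])
  finally show ?thesis .
qed

text \<open>Serves scalar multiples, where \<open>c\<close> is the modulus of the scalar, and
  \<open>Ig g\<close>, where \<open>c\<close> bounds \<open>|g|\<close> on the disc.\<close>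

lemma arc_bound_mono_deriv:
  assumes "arc_bound lam f a l x" "f holomorphic_on ball 0 1" "0 \<le> c"
    "\<And>z. z \<in> ball 0 1 \<Longrightarrow> cmod (deriv h z) \<le> c * cmod (deriv f z)"
  shows "arc_bound lam h a l (c * x)"
proof -
  have "ennreal ((l / (2*pi)) powr (- lam)) * box_energy h a l \<le> ennreal ((l / (2*pi)) powr (- lam)) * (ennreal (c\<^sup>2) * box_energy f a l)"
    by (intro mult_left_mono box_energy_mono_deriv assms) auto
  also have "\<dots> = ennreal (c\<^sup>2) * (ennreal ((l / (2*pi)) powr (- lam)) * box_energy f a l)" by (simp only: mult_ac)
  also have "\<dots> \<le> ennreal (c\<^sup>2) * ennreal (x\<^sup>2)" using assms(1) unfolding arc_bound_def by (intro mult_left_mono) auto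
  also have "\<dots> = ennreal ((c * x)\<^sup>2)" by (simp add: ennreal_mult[symmetric] power_mult_distrib)
  finally show ?thesis unfolding arc_bound_def .
qed

section \<open>Subadditivity of the seminorm and the resulting norm inequalities\<close>

lemma deriv_add_ball:
  assumes "f holomorphic_on ball 0 1" "h holomorphic_on ball 0 1" "z \<in> ball 0 1"
  shows "deriv (\<lambda>z. f z + h z) z = deriv f z + deriv h z"
  using assms by (intro deriv_add) (auto simp: holomorphic_on_open field_differentiable_def)

text \<open>The weight \<open>e\<close> stays free: \<open>e = 1\<close> would give subadditivity of
  the seminorm only up to a constant factor, the optimal \<open>e\<close> gives it exactly.\<close>

lemma cmod_sq_add_weighted:
  assumes "e > 0"
  shows "(cmod (x + y))\<^sup>2 \<le> (1 + e) * (cmod x)\<^sup>2 + (1 + 1/e) * (cmod y)\<^sup>2"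
proof -
  have "0 \<le> (e * cmod x - cmod y)\<^sup>2 / e" using assms by simp
  also have "\<dots> = e * (cmod x)\<^sup>2 + (1/e) * (cmod y)\<^sup>2 - 2 * cmod x * cmod y"
    using assms by (simp add: power2_eq_square field_simps)
  finally have "2 * cmod x * cmod y \<le> e * (cmod x)\<^sup>2 + (1/e) * (cmod y)\<^sup>2" by simp
  moreover have "(cmod (x + y))\<^sup>2 \<le> (cmod x + cmod y)\<^sup>2" by (intro power_mono norm_triangle_ineq) auto
  moreover have "(cmod x + cmod y)\<^sup>2 = (cmod x)\<^sup>2 + (cmod y)\<^sup>2 + 2 * cmod x * cmod y" by (rule power2_sum)
  moreover have "(1 + e) * (cmod x)\<^sup>2 + (1 + 1/e) * (cmod y)\<^sup>2 = (cmod x)\<^sup>2 + e * (cmod x)\<^sup>2 + ((cmod y)\<^sup>2 + (1/e) * (cmod y)\<^sup>2)"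
    by (simp only: distrib_right mult_1)
  ultimately show ?thesis by linarith
qed

lemma box_energy_add_weighted:
  assumes f: "f holomorphic_on ball 0 1" and h: "h holomorphic_on ball 0 1" and e: "e > 0"
  shows "box_energy (\<lambda>z. f z + h z) a l \<le> ennreal (1 + e) * box_energy f a l + ennreal (1 + 1/e) * box_energy h a l"
proof -
  have "box_energy (\<lambda>z. f z + h z) a l \<le>
     (\<integral>\<^sup>+z. ennreal (1 + e) * (ennreal ((cmod (deriv f z))\<^sup>2 * (1 - (cmod z)\<^sup>2) / pi) * indicator (carleson_box a l) z) +
       ennreal (1 + 1/e) * (ennreal ((cmod (deriv h z))\<^sup>2 * (1 - (cmod z)\<^sup>2) / pi) * indicator (carleson_box a l) z) \<partial>lborel)"
    unfolding box_energy_def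
  proof (intro nn_integral_mono)
    fix z :: complex
    let ?k = "(1 - (cmod z)\<^sup>2) / pi"
    show "ennreal ((cmod (deriv (\<lambda>z. f z + h z) z))\<^sup>2 * (1 - (cmod z)\<^sup>2) / pi) * indicator (carleson_box a l) z \<le>
       ennreal (1 + e) * (ennreal ((cmod (deriv f z))\<^sup>2 * (1 - (cmod z)\<^sup>2) / pi) * indicator (carleson_box a l) z) +
       ennreal (1 + 1/e) * (ennreal ((cmod (deriv h z))\<^sup>2 * (1 - (cmod z)\<^sup>2) / pi) * indicator (carleson_box a l) z)"
    proof (cases "z \<in> carleson_box a l")
      case True
      then have z: "z \<in> ball 0 1" using carleson_box_subset by blast
      then have z2: "0 \<le> ?k" by (simp add: power_le_one)
      have "(cmod (deriv (\<lambda>z. f z + h z) z))\<^sup>2 * ?k \<le> ((1 + e) * (cmod (deriv f z))\<^sup>2 + (1 + 1/e) * (cmod (deriv h z))\<^sup>2) * ?k"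
        unfolding deriv_add_ball[OF f h z] by (intro mult_right_mono cmod_sq_add_weighted e z2)
      also have "\<dots> = (1 + e) * ((cmod (deriv f z))\<^sup>2 * ?k) + (1 + 1/e) * ((cmod (deriv h z))\<^sup>2 * ?k)"
        by (simp only: distrib_right mult.assoc)
      finally have "ennreal ((cmod (deriv (\<lambda>z. f z + h z) z))\<^sup>2 * ?k) \<le> ennreal ((1 + e) * ((cmod (deriv f z))\<^sup>2 * ?k) + (1 + 1/e) * ((cmod (deriv h z))\<^sup>2 * ?k))"
        by (rule ennreal_leI)
      also have "\<dots> = ennreal (1 + e) * ennreal ((cmod (deriv f z))\<^sup>2 * ?k) + ennreal (1 + 1/e) * ennreal ((cmod (deriv h z))\<^sup>2 * ?k)"
        by (rule ennreal_linear_combination) (use e z2 in \<open>auto intro!: mult_nonneg_nonneg simp del: times_divide_eq_right\<close>)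
      finally show ?thesis using True by simp
    qed simp
  qed
  also have "\<dots> = ennreal (1 + e) * box_energy f a l + ennreal (1 + 1/e) * box_energy h a l"
    unfolding box_energy_def using box_density_measurable[OF f] box_density_measurable[OF h]
    by (subst nn_integral_add) (auto simp: nn_integral_cmult)
  finally show ?thesis .
qed

text \<open>With \<open>e = Y/X\<close> the weighted inequality yields exactly
  \<open>(X + Y)^2\<close>. Both bounds are first enlarged by \<open>\<eta>\<close>, so that the
  quotient makes sense even if one of them is 0, and then \<open>\<eta>\<close> tends to 0.\<close>

lemma arc_bound_add:
  assumes f: "f holomorphic_on ball 0 1" and h: "h holomorphic_on ball 0 1"
    and x: "arc_bound lam f a l x" "0 \<le> x" and y: "arc_bound lam h a l y" "0 \<le> y"
  shows "arc_bound lam (\<lambda>z. f z + h z) a l (x + y)"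
proof -
  let ?s = "ennreal ((l / (2*pi)) powr (- lam))"
  have "?s * box_energy (\<lambda>z. f z + h z) a l \<le> ennreal (((x + \<eta>) + (y + \<eta>))\<^sup>2)" if \<eta>: "0 < \<eta>" for \<eta>
  proof -
    define X Y where "X = x + \<eta>" and "Y = y + \<eta>"
    have XY: "0 < X" "0 < Y" using x y \<eta> by (auto simp: X_def Y_def)
    have "arc_bound lam f a l X" "arc_bound lam h a l Y"
      using arc_bound_mono[OF x] arc_bound_mono[OF y] \<eta> by (auto simp: X_def Y_def)
    then have b: "?s * box_energy f a l \<le> ennreal (X\<^sup>2)" "?s * box_energy h a l \<le> ennreal (Y\<^sup>2)"
      by (simp_all add: arc_bound_def)
    have "?s * box_energy (\<lambda>z. f z + h z) a l \<le> ?s * (ennreal (1 + Y/X) * box_energy f a l + ennreal (1 + 1/(Y/X)) * box_energy h a l)"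
      using XY by (intro mult_left_mono box_energy_add_weighted f h) auto
    also have "\<dots> = ennreal (1 + Y/X) * (?s * box_energy f a l) + ennreal (1 + 1/(Y/X)) * (?s * box_energy h a l)"
      by (simp only: distrib_left mult_ac)
    also have "\<dots> \<le> ennreal (1 + Y/X) * ennreal (X\<^sup>2) + ennreal (1 + 1/(Y/X)) * ennreal (Y\<^sup>2)"
      by (intro add_mono mult_left_mono b) auto
    also have "\<dots> = ennreal ((1 + Y/X) * X\<^sup>2 + (1 + 1/(Y/X)) * Y\<^sup>2)"
      by (rule ennreal_linear_combination[symmetric]) (use XY in auto)
    also have "(1 + Y/X) * X\<^sup>2 + (1 + 1/(Y/X)) * Y\<^sup>2 = (X + Y)\<^sup>2"
      using XY by (simp add: power2_eq_square field_simps)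
    finally show ?thesis by (simp add: X_def Y_def)
  qed
  then have "eventually (\<lambda>\<eta>. ?s * box_energy (\<lambda>z. f z + h z) a l \<le> ennreal (((x + \<eta>) + (y + \<eta>))\<^sup>2)) (at_right 0)"
    by (intro eventually_at_rightI[of 0 1]) auto
  moreover have "((\<lambda>\<eta>. ennreal (((x + \<eta>) + (y + \<eta>))\<^sup>2)) \<longlongrightarrow> ennreal (((x + 0) + (y + 0))\<^sup>2)) (at_right 0)"
    by (intro tendsto_ennrealI tendsto_intros)
  ultimately show ?thesis unfolding arc_bound_def by (intro tendsto_lowerbound) (auto simp: trivial_limit_at_right_real)
qed

lemma box_bound_add:
  assumes "box_bound lam f x" "box_bound lam h y"
  shows "box_bound lam (\<lambda>z. f z + h z) (x + y)"
  using assms unfolding box_bound_def by (fastforce intro!: arc_bound_add holomorphic_on_add)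

lemma box_bound_cmult:
  assumes "box_bound lam f x"
  shows "box_bound lam (\<lambda>z. c * f z) (cmod c * x)"
proof -
  have f: "f holomorphic_on ball 0 1" using assms by (simp add: box_bound_def)
  have "deriv (\<lambda>z. c * f z) z = c * deriv f z" if "z \<in> ball 0 1" for z
    using f that by (intro deriv_cmult) (auto simp: holomorphic_on_open field_differentiable_def)
  then show ?thesis using assms unfolding box_bound_def
    by (auto intro!: arc_bound_mono_deriv[OF _ f] holomorphic_intros simp: norm_mult)
qed

lemma box_bound_const: "box_bound lam (\<lambda>z. c) 0"
  by (auto simp: box_bound_def arc_bound_def box_energy_def)

abbreviation box_finite :: "real \<Rightarrow> (complex \<Rightarrow> complex) \<Rightarrow> bool" where
  "box_finite lam f \<equiv> \<exists>x. box_bound lam f x"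

lemma morrey_norm_le:
  assumes "box_bound lam f x"
  shows "morrey_norm lam f \<le> cmod (f 0) + x"
proof -
  have "(SUP (a, l)\<in>arc_params. ennreal ((l / (2*pi)) powr (- lam)) * box_energy f a l) \<le> ennreal (x\<^sup>2)"
    using assms by (intro SUP_least) (auto simp: box_bound_def arc_bound_def)
  then have "enn2real (SUP (a, l)\<in>arc_params. ennreal ((l / (2*pi)) powr (- lam)) * box_energy f a l) \<le> x\<^sup>2"
    by (rule enn2real_leI[rotated]) simp
  then have "sqrt (enn2real (SUP (a, l)\<in>arc_params. ennreal ((l / (2*pi)) powr (- lam)) * box_energy f a l)) \<le> x"
    using assms by (intro real_le_lsqrt) (auto simp: box_bound_def)
  then show ?thesis by (simp add: morrey_norm_def)
qed

lemma morrey_norm_nonneg: "0 \<le> morrey_norm lam f"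
  by (simp add: morrey_norm_def)

text \<open>Once some finite bound exists, the supremum is below \<open>top\<close> and
  \<open>enn2real\<close> loses nothing, so the norm without its value at 0 is itself an admissible
  bound. This is why the norm inequalities that follow assume \<open>box_finite\<close>.\<close>

lemma box_bound_morrey_norm:
  assumes "box_finite lam f"
  shows "box_bound lam f (morrey_norm lam f - cmod (f 0))"
proof -
  obtain x where x: "box_bound lam f x" using assms by blast
  let ?S = "SUP (a, l)\<in>arc_params. ennreal ((l / (2*pi)) powr (- lam)) * box_energy f a l"
  have "?S \<le> ennreal (x\<^sup>2)"
    using x by (intro SUP_least) (auto simp: box_bound_def arc_bound_def)
  also have "\<dots> < top" by simp
  finally have S: "ennreal (enn2real ?S) = ?S" by (simp add: less_top)
  have "ennreal ((l / (2*pi)) powr (- lam)) * box_energy f a l \<le> ?S" if "(a, l) \<in> arc_params" for a l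
    using that by (intro SUP_upper2[of "(a, l)"]) auto
  then show ?thesis using x S by (auto simp: box_bound_def arc_bound_def morrey_norm_def)
qed

lemma morrey_norm_add:
  assumes "box_finite lam f" "box_finite lam h"
  shows "morrey_norm lam (\<lambda>z. f z + h z) \<le> morrey_norm lam f + morrey_norm lam h"
  using morrey_norm_le[OF box_bound_add[OF box_bound_morrey_norm[OF assms(1)] box_bound_morrey_norm[OF assms(2)]]]
    norm_triangle_ineq[of "f 0" "h 0"] by linarith

lemma morrey_norm_cmult:
  assumes "box_finite lam f"
  shows "morrey_norm lam (\<lambda>z. c * f z) \<le> cmod c * morrey_norm lam f"
  using morrey_norm_le[OF box_bound_cmult[OF box_bound_morrey_norm[OF assms], of c]]
  by (simp add: norm_mult algebra_simps)

lemma box_finite_add: "box_finite lam f \<Longrightarrow> box_finite lam h \<Longrightarrow> box_finite lam (\<lambda>z. f z + h z)"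
  using box_bound_add by blast

lemma box_finite_cmult: "box_finite lam f \<Longrightarrow> box_finite lam (\<lambda>z. c * f z)"
  using box_bound_cmult by blast

lemma box_finite_diff: "box_finite lam f \<Longrightarrow> box_finite lam h \<Longrightarrow> box_finite lam (\<lambda>z. f z - h z)"
  using box_finite_add[of lam f "\<lambda>z. (-1) * h z"] box_finite_cmult[of lam h "-1"] by simp

lemma morrey_norm_diff:
  assumes "box_finite lam f" "box_finite lam h"
  shows "morrey_norm lam (\<lambda>z. f z - h z) \<le> morrey_norm lam f + morrey_norm lam h"
  using morrey_norm_add[OF assms(1) box_finite_cmult[OF assms(2), of "-1"]] morrey_norm_cmult[OF assms(2), of "-1"] by simp

lemma morrey_norm_le_diff:
  assumes "box_finite lam f" "box_finite lam h"
  shows "morrey_norm lam f \<le> morrey_norm lam (\<lambda>z. f z - h z) + morrey_norm lam h"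
  using morrey_norm_add[OF box_finite_diff[OF assms] assms(2)] by simp

lemma box_finite_sum:
  assumes "\<And>k. k \<in> I \<Longrightarrow> box_finite lam (f k)"
  shows "box_finite lam (\<lambda>z. \<Sum>k\<in>I. f k z)" "morrey_norm lam (\<lambda>z. \<Sum>k\<in>I. f k z) \<le> (\<Sum>k\<in>I. morrey_norm lam (f k))"
proof -
  have z: "morrey_norm lam (\<lambda>z. 0) = 0"
    using morrey_norm_le[OF box_bound_const, of lam 0] morrey_norm_nonneg[of lam "\<lambda>z. 0"] by simp
  have "box_finite lam (\<lambda>z. \<Sum>k\<in>I. f k z) \<and> morrey_norm lam (\<lambda>z. \<Sum>k\<in>I. f k z) \<le> (\<Sum>k\<in>I. morrey_norm lam (f k))"
    using assms
  proof (induction I rule: infinite_finite_induct)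
    case (insert k I)
    then have a: "box_finite lam (f k)" "box_finite lam (\<lambda>z. \<Sum>k\<in>I. f k z)" by auto
    show ?case using insert box_finite_add[OF a] morrey_norm_add[OF a] by simp
  qed (use box_bound_const[of lam 0] z in auto)
  then show "box_finite lam (\<lambda>z. \<Sum>k\<in>I. f k z)" "morrey_norm lam (\<lambda>z. \<Sum>k\<in>I. f k z) \<le> (\<Sum>k\<in>I. morrey_norm lam (f k))" by auto
qed

lemma morrey_box_finite:
  assumes "0 < lam" "lam < 1" "f \<in> morrey lam"
  shows "box_finite lam f"
proof -
  obtain B where "0 \<le> B" "\<And>a l. (a, l) \<in> arc_params \<Longrightarrow> ennreal ((l / (2*pi)) powr (- lam)) * box_energy f a l \<le> ennreal B"
    using morrey_box_energy[OF assms] by blast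
  then have "box_bound lam f (sqrt B)"
    using assms(3) by (auto simp: box_bound_def arc_bound_def morrey_def hardy2_def)
  then show ?thesis by blast
qed

section \<open>Functions that belong to the space\<close>

lemma set_lint_norm_sq_le:
  fixes F :: "real \<Rightarrow> complex"
  assumes "\<And>t. cmod (F t) \<le> B" "F \<in> borel_measurable borel" "0 \<le> l"
  shows "(LINT t:{a..a+l}|lborel. (cmod (F t))\<^sup>2) \<le> B\<^sup>2 * l"
proof -
  have B: "0 \<le> B" using assms(1)[of 0] norm_ge_zero order_trans by blast
  have "(LINT t:{a..a+l}|lborel. (cmod (F t))\<^sup>2) \<le> (LINT t:{a..a+l}|lborel. B\<^sup>2)"
    unfolding set_lebesgue_integral_def
  proof (rule integral_mono)
    show "integrable lborel (\<lambda>t. indicat_real {a..a+l} t *\<^sub>R (cmod (F t))\<^sup>2)"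
      by (rule integrableI_bounded_set_indicator[where B = "B\<^sup>2"])
         (use assms in \<open>auto simp: emeasure_lborel_Icc_eq power_mono\<close>)
    show "integrable lborel (\<lambda>t. indicat_real {a..a+l} t *\<^sub>R B\<^sup>2)"
      by (rule integrableI_bounded_set_indicator[where B = "B\<^sup>2"]) (auto simp: emeasure_lborel_Icc_eq)
  qed (use assms(1) in \<open>auto simp: indicator_def power_mono\<close>)
  also have "\<dots> = B\<^sup>2 * l" using assms(3) by (simp add: set_lebesgue_integral_def)
  finally show ?thesis .
qed

text \<open>A function bounded by \<open>B\<close> has oscillation at most
  \<open>(2 * B)^2 * |I|\<close> on \<open>I\<close>, and \<open>|I|^(1 - lam)\<close> is at most 1.
  The radial limits are the plain values on the circle. This puts all finite sums of test functions
  into the space.\<close>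

lemma continuous_closed_disc_in_morrey:
  assumes lam: "lam < 1" and f: "f holomorphic_on ball 0 1" "continuous_on (cball 0 1) f"
  shows "f \<in> morrey lam"
proof -
  have "bounded (f ` cball 0 1)"
    by (intro compact_imp_bounded compact_continuous_image f) auto
  then obtain B where B: "0 < B" "\<And>z. z \<in> cball 0 1 \<Longrightarrow> cmod (f z) \<le> B"
    by (auto simp: bounded_pos)
  have cf: "continuous_on UNIV (\<lambda>t. f (of_real r * cis t))" if "0 \<le> r" "r \<le> 1" for r
    by (rule continuous_on_compose2[OF f(2)]) (use that in \<open>auto intro!: continuous_intros simp: norm_mult\<close>)
  have m: "(\<lambda>t. f (of_real r * cis t)) \<in> borel_measurable borel" if "0 \<le> r" "r \<le> 1" for r
    by (rule borel_measurable_continuous_onI[OF cf[OF that]])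
  have H: "f \<in> hardy2"
    unfolding hardy2_def
  proof (intro CollectI conjI f exI[of _ "B\<^sup>2"] ballI)
    fix r :: real assume r: "r \<in> {0..<1}"
    have "(LINT t:{0..0+2*pi}|lborel. (cmod (f (of_real r * cis t)))\<^sup>2) \<le> B\<^sup>2 * (2 * pi)"
      by (rule set_lint_norm_sq_le) (use r B m in \<open>auto simp: norm_mult\<close>)
    then show "(LINT t:{0..2*pi}|lborel. (cmod (f (of_real r * cis t)))\<^sup>2) / (2*pi) \<le> B\<^sup>2"
      by (simp add: field_simps)
  qed
  have bv: "bval f t = f (cis t)" for t
  proof (rule bval_eqI)
    have "((\<lambda>r::real. of_real r * cis t) \<longlongrightarrow> of_real 1 * cis t) (at_left 1)" by (intro tendsto_intros)
    moreover have "eventually (\<lambda>r::real. of_real r * cis t \<in> cball 0 1) (at_left 1)"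
      by (rule eventually_at_leftI[of 0]) (auto simp: norm_mult)
    ultimately show "((\<lambda>r. f (of_real r * cis t)) \<longlongrightarrow> f (cis t)) (at_left 1)"
      by (intro continuous_on_tendsto_compose[OF f(2), of "\<lambda>r. of_real r * cis t" "cis t"]) auto
  qed
  have m1: "(\<lambda>t. f (cis t)) \<in> borel_measurable borel" using m[of 1] by simp
  have avg: "cmod (arc_avg f a l) \<le> B" if l: "0 < l" for a l
  proof -
    have "cmod (LINT t:{a..a+l}|lborel. bval f t) \<le> (LINT t:{a..a+l}|lborel. B)"
      unfolding bv set_lebesgue_integral_def
    proof (rule Bochner_Integration.integral_norm_bound_integral)
      show "integrable lborel (\<lambda>t. indicat_real {a..a+l} t *\<^sub>R f (cis t))"
        by (rule integrableI_bounded_set_indicator[where B = B]) (use B m1 in \<open>auto simp: emeasure_lborel_Icc_eq\<close>)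
      show "integrable lborel (\<lambda>t. indicat_real {a..a+l} t *\<^sub>R B)"
        by (rule integrableI_bounded_set_indicator[where B = B]) (use B in \<open>auto simp: emeasure_lborel_Icc_eq\<close>)
    qed (use B in \<open>auto simp: indicator_def\<close>)
    also have "\<dots> = B * l" using l by (simp add: set_lebesgue_integral_def)
    finally show ?thesis using l by (simp add: arc_avg_def norm_mult norm_divide field_simps)
  qed
  show ?thesis
    unfolding morrey_def
  proof (intro CollectI conjI H exI[of _ "(2 * B)\<^sup>2"] ballI, clarify)
    fix a l assume al: "(a, l) \<in> arc_params"
    then have l: "0 < l" "l \<le> 2*pi" by (auto simp: arc_params_def)
    define s where "s = l / (2*pi)"
    have s: "0 < s" "s \<le> 1" using l by (auto simp: s_def)
    have "(LINT t:{a..a+l}|lborel. (cmod (bval f t - arc_avg f a l))\<^sup>2) \<le> (2 * B)\<^sup>2 * l"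
    proof (rule set_lint_norm_sq_le)
      show "cmod (bval f t - arc_avg f a l) \<le> 2 * B" for t
        using norm_triangle_ineq4[of "bval f t" "arc_avg f a l"] avg[OF l(1), of a] B(2)[of "cis t"] by (simp add: bv)
    qed (use m1 l in \<open>auto simp: bv\<close>)
    then have "(LINT t:{a..a+l}|lborel. (cmod (bval f t - arc_avg f a l))\<^sup>2) / (2*pi) \<le> (2 * B)\<^sup>2 * s"
      by (simp add: s_def field_simps)
    then have "s powr (- lam) * ((LINT t:{a..a+l}|lborel. (cmod (bval f t - arc_avg f a l))\<^sup>2) / (2*pi)) \<le> s powr (- lam) * ((2 * B)\<^sup>2 * s)"
      by (intro mult_left_mono) auto
    also have "\<dots> = (2 * B)\<^sup>2 * (s powr (- lam) * s powr 1)" using s by simp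
    also have "s powr (- lam) * s powr 1 = s powr (1 - lam)"
      using powr_add[of s "-lam" 1] by (simp only: uminus_add_conv_diff)
    also have "(2 * B)\<^sup>2 * s powr (1 - lam) \<le> (2 * B)\<^sup>2 * 1"
      using s lam by (intro mult_left_mono powr_le1) auto
    finally show "(l / (2*pi)) powr (- lam) * ((LINT t:{a..a+l}|lborel. (cmod (bval f t - arc_avg f a l))\<^sup>2) / (2*pi)) \<le> (2 * B)\<^sup>2"
      by (simp add: s_def)
  qed
qed

text \<open>The junk value of \<^const>\<open>bval\<close> does not scale, so Fatou's theorem is needed even here.\<close>

lemma morrey_cmult:
  assumes f: "f \<in> morrey lam" and c: "c \<noteq> 0"
  shows "(\<lambda>z. c * f z) \<in> morrey lam"
proof -
  let ?h = "\<lambda>z. c * f z"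
  from f obtain M where fH: "f \<in> hardy2" and M: "\<And>a l. (a, l) \<in> arc_params \<Longrightarrow> (l / (2*pi)) powr (- lam) *
          ((LINT t:{a..a+l}|lborel. (cmod (bval f t - arc_avg f a l))\<^sup>2) / (2*pi)) \<le> M"
    unfolding morrey_def by fast
  from fH obtain M1 where fh: "f holomorphic_on ball 0 1" and
    M1: "\<And>r. r \<in> {0..<1} \<Longrightarrow> (LINT t:{0..2*pi}|lborel. (cmod (f (of_real r * cis t)))\<^sup>2) / (2*pi) \<le> M1"
    unfolding hardy2_def by blast
  have hh: "?h holomorphic_on ball 0 1" by (intro holomorphic_intros fh)
  have sc: "(LINT t:A|lborel. (cmod c)\<^sup>2 * u t) = (cmod c)\<^sup>2 * (LINT t:A|lborel. u t)" for A and u :: "real \<Rightarrow> real"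
    by simp
  have hH: "?h \<in> hardy2"
    unfolding hardy2_def
  proof (intro CollectI conjI hh exI[of _ "(cmod c)\<^sup>2 * M1"] ballI)
    fix r :: real assume r: "r \<in> {0..<1}"
    show "(LINT t:{0..2*pi}|lborel. (cmod (c * f (of_real r * cis t)))\<^sup>2) / (2*pi) \<le> (cmod c)\<^sup>2 * M1"
      using mult_left_mono[OF M1[OF r], of "(cmod c)\<^sup>2"] by (simp add: norm_mult power_mult_distrib sc)
  qed
  have [measurable]: "bval f \<in> borel_measurable borel" "bval ?h \<in> borel_measurable borel"
    using bval_measurable[OF fh] bval_measurable[OF hh] by auto
  have ae: "AE t in lborel. bval ?h t = c * bval f t"
    using bval_tendsto_AE[OF fH] by (rule eventually_mono) (auto intro!: bval_eqI tendsto_mult)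
  have avg: "arc_avg ?h a l = c * arc_avg f a l" for a l
  proof -
    have "(LINT t:{a..a+l}|lborel. bval ?h t) = (LINT t:{a..a+l}|lborel. c * bval f t)"
      unfolding set_lebesgue_integral_def
      by (rule integral_cong_AE) (use ae in \<open>auto elim!: eventually_mono\<close>)
    then show ?thesis by (simp add: arc_avg_def)
  qed
  have "(LINT t:{a..a+l}|lborel. (cmod (bval ?h t - arc_avg ?h a l))\<^sup>2) =
     (cmod c)\<^sup>2 * (LINT t:{a..a+l}|lborel. (cmod (bval f t - arc_avg f a l))\<^sup>2)" for a l
  proof -
    have "(LINT t:{a..a+l}|lborel. (cmod (bval ?h t - arc_avg ?h a l))\<^sup>2) =
     (LINT t:{a..a+l}|lborel. (cmod c)\<^sup>2 * (cmod (bval f t - arc_avg f a l))\<^sup>2)"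
      unfolding set_lebesgue_integral_def avg
    proof (rule integral_cong_AE)
      show "AE t in lborel. indicat_real {a..a+l} t *\<^sub>R (cmod (bval ?h t - c * arc_avg f a l))\<^sup>2 =
         indicat_real {a..a+l} t *\<^sub>R ((cmod c)\<^sup>2 * (cmod (bval f t - arc_avg f a l))\<^sup>2)"
        using ae by (rule eventually_mono)
          (simp add: right_diff_distrib[symmetric] norm_mult power_mult_distrib)
    qed measurable
    then show ?thesis by (simp add: sc)
  qed
  note e = this
  show ?thesis
    unfolding morrey_def
  proof (intro CollectI conjI hH exI[of _ "(cmod c)\<^sup>2 * M"] ballI, clarify)
    fix a l assume "(a, l) \<in> arc_params"
    from mult_left_mono[OF M[OF this], of "(cmod c)\<^sup>2"]
    show "(l / (2*pi)) powr (- lam) * ((LINT t:{a..a+l}|lborel. (cmod (bval ?h t - arc_avg ?h a l))\<^sup>2) / (2*pi)) \<le> (cmod c)\<^sup>2 * M"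
      unfolding e by (simp add: mult_ac)
  qed
qed

section \<open>Test functions\<close>

text \<open>The disc is convex, so the integrand has a primitive there, and the integral along the
  segment from 0 is the increment of that primitive.\<close>

lemma Ig_deriv:
  assumes f: "f holomorphic_on ball 0 1" and g: "g holomorphic_on ball 0 1"
  shows "Ig g f holomorphic_on ball 0 1" "\<And>z. z \<in> ball 0 1 \<Longrightarrow> deriv (Ig g f) z = deriv f z * g z" "Ig g f 0 = 0"
proof -
  have h: "(\<lambda>w. deriv f w * g w) holomorphic_on ball 0 1"
    by (intro holomorphic_intros f g) auto
  obtain G where G: "\<And>x. x \<in> ball 0 1 \<Longrightarrow> (G has_field_derivative deriv f x * g x) (at x within ball 0 1)"
    using holomorphic_convex_primitive'[OF convex_ball open_ball h] by blast
  have eq: "Ig g f z = G z - G 0" if z: "z \<in> ball 0 1" for z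
  proof -
    have "((\<lambda>w. deriv f w * g w) has_contour_integral (G (pathfinish (linepath 0 z)) - G (pathstart (linepath 0 z)))) (linepath 0 z)"
    proof (rule contour_integral_primitive[OF G])
      have "closed_segment 0 z \<subseteq> ball 0 1" using z by (intro closed_segment_subset) auto
      then show "path_image (linepath 0 z) \<subseteq> ball 0 1" by simp
    qed auto
    then show ?thesis unfolding Ig_def by (simp add: contour_integral_unique)
  qed
  have d: "(Ig g f has_field_derivative deriv f z * g z) (at z)" if z: "z \<in> ball 0 1" for z
  proof -
    have "(G has_field_derivative deriv f z * g z) (at z)"
      using G[OF z] z by (simp add: at_within_open[OF z open_ball])
    then have "((\<lambda>z. G z - G 0) has_field_derivative deriv f z * g z) (at z)"
      by (auto intro!: derivative_eq_intros)
    then show ?thesis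
      by (rule has_field_derivative_transform_within_open[OF _ open_ball z]) (simp add: eq)
  qed
  then show "Ig g f holomorphic_on ball 0 1"
    unfolding holomorphic_on_open[OF open_ball] by blast
  show "deriv (Ig g f) z = deriv f z * g z" if "z \<in> ball 0 1" for z
    using d[OF that] by (rule DERIV_imp_deriv)
  show "Ig g f 0 = 0" using eq[of 0] by simp
qed

text \<open>A multiple of the Cauchy kernel less its value at 0, so that the norm is the seminorm
  alone. The kernel has squared Hardy norm \<open>1 / (1 - |w|^2)\<close>; the exponent brings the
  total energy to the order \<open>(1 - |w|)^lam\<close>, the scale of a box of size
  \<open>1 - |w|\<close>.\<close>

definition cauchy_fn :: "real \<Rightarrow> complex \<Rightarrow> complex \<Rightarrow> complex" where
  "cauchy_fn lam w z = of_real ((1 - cmod w) powr ((1 + lam) / 2)) * (1 / (1 - cnj w * z) - 1)"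

lemma one_minus_cnj_nonzero: "cmod w < 1 \<Longrightarrow> cmod z \<le> 1 \<Longrightarrow> 1 - cnj w * z \<noteq> 0"
  using cmod_one_minus_ge(1)[of z w] by auto

lemma cauchy_fn_basic:
  assumes w: "cmod w < 1"
  shows "cauchy_fn lam w holomorphic_on ball 0 1" "continuous_on (cball 0 1) (cauchy_fn lam w)" "cauchy_fn lam w 0 = 0"
    "\<And>z. z \<in> ball 0 1 \<Longrightarrow> deriv (cauchy_fn lam w) z = of_real ((1 - cmod w) powr ((1 + lam) / 2)) * cnj w / (1 - cnj w * z)\<^sup>2"
proof -
  show "cauchy_fn lam w holomorphic_on ball 0 1" unfolding cauchy_fn_def
    by (intro holomorphic_intros) (use one_minus_cnj_nonzero[OF w] in auto)
  show "continuous_on (cball 0 1) (cauchy_fn lam w)" unfolding cauchy_fn_def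
    by (intro continuous_intros) (use one_minus_cnj_nonzero[OF w] in auto)
  show "cauchy_fn lam w 0 = 0" by (simp add: cauchy_fn_def)
  fix z :: complex assume z: "z \<in> ball 0 1"
  then have nz: "1 - cnj w * z \<noteq> 0" using one_minus_cnj_nonzero[OF w, of z] by auto
  show "deriv (cauchy_fn lam w) z = of_real ((1 - cmod w) powr ((1 + lam) / 2)) * cnj w / (1 - cnj w * z)\<^sup>2"
    unfolding cauchy_fn_def
    by (rule DERIV_imp_deriv) (use nz in \<open>auto intro!: derivative_eq_intros simp: power2_eq_square\<close>)
qed

text \<open>The box is enlarged to the whole disc, which is efficient for boxes larger than
  \<open>1 - |w|\<close>. The Littlewood-Paley inequality reduces the energy to a geometric series,
  at most \<open>\<delta>^(1+lam) / (1 - |w|^2)\<close>.\<close>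

lemma cauchy_fn_energy_disc:
  assumes w: "cmod w < 1"
  shows "box_energy (cauchy_fn lam w) a l \<le> ennreal ((1 - cmod w) powr lam)"
proof -
  define \<delta> where "\<delta> = 1 - cmod w"
  have \<delta>: "0 < \<delta>" "\<delta> \<le> 1" using w by (auto simp: \<delta>_def)
  define C where "C = \<delta> powr ((1 + lam) / 2)"
  define b where "b n = (if n = 0 then 0 else of_real C * cnj w ^ n)" for n :: nat
  let ?f = "cauchy_fn lam w"
  have b: "is_powser b ?f"
    unfolding is_powser_def
  proof
    fix z :: complex assume z: "z \<in> ball 0 1"
    have "cmod (cnj w * z) < 1 * 1" unfolding norm_mult using w z by (intro mult_strict_mono') auto
    then have "(\<lambda>n. (cnj w * z) ^ n) sums (1 / (1 - cnj w * z))" by (intro geometric_sums) simp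
    moreover have "(\<lambda>n. if n = 0 then 1 else 0) sums (1::complex)" using sums_single[of 0 "\<lambda>_. 1::complex"] by simp
    ultimately have "(\<lambda>n. of_real C * ((cnj w * z) ^ n - (if n = 0 then 1 else 0))) sums ?f z"
      unfolding cauchy_fn_def C_def \<delta>_def by (intro sums_mult sums_diff)
    moreover have "of_real C * ((cnj w * z) ^ n - (if n = 0 then 1 else 0)) = b n * z ^ n" for n
      by (simp add: b_def power_mult_distrib)
    ultimately show "(\<lambda>n. b n * z ^ n) sums ?f z" by simp
  qed
  have bn: "(cmod (b n))\<^sup>2 \<le> C\<^sup>2 * ((cmod w)\<^sup>2) ^ n" for n
    by (simp add: b_def norm_mult norm_power power_mult_distrib power_mult[symmetric] mult.commute)
  have w2: "(cmod w)\<^sup>2 < 1" using w by (simp add: abs_square_less_1)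
  then have gs: "(\<lambda>n. C\<^sup>2 * ((cmod w)\<^sup>2) ^ n) sums (C\<^sup>2 * (1 / (1 - (cmod w)\<^sup>2)))"
    by (intro sums_mult geometric_sums) simp
  have bs: "summable (\<lambda>n. (cmod (b n))\<^sup>2)"
    by (rule summable_comparison_test'[OF sums_summable[OF gs], of 0]) (use bn in auto)
  define Q where "Q = 2 * pi * (\<Sum>n. (cmod (b n))\<^sup>2)"
  have Q0: "0 \<le> Q" unfolding Q_def using suminf_nonneg[OF bs] by simp
  have "(\<Sum>n. (cmod (b n))\<^sup>2) \<le> C\<^sup>2 * (1 / (1 - (cmod w)\<^sup>2))"
    using suminf_le[OF bn bs sums_summable[OF gs]] sums_unique[OF gs] by simp
  also have "\<dots> \<le> C\<^sup>2 * (1 / \<delta>)"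
  proof (intro mult_left_mono divide_left_mono)
    have "(cmod w)\<^sup>2 \<le> cmod w" using w by (simp add: power2_eq_square mult_left_le)
    then show "\<delta> \<le> 1 - (cmod w)\<^sup>2" by (simp add: \<delta>_def)
  qed (use \<delta> w2 in auto)
  also have "C\<^sup>2 = \<delta> powr (1 + lam)" using \<delta> by (simp add: C_def powr_power add_divide_distrib)
  also have "\<delta> powr (1 + lam) * (1 / \<delta>) = \<delta> powr lam" using \<delta> by (simp add: powr_add)
  finally have S: "(\<Sum>n. (cmod (b n))\<^sup>2) \<le> \<delta> powr lam" .
  have hol: "?f holomorphic_on ball 0 1" by (rule cauchy_fn_basic[OF w])
  have LP: "(\<integral>\<^sup>+z\<in>ball 0 1. ennreal ((cmod (deriv ?f z))\<^sup>2 * (1 - (cmod z)\<^sup>2)) \<partial>lborel) \<le> ennreal (Q / 2)"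
    by (rule littlewood_paley[OF hol _ Q0]) (unfold Q_def, rule circle_sq_powser_le[OF b _ _ bs])
  have "box_energy ?f a l \<le> (\<integral>\<^sup>+z. ennreal (1 / pi) * (ennreal ((cmod (deriv ?f z))\<^sup>2 * (1 - (cmod z)\<^sup>2)) * indicator (ball 0 1) z) \<partial>lborel)"
    unfolding box_energy_def
    by (intro nn_integral_mono) (use carleson_box_subset[of a l] in \<open>auto simp: indicator_def ennreal_mult[symmetric] power_le_one ennreal_mult'[symmetric]\<close>)
  also have "\<dots> = ennreal (1 / pi) * (\<integral>\<^sup>+z\<in>ball 0 1. ennreal ((cmod (deriv ?f z))\<^sup>2 * (1 - (cmod z)\<^sup>2)) \<partial>lborel)"
  proof (rule nn_integral_cmult)
    have "continuous_on (ball 0 1) (deriv ?f)"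
      by (intro holomorphic_on_imp_continuous_on holomorphic_deriv hol) auto
    from cmod_sq_indicator_measurable[OF _ this, of "\<lambda>z. 1 - (cmod z)\<^sup>2"]
    show "(\<lambda>z. ennreal ((cmod (deriv ?f z))\<^sup>2 * (1 - (cmod z)\<^sup>2)) * indicator (ball 0 1) z) \<in> borel_measurable lborel" by simp
  qed
  also have "\<dots> \<le> ennreal (1 / pi) * ennreal (Q / 2)" by (intro mult_left_mono LP) auto
  also have "\<dots> = ennreal (\<Sum>n. (cmod (b n))\<^sup>2)"
    using Q0 by (subst ennreal_mult[symmetric]) (auto simp: Q_def)
  also have "\<dots> \<le> ennreal (\<delta> powr lam)" by (rule ennreal_leI[OF S])
  finally show ?thesis by (simp add: \<delta>_def)
qed

text \<open>A box fixes angles only modulo \<open>2*pi\<close>. Within \<open>pi\<close> of the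
  centre of the arc a nonzero multiple is possible only if \<open>l = 2*pi\<close> and
  \<open>t\<close> is an endpoint, which belongs to the arc anyway.\<close>

lemma carleson_box_angle:
  assumes l: "0 < l" "l \<le> 2*pi" and t: "\<bar>t - (a + l/2)\<bar> \<le> pi" and r: "0 < r" and z: "of_real r * cis t \<in> carleson_box a l"
  shows "t \<in> {a..a+l}"
proof -
  obtain t' where t': "t' \<in> {a..a+l}" "of_real r * cis t = of_real (cmod (of_real r * cis t)) * cis t'"
    using carleson_boxD(3)[OF z] by blast
  then have "cis t = cis t'" using r by (simp add: norm_mult)
  then obtain n :: int where n: "t = t' + 2 * pi * n"
    using sin_cos_eq_iff[of t t'] by (auto simp: complex_eq_iff)
  have "a \<le> t'" "t' \<le> a + l" using t'(1) by auto
  then have "\<bar>t' - (a + l/2)\<bar> \<le> l/2" by linarith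
  with t n have "\<bar>2 * pi * real_of_int n\<bar> \<le> pi + l/2" by linarith
  moreover have "pi + l/2 \<le> 2 * pi" using l by simp
  moreover have "\<bar>2 * pi * real_of_int n\<bar> = 2 * pi * \<bar>real_of_int n\<bar>" by (simp add: abs_mult)
  ultimately have "2 * pi * \<bar>real_of_int n\<bar> \<le> 2 * pi * 1" by linarith
  then have "\<bar>real_of_int n\<bar> \<le> 1" by (subst (asm) mult_le_cancel_left_pos) auto
  then consider "n = 0" | "n = 1" | "n = -1" by linarith
  then show ?thesis
  proof cases
    case 1 then show ?thesis using n t' by simp
  next
    case 2 then show ?thesis using n t' t l by (auto simp: abs_le_iff)
  next
    case 3 then show ?thesis using n t' t l by (auto simp: abs_le_iff)
  qed
qed

text \<open>In polar coordinates about the centre of the arc, \<open>r * (1 - r^2)\<close> is at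
  most \<open>2 * s\<close> on a radial interval of length \<open>s\<close>, and the angle ranges
  over \<open>l = 2*pi*s\<close>.\<close>

lemma carleson_box_weight:
  assumes l: "0 < l" "l \<le> 2*pi"
  shows "(\<integral>\<^sup>+z\<in>carleson_box a l. ennreal (1 - (cmod z)\<^sup>2) \<partial>lborel) \<le> ennreal (4 * pi * (l / (2*pi)) ^ 3)"
proof -
  define s where "s = l / (2*pi)"
  have s: "0 < s" "s \<le> 1" using l by (auto simp: s_def)
  define \<theta> where "\<theta> = a + l/2"
  have "(\<integral>\<^sup>+z\<in>carleson_box a l. ennreal (1 - (cmod z)\<^sup>2) \<partial>lborel) =
     (\<integral>\<^sup>+t\<in>{\<theta>-pi..\<theta>-pi+2*pi}. (\<integral>\<^sup>+r\<in>{0<..}. ennreal r * (ennreal (1 - (cmod (of_real r * cis t))\<^sup>2) *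
        indicator (carleson_box a l) (of_real r * cis t)) \<partial>lborel) \<partial>lborel)"
    by (rule nn_integral_polar) measurable
  also have "\<dots> \<le> (\<integral>\<^sup>+t. (\<integral>\<^sup>+r. ennreal (2 * s) * indicator {1-s..1} r \<partial>lborel) * indicator {a..a+l} t \<partial>lborel)"
  proof (intro nn_integral_mono)
    fix t :: real
    show "(\<integral>\<^sup>+r\<in>{0<..}. ennreal r * (ennreal (1 - (cmod (of_real r * cis t))\<^sup>2) *
        indicator (carleson_box a l) (of_real r * cis t)) \<partial>lborel) * indicator {\<theta>-pi..\<theta>-pi+2*pi} t \<le>
      (\<integral>\<^sup>+r. ennreal (2 * s) * indicator {1-s..1} r \<partial>lborel) * indicator {a..a+l} t"
    proof (cases "t \<in> {\<theta>-pi..\<theta>-pi+2*pi}")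
      case True
      have "(\<integral>\<^sup>+r\<in>{0<..}. ennreal r * (ennreal (1 - (cmod (of_real r * cis t))\<^sup>2) *
        indicator (carleson_box a l) (of_real r * cis t)) \<partial>lborel) \<le> (\<integral>\<^sup>+r. (ennreal (2 * s) * indicator {1-s..1} r) * indicator {a..a+l} t \<partial>lborel)"
      proof (intro nn_integral_mono)
        fix r :: real
        show "ennreal r * (ennreal (1 - (cmod (of_real r * cis t))\<^sup>2) * indicator (carleson_box a l) (of_real r * cis t)) * indicator {0<..} r
          \<le> (ennreal (2 * s) * indicator {1-s..1} r) * indicator {a..a+l} t"
        proof (cases "0 < r \<and> of_real r * cis t \<in> carleson_box a l")
          case rz: True
          then have ta: "t \<in> {a..a+l}"
            using True by (intro carleson_box_angle[OF l]) (auto simp: \<theta>_def abs_le_iff)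
          have r: "1 - s \<le> r" "r < 1" using carleson_boxD(1,2)[of "of_real r * cis t" a l] rz by (auto simp: norm_mult s_def)
          have "1 - r\<^sup>2 = (1 - r) * (1 + r)" by (simp add: power2_eq_square algebra_simps)
          also have "\<dots> \<le> s * 2" using r s rz by (intro mult_mono) auto
          finally have "r * (1 - r\<^sup>2) \<le> 1 * (2 * s)" using r rz by (intro mult_mono) (auto simp: power_le_one)
          then have "ennreal (r * (1 - r\<^sup>2)) \<le> ennreal (2 * s)" by (intro ennreal_leI) simp
          then show ?thesis using rz ta r by (simp add: norm_mult ennreal_mult' )
        qed auto
      qed
      also have "\<dots> = (\<integral>\<^sup>+r. ennreal (2 * s) * indicator {1-s..1} r \<partial>lborel) * indicator {a..a+l} t"
        by (rule nn_integral_multc) measurable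
      finally show ?thesis using True by simp
    qed simp
  qed
  also have "\<dots> = ennreal (2 * s) * ennreal s * ennreal l"
    using s l by (simp add: nn_integral_cmult)
  also have "\<dots> = ennreal (4 * pi * s ^ 3)"
    using s l by (simp add: ennreal_mult[symmetric]) (simp add: s_def power3_eq_cube field_simps)
  finally show ?thesis by (simp add: s_def)
qed

text \<open>Meant for boxes smaller than \<open>1 - |w|\<close>: the derivative is estimated by
  \<open>|1 - cnj w z| >= 1 - |w|\<close> alone, and the smallness comes from the weight, whose
  integral is of order \<open>s^3\<close>.\<close>

lemma cauchy_fn_energy_small:
  assumes w: "cmod w < 1" and l: "0 < l" "l \<le> 2*pi"
  shows "box_energy (cauchy_fn lam w) a l \<le> ennreal (4 * (l / (2*pi)) ^ 3 * (1 - cmod w) powr (lam - 3))"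
proof -
  define \<delta> where "\<delta> = 1 - cmod w"
  have \<delta>: "0 < \<delta>" "\<delta> \<le> 1" using w by (auto simp: \<delta>_def)
  let ?K = "\<delta> powr (1 + lam) / \<delta> ^ 4"
  have "box_energy (cauchy_fn lam w) a l \<le> (\<integral>\<^sup>+z. ennreal (?K / pi) * (ennreal (1 - (cmod z)\<^sup>2) * indicator (carleson_box a l) z) \<partial>lborel)"
    unfolding box_energy_def
  proof (intro nn_integral_mono)
    fix z :: complex
    show "ennreal ((cmod (deriv (cauchy_fn lam w) z))\<^sup>2 * (1 - (cmod z)\<^sup>2) / pi) * indicator (carleson_box a l) z
      \<le> ennreal (?K / pi) * (ennreal (1 - (cmod z)\<^sup>2) * indicator (carleson_box a l) z)"
    proof (cases "z \<in> carleson_box a l")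
      case True
      then have z: "z \<in> ball 0 1" using carleson_box_subset by blast
      have ge: "\<delta> \<le> cmod (1 - cnj w * z)" using cmod_one_minus_ge(1)[of z w] z w by (simp add: \<delta>_def)
      have "cmod (deriv (cauchy_fn lam w) z) = \<delta> powr ((1 + lam) / 2) * cmod w / (cmod (1 - cnj w * z))\<^sup>2"
        unfolding cauchy_fn_basic(4)[OF w z] by (simp add: norm_mult norm_divide norm_power \<delta>_def)
      also have "\<dots> \<le> \<delta> powr ((1 + lam) / 2) * 1 / \<delta>\<^sup>2"
        using ge \<delta> w by (intro frac_le mult_left_mono power_mono) auto
      finally have "(cmod (deriv (cauchy_fn lam w) z))\<^sup>2 \<le> (\<delta> powr ((1 + lam) / 2) * 1 / \<delta>\<^sup>2)\<^sup>2"
        by (intro power_mono) auto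
      also have "\<dots> = ?K" using \<delta> by (simp add: power_divide powr_power power_mult[symmetric] add_divide_distrib)
      finally have "(cmod (deriv (cauchy_fn lam w) z))\<^sup>2 * ((1 - (cmod z)\<^sup>2) / pi) \<le> ?K * ((1 - (cmod z)\<^sup>2) / pi)"
        using z by (intro mult_right_mono) (auto simp: power_le_one)
      then have "ennreal ((cmod (deriv (cauchy_fn lam w) z))\<^sup>2 * (1 - (cmod z)\<^sup>2) / pi) \<le> ennreal (?K / pi * (1 - (cmod z)\<^sup>2))"
        by (intro ennreal_leI) simp
      also have "\<dots> = ennreal (?K / pi) * ennreal (1 - (cmod z)\<^sup>2)"
        using \<delta> by (intro ennreal_mult') auto
      finally show ?thesis using True by simp
    qed simp
  qed
  also have "\<dots> = ennreal (?K / pi) * (\<integral>\<^sup>+z\<in>carleson_box a l. ennreal (1 - (cmod z)\<^sup>2) \<partial>lborel)"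
    by (rule nn_integral_cmult) measurable
  also have "\<dots> \<le> ennreal (?K / pi) * ennreal (4 * pi * (l / (2*pi)) ^ 3)"
    by (intro mult_left_mono carleson_box_weight l) auto
  also have "\<dots> = ennreal (?K / pi * (4 * pi * (l / (2*pi)) ^ 3))"
    using \<delta> l by (intro ennreal_mult[symmetric]) auto
  also have "?K / pi * (4 * pi * (l / (2*pi)) ^ 3) = 4 * (l / (2*pi)) ^ 3 * ?K" by simp
  also have "?K = \<delta> powr (lam - 3)"
  proof -
    have "?K = \<delta> powr (1 + lam) / \<delta> powr 4" using \<delta> by simp
    also have "\<dots> = \<delta> powr (1 + lam - 4)" by (rule powr_diff[symmetric])
    finally show ?thesis by simp
  qed
  finally show ?thesis by (simp add: \<delta>_def)
qed

text \<open>If \<open>\<delta> <= s\<close>, the disc estimate gives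
  \<open>(\<delta>/s)^lam = p^2\<close>. Otherwise the small-box estimate gives
  \<open>4 * (s/\<delta>)^(3 - lam)\<close>; as \<open>s < \<delta>\<close> and
  \<open>3 - lam >= lam\<close>, this is at most
  \<open>4 * (s/\<delta>)^lam = (2/p)^2\<close>.\<close>

lemma cauchy_fn_arc_bound:
  assumes lam: "0 < lam" "lam < 1" and w: "cmod w < 1" and l: "0 < l" "l \<le> 2*pi"
    and p: "p = ((1 - cmod w) / (l / (2*pi))) powr (lam/2)"
  shows "arc_bound lam (cauchy_fn lam w) a l (2 * min p (1 / p))"
proof -
  define \<delta> where "\<delta> = 1 - cmod w"
  have \<delta>: "0 < \<delta>" "\<delta> \<le> 1" using w by (auto simp: \<delta>_def)
  define s where "s = l / (2*pi)"
  have s: "0 < s" "s \<le> 1" using l by (auto simp: s_def)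
  have p': "p = (\<delta> / s) powr (lam/2)" by (simp add: p \<delta>_def s_def)
  have p0: "0 < p" using s \<delta> by (simp add: p')
  have p2: "p\<^sup>2 = (\<delta> / s) powr lam" using s \<delta> by (simp add: p' powr_power)
  have b1: "ennreal (s powr (- lam)) * box_energy (cauchy_fn lam w) a l \<le> ennreal (p\<^sup>2)"
  proof -
    have "ennreal (s powr (- lam)) * box_energy (cauchy_fn lam w) a l \<le> ennreal (s powr (- lam)) * ennreal (\<delta> powr lam)"
      using cauchy_fn_energy_disc[OF w, of lam a l] by (intro mult_left_mono) (auto simp: \<delta>_def)
    also have "\<dots> = ennreal (s powr (- lam) * \<delta> powr lam)" by (simp add: ennreal_mult)
    also have "s powr (- lam) * \<delta> powr lam = p\<^sup>2" using s \<delta> by (simp add: p2 powr_divide powr_minus_divide)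
    finally show ?thesis .
  qed
  show ?thesis
  proof (cases "\<delta> \<le> s")
    case True
    then have "p \<le> 1" using s \<delta> lam by (simp add: p' powr_le1)
    then have "1 \<le> 1 / p" using p0 by simp
    then have "p \<le> 1 / p" using \<open>p \<le> 1\<close> by linarith
    then have m: "min p (1 / p) = p" by simp
    have "p\<^sup>2 \<le> (2 * p)\<^sup>2" by (simp add: power_mult_distrib)
    then show ?thesis unfolding arc_bound_def m using b1 by (auto simp: s_def[symmetric] intro: order_trans ennreal_leI)
  next
    case False
    then have ps: "p \<ge> 1" using s \<delta> lam by (simp add: p' ge_one_powr_ge_zero)
    have "1 / p \<le> 1" using ps by simp
    then have "1 / p \<le> p" using ps by linarith
    then have m: "min p (1 / p) = 1 / p" by simp
    have "ennreal (s powr (- lam)) * box_energy (cauchy_fn lam w) a l \<le> ennreal (s powr (- lam)) * ennreal (4 * s ^ 3 * \<delta> powr (lam - 3))"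
      using cauchy_fn_energy_small[OF w l, of lam a] by (intro mult_left_mono) (auto simp: \<delta>_def s_def)
    also have "\<dots> = ennreal (s powr (- lam) * (4 * s ^ 3 * \<delta> powr (lam - 3)))" using s by (simp add: ennreal_mult)
    also have "\<dots> \<le> ennreal ((2 * (1 / p))\<^sup>2)"
    proof (intro ennreal_leI)
      have "s powr (- lam) * (4 * s ^ 3 * \<delta> powr (lam - 3)) = 4 * (s powr (- lam) * s powr 3 * \<delta> powr (- (3 - lam)))"
        using s by simp
      also have "s powr (- lam) * s powr 3 = s powr (3 - lam)" using powr_add[of s "- lam" 3] by (simp only: uminus_add_conv_diff)
      also have "s powr (3 - lam) * \<delta> powr (- (3 - lam)) = (s / \<delta>) powr (3 - lam)"
        using s \<delta> by (simp only: powr_divide powr_minus_divide) simp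
      also have "(s / \<delta>) powr (3 - lam) \<le> (s / \<delta>) powr lam"
        using False s \<delta> lam by (intro powr_mono') auto
      also have "(s / \<delta>) powr lam = 1 / p\<^sup>2" using s \<delta> by (simp add: p2 powr_divide)
      finally show "s powr (- lam) * (4 * s ^ 3 * \<delta> powr (lam - 3)) \<le> (2 * (1 / p))\<^sup>2"
        by (simp add: power_divide power_mult_distrib)
    qed
    finally show ?thesis unfolding arc_bound_def m by (simp add: s_def)
  qed
qed

text \<open>The terms with \<open>p k < 1\<close> and the reciprocals of those with
  \<open>p k >= 1\<close> each form a series dominated by a geometric one whose largest term is at
  most 1. The bound is thus independent of \<open>p 0\<close>, which makes it uniform over
  boxes.\<close>

lemma sum_min_inverse_le:
  fixes p :: "nat \<Rightarrow> real"
  assumes p: "\<And>k. 0 < p k" "\<And>k. p (Suc k) \<le> p k / 2"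
  shows "(\<Sum>k<n. min (p k) (1 / p k)) \<le> 4"
proof -
  \<comment> \<open>The subtracted term makes the induction close, as it absorbs the next
    summand.\<close>
  have dec: "(\<Sum>k<n. p (m + k)) \<le> 2 * p m - 2 * p (m + n)" for m n
  proof (induction n)
    case (Suc n)
    have "p (m + n) \<le> 2 * p (m + n) - 2 * p (m + Suc n)" using p(2)[of "m + n"] by simp
    then show ?case using Suc by simp
  qed simp
  have inc: "(\<Sum>k\<le>n. 1 / p k) \<le> 2 / p n" for n
  proof (induction n)
    case (Suc n)
    have "2 / p n \<le> 1 / p (Suc n)" using p(1)[of n] p(1)[of "Suc n"] p(2)[of n] by (simp add: field_simps)
    then have "(\<Sum>k\<le>n. 1 / p k) + 1 / p (Suc n) \<le> 1 / p (Suc n) + 1 / p (Suc n)" using Suc by linarith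
    also have "\<dots> = 2 / p (Suc n)" by simp
    finally show ?case by simp
  qed (use p(1)[of 0] in \<open>auto intro: divide_right_mono less_imp_le\<close>)
  have mono: "p (k + j) \<le> p k" for k j
  proof (induction j)
    case (Suc j)
    then show ?case using p(2)[of "k + j"] p(1)[of "k + j"] by simp
  qed simp
  define A where "A = {k\<in>{..<n}. 1 \<le> p k}"
  define B where "B = {k\<in>{..<n}. p k < 1}"
  have AB: "{..<n} = A \<union> B" "A \<inter> B = {}" "finite A" "finite B" by (auto simp: A_def B_def)
  have "(\<Sum>k<n. min (p k) (1 / p k)) = (\<Sum>k\<in>A. min (p k) (1 / p k)) + (\<Sum>k\<in>B. min (p k) (1 / p k))"
    unfolding AB(1) by (rule sum.union_disjoint[OF AB(3,4,2)])
  also have "(\<Sum>k\<in>A. min (p k) (1 / p k)) \<le> 2"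
  proof (cases "A = {}")
    case False
    define m where "m = Max A"
    have m: "m \<in> A" "\<And>k. k \<in> A \<Longrightarrow> k \<le> m" using False AB by (auto simp: m_def)
    have "(\<Sum>k\<in>A. min (p k) (1 / p k)) \<le> (\<Sum>k\<in>A. 1 / p k)" by (intro sum_mono) auto
    also have "\<dots> \<le> (\<Sum>k\<le>m. 1 / p k)"
      by (intro sum_mono2) (use m p(1) in \<open>auto simp: less_imp_le\<close>)
    also have "\<dots> \<le> 2 / p m" by (rule inc)
    also have "\<dots> \<le> 2 / 1" using m(1) by (intro divide_left_mono) (auto simp: A_def)
    finally show ?thesis by simp
  qed simp
  also have "(\<Sum>k\<in>B. min (p k) (1 / p k)) \<le> 2"
  proof (cases "B = {}")
    case False
    define m where "m = Min B"
    have m: "m \<in> B" "\<And>k. k \<in> B \<Longrightarrow> m \<le> k" using False AB by (auto simp: m_def)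
    have "(\<Sum>k\<in>B. min (p k) (1 / p k)) \<le> (\<Sum>k\<in>B. p k)" by (intro sum_mono) auto
    also have "\<dots> \<le> (\<Sum>k\<in>(\<lambda>j. m + j) ` {..<n}. p k)"
    proof (rule sum_mono2)
      show "B \<subseteq> (\<lambda>j. m + j) ` {..<n}"
      proof
        fix k assume k: "k \<in> B"
        then have "k = m + (k - m)" "k - m < n" using m(2)[OF k] by (auto simp: B_def)
        then show "k \<in> (\<lambda>j. m + j) ` {..<n}" by blast
      qed
    qed (use p(1) in \<open>auto simp: less_imp_le\<close>)
    also have "\<dots> = (\<Sum>j<n. p (m + j))" by (subst sum.reindex) auto
    also have "\<dots> \<le> 2 * p m - 2 * p (m + n)" by (rule dec)
    also have "\<dots> \<le> 2" using m(1) p(1)[of "m + n"] by (auto simp: B_def)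
    finally show ?thesis .
  qed simp
  finally show ?thesis by simp
qed

lemma arc_bound_sum:
  assumes "finite I" "\<And>k. k \<in> I \<Longrightarrow> f k holomorphic_on ball 0 1" "\<And>k. k \<in> I \<Longrightarrow> arc_bound lam (f k) a l (x k)" "\<And>k. k \<in> I \<Longrightarrow> 0 \<le> x k"
  shows "arc_bound lam (\<lambda>z. \<Sum>k\<in>I. f k z) a l (\<Sum>k\<in>I. x k)"
  using assms
proof (induction I rule: finite_induct)
  case empty
  then show ?case by (simp add: arc_bound_def box_energy_def)
next
  case (insert k I)
  then show ?case by (auto intro!: arc_bound_add holomorphic_on_sum sum_nonneg)
qed

text \<open>Dividing by the size of a box multiplies all the numbers by a common factor, so
  \<open>dec\<close> makes \<open>p\<close> halve for every box at once. The total is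
  \<open>2 * 4 = 8\<close> for every box and every finite \<open>I\<close>, and the value at 0 adds
  nothing.\<close>

lemma cauchy_fn_sum:
  fixes w :: "nat \<Rightarrow> complex"
  assumes lam: "0 < lam" "lam < 1" and w: "\<And>k. cmod (w k) < 1"
    and dec: "\<And>k. (1 - cmod (w (Suc k))) powr (lam/2) \<le> (1 - cmod (w k)) powr (lam/2) / 2" and I: "finite I"
  shows "(\<lambda>z. \<Sum>k\<in>I. cauchy_fn lam (w k) z) \<in> morrey lam"
    "morrey_norm lam (\<lambda>z. \<Sum>k\<in>I. cauchy_fn lam (w k) z) \<le> 8"
proof -
  let ?f = "\<lambda>k. cauchy_fn lam (w k)"
  have hol: "(\<lambda>z. \<Sum>k\<in>I. ?f k z) holomorphic_on ball 0 1"
    by (intro holomorphic_on_sum cauchy_fn_basic w)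
  show "(\<lambda>z. \<Sum>k\<in>I. ?f k z) \<in> morrey lam"
    by (intro continuous_closed_disc_in_morrey lam hol continuous_on_sum cauchy_fn_basic w)
  have "arc_bound lam (\<lambda>z. \<Sum>k\<in>I. ?f k z) a l 8" if "(a, l) \<in> arc_params" for a l
  proof -
    have l: "0 < l" "l \<le> 2*pi" using that by (auto simp: arc_params_def)
    define p where "p k = ((1 - cmod (w k)) / (l / (2*pi))) powr (lam/2)" for k
    have p0: "0 < p k" for k using w[of k] l by (simp add: p_def)
    have pd: "p (Suc k) \<le> p k / 2" for k
    proof -
      have pe: "p k = (1 - cmod (w k)) powr (lam/2) / (l / (2*pi)) powr (lam/2)" for k
        unfolding p_def by (rule powr_divide)
      show ?thesis unfolding pe using divide_right_mono[OF dec[of k], of "(l / (2*pi)) powr (lam/2)"] by simp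
    qed
    have ab: "arc_bound lam (?f k) a l (2 * min (p k) (1 / p k))" for k
      by (rule cauchy_fn_arc_bound[OF lam w l p_def])
    have "arc_bound lam (\<lambda>z. \<Sum>k\<in>I. ?f k z) a l (\<Sum>k\<in>I. 2 * min (p k) (1 / p k))"
      by (intro arc_bound_sum I ab cauchy_fn_basic w) (use p0 in \<open>auto simp: less_imp_le\<close>)
    moreover have "(\<Sum>k\<in>I. 2 * min (p k) (1 / p k)) \<le> 8"
    proof -
      obtain n where n: "I \<subseteq> {..<n}" using finite_nat_bounded[OF I] by blast
      have "(\<Sum>k\<in>I. 2 * min (p k) (1 / p k)) \<le> (\<Sum>k<n. 2 * min (p k) (1 / p k))"
        by (intro sum_mono2) (use n p0 in \<open>auto simp: less_imp_le\<close>)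
      also have "\<dots> = 2 * (\<Sum>k<n. min (p k) (1 / p k))" by (simp add: sum_distrib_left)
      also have "\<dots> \<le> 2 * 4" by (intro mult_left_mono sum_min_inverse_le p0 pd) auto
      finally show ?thesis by simp
    qed
    moreover have "0 \<le> (\<Sum>k\<in>I. 2 * min (p k) (1 / p k))" using p0 by (intro sum_nonneg) (auto simp: less_imp_le)
    ultimately show ?thesis using arc_bound_mono by blast
  qed
  then have "box_bound lam (\<lambda>z. \<Sum>k\<in>I. ?f k z) 8" using hol by (auto simp: box_bound_def)
  from morrey_norm_le[OF this] show "morrey_norm lam (\<lambda>z. \<Sum>k\<in>I. ?f k z) \<le> 8"
    using cauchy_fn_basic(3)[OF w] by simp
qed

section \<open>Lower bound and compact operators\<close>

text \<open>On each circle only the term of index 0 in Parseval's identity is kept, and the result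
  is integrated against \<open>r\<close>.\<close>

lemma submean_unit_disc:
  assumes v: "v holomorphic_on ball 0 1"
  shows "ennreal (pi * (cmod (v 0))\<^sup>2) \<le> (\<integral>\<^sup>+z\<in>ball 0 1. ennreal ((cmod (v z))\<^sup>2) \<partial>lborel)"
proof -
  obtain a where a: "is_powser a v" using holomorphic_is_powser[OF v] .
  have "(\<lambda>n. a n * 0 ^ n) sums v 0" using a unfolding is_powser_def by (rule bspec) simp
  moreover have "(\<lambda>n. a n * 0 ^ n) sums a 0" by (rule powser_sums_zero)
  ultimately have a0: "v 0 = a 0" by (rule sums_unique2)
  have cs: "ennreal (2 * pi * (cmod (v 0))\<^sup>2) \<le> circle_sq v r" if "0 \<le> r" "r < 1" for r
  proof -
    have "(\<Sum>n\<in>{0}. ennreal (2 * pi * (cmod (a n))\<^sup>2 * r ^ (2*n))) \<le> circle_sq v r"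
      unfolding circle_sq_powser[OF a that] by (rule sum_le_suminf) auto
    then show ?thesis by (simp add: a0)
  qed
  let ?c = "2 * pi * (cmod (v 0))\<^sup>2"
  have "ennreal (pi * (cmod (v 0))\<^sup>2) = ennreal (?c * (1\<^sup>2 / 2) - ?c * (0\<^sup>2 / 2))" by simp
  also have "\<dots> = (\<integral>\<^sup>+r. ennreal (?c * r) * indicator {0..1} r \<partial>lborel)"
    by (rule nn_integral_FTC_Icc[symmetric, where F = "\<lambda>r. ?c * (r\<^sup>2 / 2)"]) (auto intro!: derivative_eq_intros)
  also have "\<dots> = (\<integral>\<^sup>+r\<in>{0<..<1}. ennreal (r * 1) * ennreal ?c \<partial>lborel)"
    by (rule nn_integral_cong_AE)
       (use AE_lborel_neq[of 0] AE_lborel_neq[of 1] in \<open>eventually_elim, auto simp: indicator_def ennreal_mult[symmetric] mult_ac\<close>)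
  also have "\<dots> \<le> (\<integral>\<^sup>+r\<in>{0<..<1}. ennreal (r * 1) * circle_sq v r \<partial>lborel)"
    by (intro nn_integral_mono) (auto simp: indicator_def intro!: mult_left_mono cs)
  also have "\<dots> = (\<integral>\<^sup>+z\<in>ball 0 1. ennreal ((cmod (v z))\<^sup>2 * 1) \<partial>lborel)"
    by (rule nn_integral_disc_circles[symmetric]) (auto intro: holomorphic_on_imp_continuous_on v)
  finally show ?thesis by simp
qed

lemma submean_disc:
  assumes u: "u holomorphic_on ball 0 1" and \<rho>: "0 < \<rho>" and sub: "ball w \<rho> \<subseteq> ball 0 1"
  shows "ennreal (pi * \<rho>\<^sup>2 * (cmod (u w))\<^sup>2) \<le> (\<integral>\<^sup>+z\<in>ball w \<rho>. ennreal ((cmod (u z))\<^sup>2) \<partial>lborel)"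
proof -
  define v where "v \<zeta> = u (w + of_real \<rho> * \<zeta>)" for \<zeta>
  have mem: "w + of_real \<rho> * \<zeta> \<in> ball w \<rho> \<longleftrightarrow> \<zeta> \<in> ball 0 1" for \<zeta>
    using \<rho> by (simp add: dist_norm norm_mult)
  have "(u \<circ> (\<lambda>\<zeta>. w + of_real \<rho> * \<zeta>)) holomorphic_on ball 0 1"
    by (rule holomorphic_on_compose_gen[OF _ u]) (use mem sub in \<open>auto intro!: holomorphic_intros\<close>)
  then have vh: "v holomorphic_on ball 0 1" by (simp add: v_def[abs_def] o_def)
  have "continuous_on (ball w \<rho>) u"
    using holomorphic_on_imp_continuous_on[OF u] sub by (rule continuous_on_subset)
  from cmod_sq_indicator_measurable[OF _ this, of "\<lambda>_. 1"]
  have m: "(\<lambda>z. ennreal ((cmod (u z))\<^sup>2) * indicator (ball w \<rho>) z) \<in> borel_measurable borel" by simp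
  have "ennreal (pi * \<rho>\<^sup>2 * (cmod (u w))\<^sup>2) = ennreal (\<rho>\<^sup>2) * ennreal (pi * (cmod (v 0))\<^sup>2)"
    by (simp add: v_def ennreal_mult[symmetric] mult_ac)
  also have "\<dots> \<le> ennreal (\<rho>\<^sup>2) * (\<integral>\<^sup>+z\<in>ball 0 1. ennreal ((cmod (v z))\<^sup>2) \<partial>lborel)"
    by (intro mult_left_mono submean_unit_disc vh) auto
  also have "\<dots> = ennreal (\<rho>\<^sup>2) * (\<integral>\<^sup>+\<zeta>. ennreal ((cmod (u (w + \<rho> *\<^sub>R \<zeta>)))\<^sup>2) * indicator (ball w \<rho>) (w + \<rho> *\<^sub>R \<zeta>) \<partial>lborel)"
    using mem by (simp add: v_def scaleR_conv_of_real indicator_def)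
  also have "\<dots> = (\<integral>\<^sup>+z. ennreal ((cmod (u z))\<^sup>2) * indicator (ball w \<rho>) z \<partial>lborel)"
    using \<rho> m by (subst (2) lborel_affine[of \<rho> w])
      (simp_all add: nn_integral_density nn_integral_distr nn_integral_cmult DIM_complex)
  finally show ?thesis .
qed

text \<open>With \<open>z = w * (1 + \<zeta>)\<close> and \<open>|\<zeta>| < \<delta>\<close>, the
  angle between \<open>z\<close> and \<open>w\<close> is the imaginary part of
  \<open>Ln (1 + \<zeta>)\<close>, at most \<open>2 * \<delta>\<close> in modulus. The box has size
  \<open>2 * \<delta>\<close> and half-angle \<open>2*pi*\<delta>\<close>, which leaves
  room.\<close>

lemma ball_subset_carleson_box:
  assumes w: "w = of_real (1 - \<delta>) * cis \<theta>" and \<delta>: "0 < \<delta>" "\<delta> \<le> 1/8"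
  shows "ball w (\<delta>/2) \<subseteq> carleson_box (\<theta> - 2 * pi * \<delta>) (4 * pi * \<delta>)"
proof
  fix z assume "z \<in> ball w (\<delta>/2)"
  then have d: "cmod (z - w) < \<delta>/2" by (simp add: dist_norm norm_minus_commute)
  have cw: "cmod w = 1 - \<delta>" using \<delta> by (simp add: w norm_mult del: of_real_diff)
  have w0: "w \<noteq> 0" using cw \<delta> by auto
  have lo: "1 - 2 * \<delta> \<le> cmod z" using d cw norm_triangle_ineq2[of w "w - z"] \<delta> by (simp add: norm_minus_commute)
  have hi: "cmod z < 1" using d cw norm_triangle_ineq[of w "z - w"] \<delta> by simp
  define \<zeta> where "\<zeta> = (z - w) / w"
  have "cmod \<zeta> < (\<delta>/2) / (1/2)"
    unfolding \<zeta>_def norm_divide using d cw \<delta> by (intro frac_less) auto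
  then have \<zeta>: "cmod \<zeta> < \<delta>" by simp
  have zw: "z = w * (1 + \<zeta>)" using w0 by (simp add: \<zeta>_def field_simps)
  have z0: "z \<noteq> 0" using lo \<delta> by auto
  then have u0: "1 + \<zeta> \<noteq> 0" using zw by auto
  define t where "t = \<theta> + Im (Ln (1 + \<zeta>))"
  have "\<bar>Im (Ln (1 + \<zeta>))\<bar> \<le> cmod (Ln (1 + \<zeta>))" by (rule abs_Im_le_cmod)
  also have "\<dots> \<le> 2 * cmod \<zeta>" using \<zeta> \<delta> by (intro norm_Ln_le) auto
  also have "\<dots> \<le> 2 * \<delta>" using \<zeta> by simp
  also have "\<dots> \<le> 2 * pi * \<delta>" using \<delta> pi_gt3 by simp
  finally have t: "t \<in> {\<theta> - 2 * pi * \<delta>..\<theta> - 2 * pi * \<delta> + 4 * pi * \<delta>}" by (simp add: t_def abs_le_iff)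
  have "1 + \<zeta> = exp (Ln (1 + \<zeta>))" using u0 by simp
  also have "\<dots> = of_real (exp (Re (Ln (1 + \<zeta>)))) * cis (Im (Ln (1 + \<zeta>)))" by (rule exp_eq_polar)
  finally have "z = of_real ((1 - \<delta>) * exp (Re (Ln (1 + \<zeta>)))) * (cis \<theta> * cis (Im (Ln (1 + \<zeta>))))"
    by (subst zw, subst w) simp
  then have zc: "z = of_real ((1 - \<delta>) * exp (Re (Ln (1 + \<zeta>)))) * cis t" by (simp add: t_def cis_mult)
  define R where "R = (1 - \<delta>) * exp (Re (Ln (1 + \<zeta>)))"
  have R: "0 < R" "z = of_real R * cis t" using \<delta> zc by (auto simp: R_def)
  then have "z / of_real (cmod z) = cis t" by (simp add: norm_mult)
  then show "z \<in> carleson_box (\<theta> - 2 * pi * \<delta>) (4 * pi * \<delta>)"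
    using lo hi t by (auto simp: carleson_box_def)
qed

text \<open>On the ball of radius \<open>\<delta>/2\<close> about \<open>w\<close> the weight is at
  least \<open>\<delta>/2\<close>, so the submean property gives the energy
  \<open>\<delta>^3/8 * |h' w|^2\<close>. The squared derivative of the test function at
  \<open>w\<close> is at least \<open>\<delta>^lam / (64 * \<delta>^3)\<close>. The box has size
  \<open>2 * \<delta>\<close>, so normalising leaves \<open>|g w|^2 * 2^(-lam) / 512\<close>, at
  least \<open>(|g w| / 32)^2\<close>.\<close>

lemma test_function_lower_bound:
  assumes lam: "0 < lam" "lam < 1" and g: "g holomorphic_on ball 0 1" and w: "cmod w < 1" "7/8 \<le> cmod w"
    and h: "box_bound lam h x" "\<And>z. z \<in> ball 0 1 \<Longrightarrow> deriv h z = deriv (cauchy_fn lam w) z * g z"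
  shows "cmod (g w) \<le> 32 * x"
proof -
  define \<delta> where "\<delta> = 1 - cmod w"
  have \<delta>: "0 < \<delta>" "\<delta> \<le> 1/8" using w by (auto simp: \<delta>_def)
  define \<theta> where "\<theta> = Arg w"
  have w0: "w \<noteq> 0" using w by auto
  have we: "w = of_real (1 - \<delta>) * cis \<theta>"
    unfolding \<theta>_def \<delta>_def using w0 by (simp add: cis_Arg sgn_eq)
  define a l where "a = \<theta> - 2 * pi * \<delta>" and "l = 4 * pi * \<delta>"
  have l: "0 < l" "l \<le> 2 * pi" "l / (2*pi) = 2 * \<delta>" using \<delta> by (auto simp: l_def)
  have al: "(a, l) \<in> arc_params" using l by (simp add: arc_params_def)
  have sub: "ball w (\<delta>/2) \<subseteq> carleson_box a l"
    unfolding a_def l_def by (rule ball_subset_carleson_box[OF we \<delta>])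
  have x0: "0 \<le> x" and hh: "h holomorphic_on ball 0 1" using h(1) by (auto simp: box_bound_def)
  have hdh: "deriv h holomorphic_on ball 0 1" by (intro holomorphic_deriv hh) auto
  have wb: "w \<in> ball 0 1" using w by simp
  have "ennreal (\<delta> / (2 * pi)) * ennreal (pi * (\<delta>/2)\<^sup>2 * (cmod (deriv h w))\<^sup>2) \<le>
     ennreal (\<delta> / (2 * pi)) * (\<integral>\<^sup>+z\<in>ball w (\<delta>/2). ennreal ((cmod (deriv h z))\<^sup>2) \<partial>lborel)"
    using \<delta> sub carleson_box_subset[of a l] by (intro mult_left_mono submean_disc hdh) auto
  also have "\<dots> = (\<integral>\<^sup>+z. ennreal (\<delta> / (2 * pi)) * (ennreal ((cmod (deriv h z))\<^sup>2) * indicator (ball w (\<delta>/2)) z) \<partial>lborel)"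
  proof (rule nn_integral_cmult[symmetric])
    have "continuous_on (ball w (\<delta>/2)) (deriv h)"
      using holomorphic_on_imp_continuous_on[OF hdh] by (rule continuous_on_subset) (use sub carleson_box_subset[of a l] in blast)
    from cmod_sq_indicator_measurable[OF _ this, of "\<lambda>_. 1"]
    show "(\<lambda>z. ennreal ((cmod (deriv h z))\<^sup>2) * indicator (ball w (\<delta>/2)) z) \<in> borel_measurable lborel" by simp
  qed
  also have "\<dots> \<le> box_energy h a l"
    unfolding box_energy_def
  proof (intro nn_integral_mono)
    fix z :: complex
    show "ennreal (\<delta> / (2 * pi)) * (ennreal ((cmod (deriv h z))\<^sup>2) * indicator (ball w (\<delta>/2)) z) \<le>
      ennreal ((cmod (deriv h z))\<^sup>2 * (1 - (cmod z)\<^sup>2) / pi) * indicator (carleson_box a l) z"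
    proof (cases "z \<in> ball w (\<delta>/2)")
      case True
      then have zb: "z \<in> carleson_box a l" using sub by blast
      have "cmod (z - w) < \<delta>/2" using True by (simp add: dist_norm norm_minus_commute)
      then have z1: "cmod z \<le> 1 - \<delta>/2"
      proof -
        have "cmod z \<le> cmod w + cmod (z - w)" using norm_triangle_ineq[of w "z - w"] by simp
        moreover have "cmod w = 1 - \<delta>" by (simp add: \<delta>_def)
        ultimately show ?thesis using \<open>cmod (z - w) < \<delta>/2\<close> by linarith
      qed
      have "(cmod z)\<^sup>2 \<le> cmod z * 1" unfolding power2_eq_square using z1 \<delta> by (intro mult_left_mono) auto
      then have "\<delta> / 2 \<le> 1 - (cmod z)\<^sup>2" using z1 by simp
      then have "(cmod (deriv h z))\<^sup>2 * (\<delta> / 2) / pi \<le> (cmod (deriv h z))\<^sup>2 * (1 - (cmod z)\<^sup>2) / pi"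
        by (intro divide_right_mono mult_left_mono) auto
      then have "ennreal (\<delta> / (2 * pi) * (cmod (deriv h z))\<^sup>2) \<le> ennreal ((cmod (deriv h z))\<^sup>2 * (1 - (cmod z)\<^sup>2) / pi)"
        by (intro ennreal_leI) (simp add: mult_ac)
      then show ?thesis using zb True \<delta> by (simp add: ennreal_mult[symmetric])
    qed simp
  qed
  finally have E: "ennreal (\<delta> / (2 * pi)) * ennreal (pi * (\<delta>/2)\<^sup>2 * (cmod (deriv h w))\<^sup>2) \<le> box_energy h a l" .
  have e1: "ennreal (\<delta> / (2 * pi)) * ennreal (pi * (\<delta>/2)\<^sup>2 * (cmod (deriv h w))\<^sup>2) = ennreal (\<delta> ^ 3 / 8 * (cmod (deriv h w))\<^sup>2)"
    using \<delta> by (subst ennreal_mult[symmetric]) (auto simp: power2_eq_square power3_eq_cube field_simps)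
  have "ennreal ((2 * \<delta>) powr (- lam) * (\<delta> ^ 3 / 8 * (cmod (deriv h w))\<^sup>2)) \<le> ennreal ((2 * \<delta>) powr (- lam)) * box_energy h a l"
    using E \<delta> unfolding e1 by (subst ennreal_mult) (auto intro!: mult_left_mono)
  also have "\<dots> \<le> ennreal (x\<^sup>2)" using h(1) al l(3) by (auto simp: box_bound_def arc_bound_def)
  finally have main: "(2 * \<delta>) powr (- lam) * (\<delta> ^ 3 / 8 * (cmod (deriv h w))\<^sup>2) \<le> x\<^sup>2"
    by (subst (asm) ennreal_le_iff) auto
  have "\<delta> powr ((1 + lam) / 2) / (8 * \<delta>\<^sup>2) \<le> cmod (deriv (cauchy_fn lam w) w)"
  proof -
    have "1 - cnj w * w = of_real (1 - (cmod w)\<^sup>2)" using complex_norm_square[of w] by (simp add: mult.commute)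
    moreover have w2: "1 - (cmod w)\<^sup>2 = \<delta> * (1 + cmod w)" by (simp add: \<delta>_def power2_eq_square algebra_simps)
    ultimately have n: "cmod (1 - cnj w * w) = \<delta> * (1 + cmod w)" using \<delta> by (simp only: norm_of_real w2) (simp add: abs_mult)
    \<comment> \<open>The factor \<open>1/2\<close> stands for \<open>|w|\<close> in the numerator
      and the 2 for \<open>1 + |w|\<close> in the denominator.\<close>
    have "\<delta> powr ((1 + lam) / 2) / (8 * \<delta>\<^sup>2) = \<delta> powr ((1 + lam) / 2) * (1/2) / (\<delta> * 2)\<^sup>2"
      by (simp add: power_mult_distrib)
    also have "\<dots> \<le> \<delta> powr ((1 + lam) / 2) * cmod w / (\<delta> * (1 + cmod w))\<^sup>2"
      using \<delta> w by (intro frac_le mult_left_mono power_mono) auto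
    also have "\<dots> = cmod (deriv (cauchy_fn lam w) w)"
      unfolding cauchy_fn_basic(4)[OF w(1) wb] by (simp add: norm_mult norm_divide norm_power n \<delta>_def[symmetric])
    finally show ?thesis .
  qed
  then have "(\<delta> powr ((1 + lam) / 2) / (8 * \<delta>\<^sup>2))\<^sup>2 \<le> (cmod (deriv (cauchy_fn lam w) w))\<^sup>2"
    by (intro power_mono) auto
  also have "(\<delta> powr ((1 + lam) / 2) / (8 * \<delta>\<^sup>2))\<^sup>2 = \<delta> powr (1 + lam) / (64 * \<delta> ^ 4)"
    using \<delta> by (simp add: power_divide power_mult_distrib powr_power power_mult[symmetric] add_divide_distrib)
  also have "\<dots> = \<delta> powr lam / (64 * \<delta> ^ 3)"
    using \<delta> by (simp add: powr_add field_simps power_numeral_reduce)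
  finally have D: "\<delta> powr lam / (64 * \<delta> ^ 3) \<le> (cmod (deriv (cauchy_fn lam w) w))\<^sup>2" .
  have "(1/2) powr lam * (\<delta> powr (- lam) * (\<delta> ^ 3 / 8 * (\<delta> powr lam / (64 * \<delta> ^ 3) * (cmod (g w))\<^sup>2))) \<le>
     (1/2) powr lam * (\<delta> powr (- lam) * (\<delta> ^ 3 / 8 * ((cmod (deriv (cauchy_fn lam w) w))\<^sup>2 * (cmod (g w))\<^sup>2)))"
    using \<delta> by (intro mult_left_mono mult_right_mono D) auto
  also have "(1/2) powr lam * (\<delta> powr (- lam) * (\<delta> ^ 3 / 8 * ((cmod (deriv (cauchy_fn lam w) w))\<^sup>2 * (cmod (g w))\<^sup>2))) =
     (2 * \<delta>) powr (- lam) * (\<delta> ^ 3 / 8 * (cmod (deriv h w))\<^sup>2)"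
    using \<delta> by (simp add: h(2)[OF wb] norm_mult power_mult_distrib powr_mult powr_minus_divide powr_divide)
  also have "\<dots> \<le> x\<^sup>2" by (rule main)
  also have "(1/2) powr lam * (\<delta> powr (- lam) * (\<delta> ^ 3 / 8 * (\<delta> powr lam / (64 * \<delta> ^ 3) * (cmod (g w))\<^sup>2))) =
     (1/2) powr lam * ((\<delta> powr (- lam) * \<delta> powr lam) * (cmod (g w))\<^sup>2 / 512)"
    using \<delta> by simp
  also have "\<delta> powr (- lam) * \<delta> powr lam = 1" using \<delta> by (simp add: powr_add[symmetric])
  finally have "(1/2) powr lam * (1 * (cmod (g w))\<^sup>2 / 512) \<le> x\<^sup>2" .
  moreover have "(1/2) powr 1 \<le> (1/2::real) powr lam" using lam by (intro powr_mono') auto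
  then have "1/2 * (1 * (cmod (g w))\<^sup>2 / 512) \<le> (1/2) powr lam * (1 * (cmod (g w))\<^sup>2 / 512)"
    by (intro mult_right_mono) auto
  ultimately have "(cmod (g w))\<^sup>2 \<le> (32 * x)\<^sup>2" by (simp add: power_mult_distrib)
  then show ?thesis by (rule power2_le_imp_le) (use x0 in simp)
qed

text \<open>Allows the distance to the boundary to be prescribed: lacunary radii can be used without
  losing the size of \<open>g\<close> at a given point.\<close>

lemma maximum_modulus_circle:
  assumes g: "g holomorphic_on ball 0 1" and z: "z0 \<in> ball 0 1" and r: "cmod z0 \<le> r" "r < 1" "0 < r"
  shows "\<exists>w. cmod w = r \<and> cmod (g z0) \<le> cmod (g w)"
proof -
  have cs: "cball 0 r \<subseteq> ball (0::complex) 1" using r by auto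
  have cg: "continuous_on (cball 0 r) g"
    using holomorphic_on_imp_continuous_on[OF g] cs by (rule continuous_on_subset)
  have "\<exists>w\<in>sphere 0 r. \<forall>y\<in>sphere 0 r. cmod (g y) \<le> cmod (g w)"
    by (rule continuous_attains_sup) (use r in \<open>auto intro!: continuous_intros continuous_on_subset[OF cg]\<close>)
  then obtain w where w: "w \<in> sphere 0 r" "\<And>y. y \<in> sphere 0 r \<Longrightarrow> cmod (g y) \<le> cmod (g w)" by blast
  have "cmod (g z0) \<le> cmod (g w)"
  proof (rule maximum_modulus_frontier[of g "cball 0 r"])
    show "g holomorphic_on interior (cball 0 r)"
      using g by (rule holomorphic_on_subset) (use cs in auto)
  qed (use w cg r in auto)
  then show ?thesis using w(1) by auto
qed

section \<open>Compact operators and the essential norm\<close>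

lemma compact_op_subseq:
  assumes K: "compact_op_on lam K" and s: "\<And>n. s n \<in> morrey lam" "\<And>n. morrey_norm lam (s n) \<le> B"
  shows "\<exists>r h. strict_mono (r :: nat \<Rightarrow> nat) \<and> h \<in> morrey lam \<and> (\<lambda>k. morrey_norm lam (\<lambda>z. K (s (r k)) z - h z)) \<longlonglongrightarrow> 0"
  using K[unfolded compact_op_on_def, THEN conjunct2, THEN conjunct2, THEN spec, of s] s by blast

text \<open>\<open>compact_op_on\<close> speaks of linearity and subsequences, so boundedness has to
  be derived: otherwise some \<open>s n\<close> in the unit ball have images of norm at least
  \<open>n\<close>, and no subsequence of the images converges. The bound later shows that the set
  defining the operator norm of a difference is nonempty.\<close>

lemma compact_op_bounded:
  assumes lam: "0 < lam" "lam < 1" and K: "compact_op_on lam K"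
  shows "\<exists>C\<ge>0. \<forall>f\<in>morrey lam. morrey_norm lam (K f) \<le> C * morrey_norm lam f"
proof (rule ccontr)
  let ?N = "morrey_norm lam"
  assume neg: "\<not> ?thesis"
  note bf = morrey_box_finite[OF lam]
  have Km: "\<And>f. f \<in> morrey lam \<Longrightarrow> K f \<in> morrey lam"
    and Kc: "\<And>f c. f \<in> morrey lam \<Longrightarrow> K (\<lambda>z. c * f z) = (\<lambda>z. c * K f z)"
    using K unfolding compact_op_on_def by blast+
  have "\<exists>f\<in>morrey lam. ?N f \<le> 1 \<and> real n \<le> ?N (K f)" for n :: nat
  proof -
    from neg obtain f where f: "f \<in> morrey lam" "\<not> ?N (K f) \<le> real n * ?N f"
      by (metis of_nat_0_le_iff)
    have N: "0 \<le> ?N f" "0 \<le> ?N (K f)" by (rule morrey_norm_nonneg)+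
    then have pos: "0 < ?N (K f)" using f(2) by (smt (verit) mult_nonneg_nonneg of_nat_0_le_iff)
    have sc: "\<exists>f\<in>morrey lam. ?N f \<le> 1 \<and> real n \<le> ?N (K f)"
      if c: "0 < c" "c * ?N f \<le> 1" "real n \<le> c * ?N (K f)" for c :: real
    proof (intro bexI conjI)
      show "(\<lambda>z. of_real c * f z) \<in> morrey lam" using morrey_cmult[OF f(1)] c(1) by simp
      show "?N (\<lambda>z. of_real c * f z) \<le> 1"
        using morrey_norm_cmult[OF bf[OF f(1)], of "of_real c"] c by simp
      have "?N (\<lambda>z. of_real (1/c) * (of_real c * K f z)) \<le> cmod (of_real (1/c)) * ?N (\<lambda>z. of_real c * K f z)"
        by (rule morrey_norm_cmult[OF box_finite_cmult[OF bf[OF Km[OF f(1)]]]])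
      then have "c * ?N (K f) \<le> ?N (\<lambda>z. of_real c * K f z)" using c(1) by (simp add: norm_divide field_simps)
      then show "real n \<le> ?N (K (\<lambda>z. of_real c * f z))" using c(3) by (simp add: Kc[OF f(1)])
    qed
    show ?thesis
    proof (cases "?N f = 0")
      \<comment> \<open>Elements are functions on the whole plane, so norm 0 does not make
        \<open>f\<close> the zero function. Every multiple of \<open>f\<close> still has norm 0
        while \<open>K f\<close> has positive norm, so the factor can be as large as
        desired.\<close>
      case True
      then show ?thesis using pos by (intro sc[of "(real n + 1) / ?N (K f)"]) auto
    next
      case False
      then have "0 < ?N f" using N by simp
      then show ?thesis using f(2) by (intro sc[of "1 / ?N f"]) (auto simp: field_simps)
    qed
  qed
  then obtain s where s: "\<And>n. s n \<in> morrey lam" "\<And>n. ?N (s n) \<le> 1" "\<And>n. real n \<le> ?N (K (s n))" by metis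
  from compact_op_subseq[OF K, of s 1, OF s(1,2)]
  obtain r h where r: "strict_mono r" and h: "h \<in> morrey lam" and lim: "(\<lambda>k. ?N (\<lambda>z. K (s (r k)) z - h z)) \<longlonglongrightarrow> 0"
    by (elim exE conjE)
  obtain k0 where k0: "\<And>k. k \<ge> k0 \<Longrightarrow> ?N (\<lambda>z. K (s (r k)) z - h z) < 1"
    using order_tendstoD(2)[OF lim, of 1] by (auto simp: eventually_sequentially)
  obtain k1 :: nat where k1: "1 + ?N h < real k1" using reals_Archimedean2 by blast
  define k where "k = max k0 k1"
  have "real k \<le> real (r k)" using seq_suble[OF r] by simp
  also have "\<dots> \<le> ?N (K (s (r k)))" by (rule s(3))
  also have "\<dots> \<le> ?N (\<lambda>z. K (s (r k)) z - h z) + ?N h"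
    by (rule morrey_norm_le_diff[OF bf[OF Km[OF s(1)]] bf[OF h]])
  also have "\<dots> < 1 + ?N h" using k0[of k] by (simp add: k_def)
  finally show False using k1 by (simp add: k_def)
qed

text \<open>Averaging \<open>n\<close> terms of the convergent subsequence gives norm at most
  \<open>C * B / n + e / 2\<close> for the limit \<open>h\<close>, for every \<open>e > 0\<close>.
  The vanishing norm of \<open>h\<close>, rather than of \<open>h\<close> as a function, is what is
  shown and what the conclusion uses.\<close>

lemma compact_op_null_sequence:
  assumes lam: "0 < lam" "lam < 1" and K: "compact_op_on lam K"
    and f: "\<And>I. finite I \<Longrightarrow> (\<lambda>z. \<Sum>k\<in>I. f k z) \<in> morrey lam" "\<And>I. finite I \<Longrightarrow> morrey_norm lam (\<lambda>z. \<Sum>k\<in>I. f k z) \<le> B"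
  obtains r :: "nat \<Rightarrow> nat" where "strict_mono r" "(\<lambda>k. morrey_norm lam (K (f (r k)))) \<longlonglongrightarrow> 0"
proof -
  let ?N = "morrey_norm lam"
  note bf = morrey_box_finite[OF lam]
  have Km: "\<And>f. f \<in> morrey lam \<Longrightarrow> K f \<in> morrey lam"
    and Ka: "\<And>f h. f \<in> morrey lam \<Longrightarrow> h \<in> morrey lam \<Longrightarrow> K (\<lambda>z. f z + h z) = (\<lambda>z. K f z + K h z)"
    using K unfolding compact_op_on_def by blast+
  obtain C where C: "0 \<le> C" "\<And>f. f \<in> morrey lam \<Longrightarrow> ?N (K f) \<le> C * ?N f"
    using compact_op_bounded[OF lam K] by blast
  have fm: "f k \<in> morrey lam" "?N (f k) \<le> B" for k using f[of "{k}"] by auto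
  from compact_op_subseq[OF K, of f B, OF fm]
  obtain r h where r: "strict_mono r" and h: "h \<in> morrey lam" and lim: "(\<lambda>k. ?N (\<lambda>z. K (f (r k)) z - h z)) \<longlonglongrightarrow> 0"
    by (elim exE conjE)
  have Ksum: "K (\<lambda>z. \<Sum>k\<in>I. f k z) = (\<lambda>z. \<Sum>k\<in>I. K (f k) z)" if "finite I" "I \<noteq> {}" for I
    using that
  proof (induction I rule: finite_ne_induct)
    case (insert k I)
    then show ?case using Ka[OF fm(1)[of k] f(1)[OF insert(1)]] by simp
  qed simp
  have B: "0 \<le> B" using fm(2)[of 0] morrey_norm_nonneg order_trans by blast
  have "?N h \<le> e" if e: "0 < e" for e
  proof -
    obtain k0 where k0: "\<And>k. k \<ge> k0 \<Longrightarrow> ?N (\<lambda>z. K (f (r k)) z - h z) < e / 2"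
      using order_tendstoD(2)[OF lim, of "e/2"] e by (auto simp: eventually_sequentially)
    \<comment> \<open>The number of averaged terms makes \<open>C * B / n\<close> at most
      \<open>e / 2\<close>; the window starts at \<open>k0\<close>, where each image is already
      within \<open>e / 2\<close> of \<open>h\<close>.\<close>
    obtain n :: nat where n: "2 * C * B / e < real n" using reals_Archimedean2 by blast
    then have n0: "0 < real n" using C B e by (smt (verit) divide_nonneg_pos mult_nonneg_nonneg)
    define J where "J = {k0..<k0 + n}"
    have J: "finite J" "card J = n" "J \<noteq> {}" using n0 by (auto simp: J_def)
    have inj: "inj_on r J" by (rule strict_mono_imp_inj_on[OF r])
    let ?A = "\<lambda>z. \<Sum>k\<in>J. K (f (r k)) z" and ?D = "\<lambda>z. \<Sum>k\<in>J. K (f (r k)) z - h z"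
    have "K (\<lambda>z. \<Sum>k\<in>r ` J. f k z) = (\<lambda>z. \<Sum>k\<in>r ` J. K (f k) z)" using J by (intro Ksum) auto
    then have KA: "K (\<lambda>z. \<Sum>k\<in>r ` J. f k z) = ?A" by (simp add: sum.reindex[OF inj])
    have "?N ?A \<le> C * ?N (\<lambda>z. \<Sum>k\<in>r ` J. f k z)" unfolding KA[symmetric] using J by (intro C f) auto
    also have "\<dots> \<le> C * B" using J C by (intro mult_left_mono f) auto
    finally have NA: "?N ?A \<le> C * B" .
    have bA: "box_finite lam ?A" unfolding KA[symmetric] using J by (intro bf Km f) auto
    have bd: "box_finite lam (\<lambda>z. K (f (r k)) z - h z)" for k by (intro box_finite_diff bf Km fm h)
    have bD: "box_finite lam ?D" "?N ?D \<le> (\<Sum>k\<in>J. ?N (\<lambda>z. K (f (r k)) z - h z))"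
      using box_finite_sum[of J lam "\<lambda>k z. K (f (r k)) z - h z"] bd by auto
    have "(\<Sum>k\<in>J. ?N (\<lambda>z. K (f (r k)) z - h z)) \<le> (\<Sum>k\<in>J. e / 2)"
      using k0 by (intro sum_mono) (auto simp: J_def less_imp_le)
    then have ND: "?N ?D \<le> real n * (e / 2)" using bD(2) J(2) by simp
    have hD: "h z = of_real (1 / real n) * (?A z - ?D z)" for z
      using n0 by (simp add: sum_subtractf J(2))
    have "?N h = ?N (\<lambda>z. of_real (1 / real n) * (?A z - ?D z))" using hD by simp
    also have "\<dots> \<le> cmod (of_real (1 / real n)) * ?N (\<lambda>z. ?A z - ?D z)"
      by (rule morrey_norm_cmult[OF box_finite_diff[OF bA bD(1)]])
    also have "\<dots> \<le> (1 / real n) * (C * B + real n * (e / 2))"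
      using morrey_norm_diff[OF bA bD(1)] NA ND n0 by (simp add: norm_divide divide_right_mono)
    also have "\<dots> = C * B / real n + e / 2" using n0 by (simp add: field_simps)
    also have "C * B / real n \<le> e / 2" using n n0 e by (simp add: field_simps)
    finally show ?thesis by simp
  qed
  then have h0: "?N h = 0" using morrey_norm_nonneg[of lam h] field_le_epsilon[of "?N h" 0] by force
  have "(\<lambda>k. ?N (K (f (r k)))) \<longlonglongrightarrow> 0"
  proof (rule tendsto_sandwich[OF _ _ tendsto_const lim])
    show "\<forall>\<^sub>F k in sequentially. 0 \<le> ?N (K (f (r k)))" by (simp add: morrey_norm_nonneg)
    show "\<forall>\<^sub>F k in sequentially. ?N (K (f (r k))) \<le> ?N (\<lambda>z. K (f (r k)) z - h z)"
      using morrey_norm_le_diff[OF bf[OF Km[OF fm(1)]] bf[OF h]] h0 by (intro always_eventually allI) simp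
  qed
  with r show thesis by (rule that)
qed

text \<open>256 is 8, the norm bound of the test functions, times 32 from the lower bound at a
  point. The estimate is pointwise in \<open>z0\<close> and presupposes no bound on
  \<open>g\<close>, so it can be used to prove one.\<close>

lemma multiplier_bound:
  assumes lam: "0 < lam" "lam < 1" and g: "g holomorphic_on ball 0 1" and Ig: "bounded_op_on lam (Ig g)"
    and K: "compact_op_on lam K" and C: "0 \<le> C"
    "\<And>f. f \<in> morrey lam \<Longrightarrow> morrey_norm lam (\<lambda>z. Ig g f z - K f z) \<le> C * morrey_norm lam f"
    and z0: "z0 \<in> ball 0 1"
  shows "cmod (g z0) \<le> 256 * C"
proof -
  let ?N = "morrey_norm lam"
  note bf = morrey_box_finite[OF lam]
  \<comment> \<open>At most \<open>1/8\<close>, as the lower bound at \<open>w\<close> asks for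
    \<open>|w| >= 7/8\<close>; at most \<open>1 - |z0|\<close>, so that \<open>z0\<close> lies on or
    inside every circle used.\<close>
  define d0 where "d0 = min (1/8) (1 - cmod z0)"
  have "d0 \<le> 1 - cmod z0" unfolding d0_def by (rule min.cobounded2)
  then have d0: "0 < d0" "d0 \<le> 1/8" "cmod z0 \<le> 1 - d0"
    using z0 unfolding d0_def by (simp, intro min.cobounded1, linarith)
  \<comment> \<open>Solves \<open>q powr (lam/2) = 1/2\<close>, so that the distances
    \<open>d k\<close> decrease exactly as fast as the bound for sums of test functions
    demands.\<close>
  define q where "q = (1/2::real) powr (2 / lam)"
  have q: "0 < q" "q \<le> 1" using lam by (auto simp: q_def powr_le1)
  define d where "d k = d0 * q ^ k" for k :: nat
  have d: "0 < d k" "d k \<le> d0" for k using d0 q by (auto simp: d_def power_le_one mult_left_le)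
  have "\<exists>w. cmod w = 1 - d k \<and> cmod (g z0) \<le> cmod (g w)" for k
    using d[of k] d0 by (intro maximum_modulus_circle g z0) auto
  then obtain w where w: "\<And>k. cmod (w k) = 1 - d k" "\<And>k. cmod (g z0) \<le> cmod (g (w k))" by metis
  have w1: "cmod (w k) < 1" "7/8 \<le> cmod (w k)" for k using w(1)[of k] d[of k] d0 by auto
  have dec: "(1 - cmod (w (Suc k))) powr (lam/2) \<le> (1 - cmod (w k)) powr (lam/2) / 2" for k
  proof -
    have "d (Suc k) powr (lam/2) = d k powr (lam/2) * q powr (lam/2)"
      using d[of k] q by (simp add: d_def powr_mult mult_ac)
    also have "q powr (lam/2) = 1/2" using lam by (simp add: q_def powr_powr)
    finally show ?thesis by (simp add: w(1))
  qed
  define f where "f k = cauchy_fn lam (w k)" for k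
  note fs = cauchy_fn_sum[OF lam, of w, OF w1(1) dec]
  have fm: "f k \<in> morrey lam" "?N (f k) \<le> 8" for k
    using fs[of "{k}"] by (auto simp: f_def)
  obtain r where r: "strict_mono r" "(\<lambda>k. ?N (K (f (r k)))) \<longlonglongrightarrow> 0"
    using compact_op_null_sequence[OF lam K, of f 8] fs unfolding f_def by blast
  have Igm: "Ig g f \<in> morrey lam" if "f \<in> morrey lam" for f using Ig that by (simp add: bounded_op_on_def)
  have Km: "K f \<in> morrey lam" if "f \<in> morrey lam" for f using K that by (simp add: compact_op_on_def)
  have le: "cmod (g z0) \<le> 32 * (C * 8 + ?N (K (f (r k))))" for k
  proof -
    let ?h = "Ig g (f (r k))"
    have fh: "f (r k) holomorphic_on ball 0 1" unfolding f_def by (rule cauchy_fn_basic[OF w1(1)])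
    have bI: "box_finite lam ?h" "box_finite lam (K (f (r k)))" by (intro bf Igm Km fm)+
    have "box_bound lam ?h (?N ?h)"
      using box_bound_morrey_norm[OF bI(1)] by (simp add: Ig_deriv(3)[OF fh g])
    then have 1: "cmod (g (w (r k))) \<le> 32 * ?N ?h"
      by (rule test_function_lower_bound[OF lam g w1]) (use Ig_deriv(2)[OF fh g] in \<open>simp add: f_def\<close>)
    have 2: "?N ?h \<le> ?N (\<lambda>z. ?h z - K (f (r k)) z) + ?N (K (f (r k)))"
      by (rule morrey_norm_le_diff[OF bI])
    have 3: "?N (\<lambda>z. ?h z - K (f (r k)) z) \<le> C * 8"
      using C(2)[OF fm(1)[of "r k"]] mult_left_mono[OF fm(2)[of "r k"] C(1)] by linarith
    have "?N ?h \<le> C * 8 + ?N (K (f (r k)))" using 2 3 by linarith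
    then have "32 * ?N ?h \<le> 32 * (C * 8 + ?N (K (f (r k))))" by (rule mult_left_mono) simp
    then show ?thesis using w(2)[of "r k"] 1 by linarith
  qed
  have "(\<lambda>k. 32 * (C * 8 + ?N (K (f (r k))))) \<longlonglongrightarrow> 32 * (C * 8 + 0)"
    by (intro tendsto_intros r)
  then have "cmod (g z0) \<le> 32 * (C * 8 + 0)"
    by (rule tendsto_lowerbound) (use le in auto)
  then show ?thesis by simp
qed

lemma compact_op_zero: "lam < 1 \<Longrightarrow> compact_op_on lam (\<lambda>f z. 0)"
proof -
  assume lam: "lam < 1"
  have z: "(\<lambda>z. 0) \<in> morrey lam" by (rule continuous_closed_disc_in_morrey[OF lam]) auto
  have "morrey_norm lam (\<lambda>z. 0) = 0"
    using morrey_norm_le[OF box_bound_const, of lam 0] morrey_norm_nonneg[of lam "\<lambda>z. 0"] by simp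
  note n = this
  show ?thesis unfolding compact_op_on_def
  proof (intro conjI allI impI ballI)
    show "\<exists>r h. strict_mono (r :: nat \<Rightarrow> nat) \<and> h \<in> morrey lam \<and> (\<lambda>k. morrey_norm lam (\<lambda>z. 0 - h z)) \<longlonglongrightarrow> 0"
      using z n by (intro exI[of _ id] exI[of _ "\<lambda>z. 0"]) (simp add: strict_mono_def)
  qed (use z in simp_all)
qed

lemma morrey_norm_Ig_le:
  assumes lam: "0 < lam" "lam < 1" and g: "g holomorphic_on ball 0 1" "\<And>z. z \<in> ball 0 1 \<Longrightarrow> cmod (g z) \<le> G" "0 \<le> G"
    and f: "f \<in> morrey lam"
  shows "morrey_norm lam (Ig g f) \<le> G * morrey_norm lam f"
proof -
  have b: "box_bound lam f (morrey_norm lam f - cmod (f 0))"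
    by (rule box_bound_morrey_norm[OF morrey_box_finite[OF lam f]])
  then have fh: "f holomorphic_on ball 0 1" by (simp add: box_bound_def)
  have "box_bound lam (Ig g f) (G * (morrey_norm lam f - cmod (f 0)))"
    using b unfolding box_bound_def
    by (auto intro!: arc_bound_mono_deriv[OF _ fh g(3)] Ig_deriv[OF fh g(1)] mult_right_mono g simp: Ig_deriv(2)[OF fh g(1)] norm_mult mult.commute g(3))
  from morrey_norm_le[OF this] have "morrey_norm lam (Ig g f) \<le> G * (morrey_norm lam f - cmod (f 0))"
    by (simp add: Ig_deriv(3)[OF fh g(1)])
  also have "\<dots> \<le> G * morrey_norm lam f" using g(3) by (intro mult_left_mono) auto
  finally show ?thesis .
qed

theorem theorem5:
  fixes lam :: real
  assumes "0 < lam" and "lam < 1"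
  shows "\<exists>C1 C2. 0 < C1 \<and> 0 < C2 \<and>
    (\<forall>g. g holomorphic_on ball 0 1 \<and> bounded_op_on lam (Ig g) \<longrightarrow>
       bounded (g ` ball 0 1) \<and>
       C1 * (SUP z\<in>ball 0 1. cmod (g z)) \<le> ess_norm lam (Ig g) \<and>
       ess_norm lam (Ig g) \<le> C2 * (SUP z\<in>ball 0 1. cmod (g z)))"
\<comment> \<open>The constants come from the pointwise bound \<open>|g z| <= 256 * C\<close> and
  from the choice \<open>K = 0\<close>; neither depends on \<open>lam\<close>.\<close>
proof (rule exI[of _ "1/256"], rule exI[of _ 1], intro conjI allI impI)
  fix g assume "g holomorphic_on ball 0 1 \<and> bounded_op_on lam (Ig g)"
  then have g: "g holomorphic_on ball 0 1" and Ig: "bounded_op_on lam (Ig g)" by auto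
  note lam = assms
  note bf = morrey_box_finite[OF lam]
  let ?N = "morrey_norm lam"
  have Igm: "Ig g f \<in> morrey lam" if "f \<in> morrey lam" for f using Ig that by (simp add: bounded_op_on_def)
  obtain CI0 where CI0: "\<And>f. f \<in> morrey lam \<Longrightarrow> ?N (Ig g f) \<le> CI0 * ?N f"
    using Ig unfolding bounded_op_on_def by blast
  define CI where "CI = max CI0 0"
  have CI: "0 \<le> CI" "\<And>f. f \<in> morrey lam \<Longrightarrow> ?N (Ig g f) \<le> CI * ?N f"
  proof -
    fix f assume f: "f \<in> morrey lam"
    have "CI0 * ?N f \<le> CI * ?N f" by (intro mult_right_mono) (auto simp: CI_def morrey_norm_nonneg)
    then show "?N (Ig g f) \<le> CI * ?N f" using CI0[OF f] by linarith
  qed (simp add: CI_def)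
  \<comment> \<open>The zero operator is compact, so the pointwise bound already applies to
    \<open>Ig g\<close> itself. Boundedness of \<open>g\<close> comes first, since otherwise the
    supremum of \<open>|g|\<close> would be a junk value.\<close>
  have gb: "cmod (g z) \<le> 256 * CI" if "z \<in> ball 0 1" for z
    by (rule multiplier_bound[OF lam g Ig compact_op_zero[OF lam(2)] CI(1) _ that]) (use CI(2) in simp)
  show "bounded (g ` ball 0 1)" using gb by (auto simp: bounded_iff intro!: exI[of _ "256 * CI"])
  define G where "G = (SUP z\<in>ball 0 1. cmod (g z))"
  have bdd: "bdd_above ((\<lambda>z. cmod (g z)) ` ball 0 1)" using gb by (rule bdd_aboveI2)
  have gG: "cmod (g z) \<le> G" if "z \<in> ball 0 1" for z unfolding G_def by (rule cSUP_upper[OF that bdd])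
  have G0: "0 \<le> G" by (rule order_trans[OF norm_ge_zero gG[of 0]]) simp
  have op: "G / 256 \<le> op_norm lam (\<lambda>f z. Ig g f z - K f z)" if K: "compact_op_on lam K" for K
    unfolding op_norm_def
  proof (rule cInf_greatest)
    \<comment> \<open>A real infimum over the empty set is unspecified; the bound for
      \<open>K\<close> supplies a member of the set.\<close>
    obtain CK where CK: "0 \<le> CK" "\<And>f. f \<in> morrey lam \<Longrightarrow> ?N (K f) \<le> CK * ?N f"
      using compact_op_bounded[OF lam K] by blast
    have Km: "K f \<in> morrey lam" if "f \<in> morrey lam" for f using K that by (simp add: compact_op_on_def)
    have "?N (\<lambda>z. Ig g f z - K f z) \<le> (CI + CK) * ?N f" if f: "f \<in> morrey lam" for f
      using morrey_norm_diff[OF bf[OF Igm[OF f]] bf[OF Km[OF f]]] CI(2)[OF f] CK(2)[OF f] by (simp add: distrib_right)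
    then show "{C. 0 \<le> C \<and> (\<forall>f\<in>morrey lam. ?N (\<lambda>z. Ig g f z - K f z) \<le> C * ?N f)} \<noteq> {}"
      using CI(1) CK(1) by (auto intro!: exI[of _ "CI + CK"])
    fix C assume "C \<in> {C. 0 \<le> C \<and> (\<forall>f\<in>morrey lam. ?N (\<lambda>z. Ig g f z - K f z) \<le> C * ?N f)}"
    then have C: "0 \<le> C" "\<And>f. f \<in> morrey lam \<Longrightarrow> ?N (\<lambda>z. Ig g f z - K f z) \<le> C * ?N f" by auto
    have "G \<le> 256 * C" unfolding G_def
      by (rule cSUP_least) (auto intro!: multiplier_bound[OF lam g Ig K C])
    then show "G / 256 \<le> C" by simp
  qed
  have ne: "{op_norm lam (\<lambda>f z. Ig g f z - K f z) | K. compact_op_on lam K} \<noteq> {}"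
    using compact_op_zero[OF lam(2)] by auto
  have "G / 256 \<le> ess_norm lam (Ig g)"
    unfolding ess_norm_def using op by (intro cInf_greatest ne) auto
  then show "1/256 * (SUP z\<in>ball 0 1. cmod (g z)) \<le> ess_norm lam (Ig g)" by (simp add: G_def)
  have "ess_norm lam (Ig g) \<le> op_norm lam (\<lambda>f z. Ig g f z - 0)"
    unfolding ess_norm_def
  proof (rule cInf_lower)
    show "op_norm lam (\<lambda>f z. Ig g f z - 0) \<in> {op_norm lam (\<lambda>f z. Ig g f z - K f z) | K. compact_op_on lam K}"
      using compact_op_zero[OF lam(2)] by (auto intro!: exI[of _ "\<lambda>f z. 0"])
    show "bdd_below {op_norm lam (\<lambda>f z. Ig g f z - K f z) | K. compact_op_on lam K}"
      unfolding bdd_below_def using op by (intro exI[of _ "G / 256"]) auto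
  qed
  also have "\<dots> \<le> G"
    unfolding op_norm_def
  proof (rule cInf_lower)
    show "G \<in> {C. 0 \<le> C \<and> (\<forall>f\<in>morrey lam. ?N (\<lambda>z. Ig g f z - 0) \<le> C * ?N f)}"
      using G0 morrey_norm_Ig_le[OF lam g gG G0] by simp
  qed (auto simp: bdd_below_def)
  finally show "ess_norm lam (Ig g) \<le> 1 * (SUP z\<in>ball 0 1. cmod (g z))" by (simp add: G_def)
qed simp_all

end
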